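(* Let $1<p<\infty$, $1<s<\infty$, let $X$ be a Banach space of analytic functions in $\mathbb{D}$ with $\Lambda^s_{1/s}\subseteq X\subseteq\mathcal{B}$, and let $\mu$ be a finite positive Borel measure on $[0,1)$. Let $q$ be the real number satisfying $\frac1p+\frac1q=1$. Then the following conditions are equivalent: (i) $\mathcal{C}_\mu$ is a bounded operator from $B_p$ into $X$; (ii) $\mu$ is a $\frac1q$-logarithmic $1$-Carleson measure.
   Context: $\mathbb{D}$ is the open unit disk of $\mathbb{C}$ and $H(\mathbb{D})$ is the space of functions analytic in $\mathbb{D}$. A Banach space of analytic functions in $\mathbb{D}$ is, as usual, a Banach space whose elements are functions in $H(\mathbb{D})$ (with the usual vector space operations) and on which the point evaluations at points of $\mathbb{D}$ are continuous. For a finite positive Borel measure $\mu$ on $[0,1)$ and an integer $n\ge 0$, let $\mu_n=\int_{[0,1)}t^n\,\mathrm{d}\mu(t)$. For $f(z)=\sum_{n=0}^\infty a_nz^n$ in $H(\mathbb{D})$, the Cesàro-like operator $\mathcal{C}_\mu$ is $$\mathcal{C}_\mu(f)(z)=\sum_{n=0}^\infty\Big(\mu_n\sum_{k=0}^n a_k\Big)z^n,\quad z\in\mathbb{D}.$$ For $p>1$, the Besov space $B_p$ consists of $f\in H(\mathbb{D})$ with $$\|f\|_{B_p}=|f(0)|+\Big(\int_{\mathbb{D}}|f'(z)|^p(1-|z|^2)^{p-2}\,\mathrm{d}A(z)\Big)^{1/p}<\infty,$$ where $\mathrm{d}A$ is area measure normalized so that $A(\mathbb{D})=1$. The Bloch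 space $\mathcal{B}$ consists of $f\in H(\mathbb{D})$ with $\|f\|_{\mathcal{B}}=|f(0)|+\sup_{z\in\mathbb{D}}(1-|z|^2)|f'(z)|<\infty$. For $s>1$, the mean Lipschitz space $\Lambda^s_{1/s}$ consists of $f\in H(\mathbb{D})$ with $$\|f\|_{\Lambda^s_{1/s}}=|f(0)|+\sup_{0<r<1}(1-r)^{1-\frac1s}M_s(r,f')<\infty,\qquad M_s(r,f')=\Big(\frac1{2\pi}\int_0^{2\pi}|f'(re^{i\theta})|^s\,\mathrm{d}\theta\Big)^{1/s}.$$ For $0\le\alpha<\infty$ and $0<\sigma<\infty$, a finite positive Borel measure $\nu$ on $[0,1)$ is an $\alpha$-logarithmic $\sigma$-Carleson measure if $$\sup_{t\in[0,1)}\frac{\nu([t,1))\big(\log\frac{e}{1-t}\big)^\alpha}{(1-t)^\sigma}<\infty.$$ *)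

theory Defs
  imports "HOL-Complex_Analysis.Complex_Analysis"
begin

abbreviation unit_disc :: "complex set" (\<open>\<D>\<close>)
  where "\<D> \<equiv> ball 0 1"

text \<open>
  An analytic function in the disc is represented by its extension by zero to the whole plane,
  so that equality of HOL functions is equality of functions on \<open>\<D>\<close> and the pointwise
  operations are those of the vector space \<open>H(\<D>)\<close>.
\<close>
definition hol_disc :: "(complex \<Rightarrow> complex) set"
  where "hol_disc = {f. f holomorphic_on \<D> \<and> (\<forall>z. z \<notin> \<D> \<longrightarrow> f z = 0)}"

text \<open>
  The metric of a norm \<open>N\<close> on \<open>X\<close>. Since \<open>N\<close> is arbitrary off \<open>X\<close>, whereas the locale
  \<open>Metric_space\<close> requires symmetry and nonnegativity on the whole type, the value is set to \<open>0\<close>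
  off \<open>X\<close>.
\<close>
definition norm_dist ::
  "(complex \<Rightarrow> complex) set \<Rightarrow> ((complex \<Rightarrow> complex) \<Rightarrow> real)
    \<Rightarrow> (complex \<Rightarrow> complex) \<Rightarrow> (complex \<Rightarrow> complex) \<Rightarrow> real"
  where "norm_dist X N f g = (if f \<in> X \<and> g \<in> X then N (\<lambda>z. f z - g z) else 0)"

definition normed_space_of_functions ::
  "(complex \<Rightarrow> complex) set \<Rightarrow> ((complex \<Rightarrow> complex) \<Rightarrow> real) \<Rightarrow> bool"
  where "normed_space_of_functions X N \<longleftrightarrow>
    (\<lambda>z. 0) \<in> X \<and>
    (\<forall>f\<in>X. \<forall>g\<in>X. (\<lambda>z. f z + g z) \<in> X) \<and>
    (\<forall>c. \<forall>f\<in>X. (\<lambda>z. c * f z) \<in> X) \<and>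
    (\<forall>f\<in>X. 0 \<le> N f) \<and>
    (\<forall>f\<in>X. N f = 0 \<longleftrightarrow> f = (\<lambda>z. 0)) \<and>
    (\<forall>c. \<forall>f\<in>X. N (\<lambda>z. c * f z) = cmod c * N f) \<and>
    (\<forall>f\<in>X. \<forall>g\<in>X. N (\<lambda>z. f z + g z) \<le> N f + N g)"

definition banach_space_of_analytic_functions ::
  "(complex \<Rightarrow> complex) set \<Rightarrow> ((complex \<Rightarrow> complex) \<Rightarrow> real) \<Rightarrow> bool"
  where "banach_space_of_analytic_functions X N \<longleftrightarrow>
    X \<subseteq> hol_disc \<and>
    normed_space_of_functions X N \<and>
    Metric_space.mcomplete X (norm_dist X N) \<and>
    (\<forall>z\<in>\<D>. continuous_map (Metric_space.mtopology X (norm_dist X N)) euclidean (\<lambda>f. f z))"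

lemma Metric_space_norm_dist:
  assumes "normed_space_of_functions X N"
  shows "Metric_space X (norm_dist X N)"
proof -
  have add: "(\<lambda>z. f z + g z) \<in> X" "N (\<lambda>z. f z + g z) \<le> N f + N g" if "f \<in> X" "g \<in> X" for f g
    using assms that unfolding normed_space_of_functions_def by blast+
  have scale: "(\<lambda>z. c * f z) \<in> X" "N (\<lambda>z. c * f z) = cmod c * N f" if "f \<in> X" for c f
    using assms that unfolding normed_space_of_functions_def by blast+
  have nonneg: "0 \<le> N f" and zero: "N f = 0 \<longleftrightarrow> f = (\<lambda>z. 0)" if "f \<in> X" for f
    using assms that unfolding normed_space_of_functions_def by blast+
  have diff: "(\<lambda>z. f z - g z) \<in> X" if "f \<in> X" "g \<in> X" for f g
    using add(1)[OF that(1) scale(1)[OF that(2), of "-1"]] by simp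
  show ?thesis
  proof
    fix f g show "0 \<le> norm_dist X N f g"
      by (simp add: norm_dist_def nonneg diff)
  next
    fix f g show "norm_dist X N f g = norm_dist X N g f"
      using scale(2)[OF diff, of f g "-1"] by (auto simp: norm_dist_def)
  next
    fix f g assume "f \<in> X" "g \<in> X"
    then show "norm_dist X N f g = 0 \<longleftrightarrow> f = g"
      by (auto simp: norm_dist_def zero diff fun_eq_iff)
  next
    fix f g h assume "f \<in> X" "g \<in> X" "h \<in> X"
    then show "norm_dist X N f h \<le> norm_dist X N f g + norm_dist X N g h"
      using add(2)[OF diff diff, of f g g h] by (simp add: norm_dist_def)
  qed
qed

definition bounded_operator ::
  "(complex \<Rightarrow> complex) set \<Rightarrow> ((complex \<Rightarrow> complex) \<Rightarrow> real)
    \<Rightarrow> (complex \<Rightarrow> complex) set \<Rightarrow> ((complex \<Rightarrow> complex) \<Rightarrow> real)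
    \<Rightarrow> ((complex \<Rightarrow> complex) \<Rightarrow> complex \<Rightarrow> complex) \<Rightarrow> bool"
  where "bounded_operator X N Y M T \<longleftrightarrow>
    (\<forall>f\<in>X. T f \<in> Y) \<and>
    (\<forall>f\<in>X. \<forall>g\<in>X. T (\<lambda>z. f z + g z) = (\<lambda>z. T f z + T g z)) \<and>
    (\<forall>c. \<forall>f\<in>X. T (\<lambda>z. c * f z) = (\<lambda>z. c * T f z)) \<and>
    (\<exists>C. \<forall>f\<in>X. M (T f) \<le> C * N f)"

definition taylor_coeff :: "(complex \<Rightarrow> complex) \<Rightarrow> nat \<Rightarrow> complex"
  where "taylor_coeff f n = (deriv ^^ n) f 0 / fact n"

text \<open>
  For \<open>f\<close> in \<open>H(\<D>)\<close> and \<open>\<mu>\<close> finite on \<open>[0,1)\<close> the series below converges on all of \<open>\<D>\<close>.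
\<close>
definition cesaro_op :: "real measure \<Rightarrow> (complex \<Rightarrow> complex) \<Rightarrow> complex \<Rightarrow> complex"
  where "cesaro_op \<mu> f z =
    (if z \<in> \<D>
     then \<Sum>n. (of_real (LINT t|\<mu>. t ^ n) * (\<Sum>k\<le>n. taylor_coeff f k)) * z ^ n
     else 0)"

text \<open>
  The spaces below are sets of functions in \<open>H(\<D>)\<close> of finite norm. As the integrands are
  nonnegative and continuous on \<open>\<D>\<close>, a finite integral amounts to integrability, and a finite
  supremum to boundedness above.
\<close>

definition disc_area :: "complex measure"
  where "disc_area = uniform_measure lborel \<D>"

definition besov_integrand :: "real \<Rightarrow> (complex \<Rightarrow> complex) \<Rightarrow> complex \<Rightarrow> real"
  where "besov_integrand p f z = cmod (deriv f z) powr p * (1 - (cmod z)\<^sup>2) powr (p - 2)"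

definition besov :: "real \<Rightarrow> (complex \<Rightarrow> complex) set"
  where "besov p = {f \<in> hol_disc. set_integrable disc_area \<D> (besov_integrand p f)}"

definition besov_norm :: "real \<Rightarrow> (complex \<Rightarrow> complex) \<Rightarrow> real"
  where "besov_norm p f =
    cmod (f 0) + (LINT z:\<D>|disc_area. besov_integrand p f z) powr (1 / p)"

definition bloch :: "(complex \<Rightarrow> complex) set"
  where "bloch = {f \<in> hol_disc. bdd_above ((\<lambda>z. (1 - (cmod z)\<^sup>2) * cmod (deriv f z)) ` \<D>)}"

definition integral_mean :: "real \<Rightarrow> real \<Rightarrow> (complex \<Rightarrow> complex) \<Rightarrow> real"
  where "integral_mean s r g =
    (1 / (2 * pi) * integral {0..2 * pi} (\<lambda>\<theta>. cmod (g (of_real r * cis \<theta>)) powr s)) powr (1 / s)"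

text \<open>The mean Lipschitz space \<open>\<Lambda>\<close> with integrability exponent \<open>s\<close> and smoothness \<open>1/s\<close>.\<close>
definition mean_lipschitz :: "real \<Rightarrow> (complex \<Rightarrow> complex) set"
  where "mean_lipschitz s = {f \<in> hol_disc.
    bdd_above ((\<lambda>r. (1 - r) powr (1 - 1 / s) * integral_mean s r (deriv f)) ` {0<..<1})}"

definition finite_borel_measure_01 :: "real measure \<Rightarrow> bool"
  where "finite_borel_measure_01 \<mu> \<longleftrightarrow>
    sets \<mu> = sets (restrict_space borel {0..<1}) \<and> finite_measure \<mu>"

definition log_carleson :: "real \<Rightarrow> real \<Rightarrow> real measure \<Rightarrow> bool"
  where "log_carleson \<alpha> \<sigma> \<nu> \<longleftrightarrow>
    bdd_above ((\<lambda>t. measure \<nu> {t..<1} * ln (exp 1 / (1 - t)) powr \<alpha> / (1 - t) powr \<sigma>) ` {0..<1})"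

end

theory Submission imports Defs begin

text \<open>
The operator acts through the quotient \<open>F(w) = f(w) / (1 - w)\<close>, whose Taylor coefficients are the
partial sums of those of \<open>f\<close>: on the disc \<open>C\<^sub>\<mu> f (z) = \<integral> F(t z) d\<mu>(t)\<close> and
\<open>(C\<^sub>\<mu> f)' (z) = \<integral> t F'(t z) d\<mu>(t)\<close> (lemmas \<open>cesaro_op_eq_integral\<close> and \<open>cesaro_op_has_derivative\<close>).
Everything else measures how fast \<open>F'\<close> can grow. Write \<open>L(r) = log (e / (1 - r))\<close>.

Carleson condition implies boundedness. A function in \<open>B\<^sub>p\<close> grows at most like
\<open>L(|w|) powr (1/q)\<close> (lemma \<open>besov_growth\<close>), so by a Cauchy estimate \<open>F'(w)\<close> is at most a constant times
\<open>L(|w|) powr (1/q) / ((1 - |w|) |1 - w|)\<close>. The power \<open>1/q\<close> of the logarithm is the one that the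
measure of \<open>[t,1)\<close> compensates, and a decomposition of \<open>[0,1)\<close> into dyadic pieces gives, for every
\<open>b\<close> in \<open>[0,1)\<close>, the pointwise bound
\<open>|(C\<^sub>\<mu> f)' (z)| \<le> C (1 - |z|) powr (b - 1) |1 - z| powr (- b)\<close> (lemma \<open>cesaro_deriv_bound\<close>).
The functions with such a bound form a Banach space under a weighted sup norm. If \<open>b s > 1\<close> it lies in the
mean Lipschitz space, because the means of powers of \<open>|1 - z|\<close> over circles are known up to
constants. The weighted norm is a supremum, so completeness is elementary and the image of
the operator is estimated pointwise.

Boundedness implies the Carleson condition. The functions \<open>1 - log (1 - a z)\<close> have Besov norm at most
\<open>C L(a) powr (1/p)\<close> (lemma \<open>log_test_besov\<close>), while for them the integral for \<open>(C\<^sub>\<mu> f)' (a)\<close> has a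
nonnegative integrand that, for \<open>a \<ge> 1/2\<close>, is at least a multiple of \<open>L(a) / (1 - a)\<^sup>2\<close> on \<open>[a,1)\<close>. Comparison
with the Bloch norm bounds the measure of \<open>[a,1)\<close> by a multiple of \<open>(1 - a) L(a) powr (1/p - 1)\<close>, and \<open>1/p - 1 = - 1/q\<close>.

Both growth of Besov functions and the norms of the test functions rest on a single area integral
(theorem \<open>Forelli_Rudin_log\<close>), used with the exponents \<open>q\<close> and \<open>p\<close> respectively.

The norm of \<open>X\<close> is unspecified. It enters only through theorem \<open>continuous_inclusion\<close>, a form of the
closed graph theorem: an inclusion between Banach spaces of functions with continuous evaluations is
bounded. It is applied once to an inclusion into \<open>X\<close> and once to the inclusion of \<open>X\<close> in the Bloch space.
\<close>

section \<open>Inclusions between Banach spaces of analytic functions are bounded\<close>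

lemma normed_space_of_functionsD:
  assumes "normed_space_of_functions X N"
  shows "(\<lambda>z. 0) \<in> X"
    and "\<And>f g. f \<in> X \<Longrightarrow> g \<in> X \<Longrightarrow> (\<lambda>z. f z + g z) \<in> X"
    and "\<And>c f. f \<in> X \<Longrightarrow> (\<lambda>z. c * f z) \<in> X"
    and "\<And>f g. f \<in> X \<Longrightarrow> g \<in> X \<Longrightarrow> (\<lambda>z. f z - g z) \<in> X"
    and "\<And>f. f \<in> X \<Longrightarrow> 0 \<le> N f"
    and "N (\<lambda>z. 0) = 0"
    and "\<And>f. f \<in> X \<Longrightarrow> N f = 0 \<Longrightarrow> f = (\<lambda>z. 0)"
    and "\<And>c f. f \<in> X \<Longrightarrow> N (\<lambda>z. c * f z) = cmod c * N f"
    and "\<And>f g. f \<in> X \<Longrightarrow> g \<in> X \<Longrightarrow> N (\<lambda>z. f z + g z) \<le> N f + N g"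
    and "\<And>f g. f \<in> X \<Longrightarrow> g \<in> X \<Longrightarrow> N (\<lambda>z. f z - g z) \<le> N f + N g"
    and "\<And>f g. f \<in> X \<Longrightarrow> g \<in> X \<Longrightarrow> N (\<lambda>z. f z - g z) = N (\<lambda>z. g z - f z)"
proof -
  show zero: "(\<lambda>z. 0) \<in> X" using assms unfolding normed_space_of_functions_def by blast
  show add: "\<And>f g. f \<in> X \<Longrightarrow> g \<in> X \<Longrightarrow> (\<lambda>z. f z + g z) \<in> X"
    using assms unfolding normed_space_of_functions_def by blast
  show scale: "\<And>c f. f \<in> X \<Longrightarrow> (\<lambda>z. c * f z) \<in> X"
    using assms unfolding normed_space_of_functions_def by blast
  show diff: "(\<lambda>z. f z - g z) \<in> X" if "f \<in> X" "g \<in> X" for f g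
    using add[OF that(1) scale[OF that(2), of "-1"]] by simp
  show "\<And>f. f \<in> X \<Longrightarrow> 0 \<le> N f"
    using assms unfolding normed_space_of_functions_def by blast
  show "N (\<lambda>z. 0) = 0" using zero assms unfolding normed_space_of_functions_def by blast
  show "\<And>f. f \<in> X \<Longrightarrow> N f = 0 \<Longrightarrow> f = (\<lambda>z. 0)"
    using assms unfolding normed_space_of_functions_def by blast
  show hom: "\<And>c f. f \<in> X \<Longrightarrow> N (\<lambda>z. c * f z) = cmod c * N f"
    using assms unfolding normed_space_of_functions_def by blast
  show tri: "\<And>f g. f \<in> X \<Longrightarrow> g \<in> X \<Longrightarrow> N (\<lambda>z. f z + g z) \<le> N f + N g"
    using assms unfolding normed_space_of_functions_def by blast
  show "N (\<lambda>z. f z - g z) \<le> N f + N g" if "f \<in> X" "g \<in> X" for f g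
    using tri[OF that(1) scale[OF that(2), of "-1"]] hom[OF that(2), of "-1"] by simp
  show "N (\<lambda>z. f z - g z) = N (\<lambda>z. g z - f z)" if "f \<in> X" "g \<in> X" for f g
    using hom[OF diff[OF that(1) that(2)], of "-1"] by simp
qed

lemma limitin_norm_dist:
  assumes "normed_space_of_functions X N" "\<And>n. f n \<in> X" "g \<in> X"
  shows "limitin (Metric_space.mtopology X (norm_dist X N)) f g sequentially \<longleftrightarrow>
         (\<lambda>n. N (\<lambda>z. f n z - g z)) \<longlonglongrightarrow> 0"
proof -
  interpret Metric_space X "norm_dist X N" by (rule Metric_space_norm_dist) fact
  note ns = normed_space_of_functionsD[OF assms(1)]
  show ?thesis
    using assms ns(5)[OF ns(4)[OF assms(2) assms(3)]]
    by (simp add: limit_metric_sequentially LIMSEQ_iff norm_dist_def)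
qed

lemma banach_space_of_analytic_functions_complete:
  fixes f :: "nat \<Rightarrow> complex \<Rightarrow> complex"
  assumes X: "banach_space_of_analytic_functions X N" and f: "\<And>n. f n \<in> X"
    and Cauchy: "\<And>e. 0 < e \<Longrightarrow> \<exists>n0. \<forall>m\<ge>n0. \<forall>n\<ge>n0. N (\<lambda>z. f m z - f n z) < e"
  obtains g where "g \<in> X" "(\<lambda>n. N (\<lambda>z. f n z - g z)) \<longlonglongrightarrow> 0"
proof -
  have ns: "normed_space_of_functions X N"
    using X by (simp add: banach_space_of_analytic_functions_def)
  interpret Metric_space X "norm_dist X N" by (rule Metric_space_norm_dist) fact
  have "MCauchy f"
    unfolding MCauchy_def using f Cauchy by (auto simp: norm_dist_def)
  then obtain g where "limitin mtopology f g sequentially"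
    using X by (auto simp: banach_space_of_analytic_functions_def mcomplete_def)
  moreover from this have "g \<in> X" by (simp add: limitin_metric)
  ultimately show ?thesis
    using limitin_norm_dist[OF ns, of f g] f that by blast
qed

lemma banach_space_of_analytic_functions_pointwise:
  assumes X: "banach_space_of_analytic_functions X N" and f: "\<And>n. f n \<in> X" and g: "g \<in> X"
    and lim: "(\<lambda>n. N (\<lambda>z. f n z - g z)) \<longlonglongrightarrow> 0"
  shows "(\<lambda>n. f n z) \<longlonglongrightarrow> g z"
proof (cases "z \<in> \<D>")
  case True
  have ns: "normed_space_of_functions X N"
    using X by (simp add: banach_space_of_analytic_functions_def)
  have "continuous_map (Metric_space.mtopology X (norm_dist X N)) euclidean (\<lambda>f. f z)"
    using X True by (simp add: banach_space_of_analytic_functions_def)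
  moreover have "limitin (Metric_space.mtopology X (norm_dist X N)) f g sequentially"
    using lim limitin_norm_dist[OF ns, of f g] f g by blast
  ultimately have "limitin euclidean ((\<lambda>f. f z) \<circ> f) (g z) sequentially"
    by (rule continuous_map_limit)
  then show ?thesis by (simp add: o_def)
next
  case False
  then have "f n z = 0" "g z = 0" for n
    using X f[of n] g by (auto simp: banach_space_of_analytic_functions_def hol_disc_def)
  then show ?thesis by simp
qed

text \<open>
The first half of the closed graph argument. The sets of functions of \<open>X\<close> with \<open>M\<close>-norm at most \<open>n\<close>
cover \<open>X\<close>, so by Baire the \<open>N\<close>-closure of one of them contains a ball. Differences of its elements then
approximate every small function in the norm of \<open>X\<close> with control of the norm of \<open>Y\<close>, and scaling makes the
control linear.
\<close>
lemma inclusion_almost_open: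
  assumes X: "banach_space_of_analytic_functions X N"
    and Y: "normed_space_of_functions Y M" and XY: "X \<subseteq> Y"
  shows "\<exists>K\<ge>0. \<forall>h\<in>X. \<forall>e>0. \<exists>u\<in>X. M u \<le> K * N h \<and> N (\<lambda>z. h z - u z) < e"
proof -
  have ns: "normed_space_of_functions X N"
    using X by (simp add: banach_space_of_analytic_functions_def)
  note nX = normed_space_of_functionsD[OF ns] and nY = normed_space_of_functionsD[OF Y]
  interpret Metric_space X "norm_dist X N" by (rule Metric_space_norm_dist) (rule ns)
  define A where "A n = {f \<in> X. M f \<le> real n}" for n
  have "mcomplete"
    using X by (simp add: banach_space_of_analytic_functions_def)
  have "\<exists>n. mtopology interior_of (mtopology closure_of A n) \<noteq> {}"
  proof (rule ccontr)
    assume "\<not> ?thesis"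
    then have "mtopology interior_of \<Union>(range (\<lambda>n. mtopology closure_of A n)) = {}"
      by (intro metric_Baire_category_alt \<open>mcomplete\<close>) auto
    moreover have "\<Union>(range (\<lambda>n. mtopology closure_of A n)) = X"
    proof
      show "\<Union>(range (\<lambda>n. mtopology closure_of A n)) \<subseteq> X"
        using closure_of_subset_topspace[of mtopology] by auto
      show "X \<subseteq> \<Union>(range (\<lambda>n. mtopology closure_of A n))"
      proof
        fix f assume f: "f \<in> X"
        then have "f \<in> A (nat \<lceil>M f\<rceil>)" by (simp add: A_def) linarith
        moreover have "A n \<subseteq> mtopology closure_of A n" for n
          by (rule closure_of_subset) (auto simp: A_def)
        ultimately show "f \<in> \<Union>(range (\<lambda>n. mtopology closure_of A n))" by auto
      qed
    qed
    moreover have "mtopology interior_of X = X" using interior_of_topspace[of mtopology] by simp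
    ultimately show False using nX(1) by auto
  qed
  then obtain n g where "g \<in> mtopology interior_of (mtopology closure_of A n)" by auto
  then obtain r where g: "g \<in> X" and r: "0 < r" and sub: "mball g r \<subseteq> mtopology closure_of A n"
    by (auto simp: in_interior_of_mball)
  have approx: "\<exists>a\<in>X. M a \<le> n \<and> N (\<lambda>z. f z - a z) < e"
    if "f \<in> X" "N (\<lambda>z. g z - f z) < r" "0 < e" for f and e :: real
  proof -
    have "f \<in> mtopology closure_of A n"
      using sub that g by (auto simp: norm_dist_def)
    then obtain a where "a \<in> A n" "norm_dist X N f a < e"
      using \<open>0 < e\<close> by (fastforce simp: metric_closure_of)
    then show ?thesis using that by (auto simp: A_def norm_dist_def)
  qed
  have small: "\<exists>u\<in>X. M u \<le> 2 * n \<and> N (\<lambda>z. h z - u z) < e"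
    if h: "h \<in> X" "N h < r" and e: "0 < e" for h e
  proof -
    have "N (\<lambda>z. g z - (g z + h z)) = N h"
      using nX(8)[OF h(1), of "-1"] by simp
    then obtain a where a: "a \<in> X" "M a \<le> n" "N (\<lambda>z. (g z + h z) - a z) < e / 2"
      using approx[OF nX(2)[OF g h(1)], of "e / 2"] h e by auto
    obtain b where b: "b \<in> X" "M b \<le> n" "N (\<lambda>z. g z - b z) < e / 2"
      using approx[OF g, of "e / 2"] e r nX(6) by auto
    have "N (\<lambda>z. ((g z + h z) - a z) - (g z - b z)) < e"
      using nX(10)[OF nX(4)[OF nX(2)[OF g h(1)] a(1)] nX(4)[OF g b(1)]] a(3) b(3) by linarith
    moreover have "(\<lambda>z. ((g z + h z) - a z) - (g z - b z)) = (\<lambda>z. h z - (a z - b z))"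
      by (simp add: fun_eq_iff)
    moreover have "M (\<lambda>z. a z - b z) \<le> 2 * n"
      using nY(10)[of a b] XY a b by (auto simp: subset_iff)
    ultimately show ?thesis using nX(4)[OF a(1) b(1)] by (intro bexI[of _ "\<lambda>z. a z - b z"]) auto
  qed
  show ?thesis
  proof (intro exI[of _ "4 * real n / r"] conjI ballI allI impI)
    show "0 \<le> 4 * real n / r" using r by simp
    fix h and e :: real
    assume h: "h \<in> X" and e: "0 < e"
    show "\<exists>u\<in>X. M u \<le> (4 * real n / r) * N h \<and> N (\<lambda>z. h z - u z) < e"
    proof (cases "N h = 0")
      case True
      then show ?thesis using nX(1,6,7) h e nY(6) by (intro bexI[of _ "\<lambda>z. 0"]) auto
    next
      case False
      then have pos: "0 < N h" using nX(5)[OF h] by simp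
      define c where "c = r / (2 * N h)"
      have c: "0 < c" using pos r by (simp add: c_def)
      have "N (\<lambda>z. of_real c * h z) = c * N h" using nX(8)[OF h, of "of_real c"] c by simp
      also have "\<dots> < r" using pos r by (simp add: c_def)
      finally obtain v where v: "v \<in> X" "M v \<le> 2 * n" "N (\<lambda>z. of_real c * h z - v z) < c * e"
        using small[OF nX(3)[OF h], of "of_real c" "c * e"] c e by auto
      define u where "u = (\<lambda>z. of_real (1/c) * v z)"
      have u: "u \<in> X" unfolding u_def by (rule nX(3)) fact
      have "M u = (1/c) * M v"
        unfolding u_def using nY(8)[of v "of_real (1/c)"] v(1) XY c
        by (auto simp: norm_divide subset_iff)
      also have "\<dots> \<le> (1/c) * (2 * n)" using v(2) c by (intro mult_left_mono) auto
      also have "\<dots> = (4 * real n / r) * N h" using r pos by (simp add: c_def)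
      finally have 1: "M u \<le> (4 * real n / r) * N h" .
      have "(\<lambda>z. h z - u z) = (\<lambda>z. of_real (1/c) * (of_real c * h z - v z))"
        using c by (simp add: u_def fun_eq_iff field_simps)
      then have "N (\<lambda>z. h z - u z) = (1/c) * N (\<lambda>z. of_real c * h z - v z)"
        using nX(8)[OF nX(4)[OF nX(3)[OF h, of "of_real c"] v(1)], of "of_real (1/c)"] c
        by (simp add: norm_divide)
      also have "\<dots> < e" using v(3) c by (simp add: field_simps)
      finally show ?thesis using u 1 by blast
    qed
  qed
qed

text \<open>
The second half of the closed graph argument. Approximating \<open>f\<close>, then the remainder, and so on,
writes \<open>f\<close> as a series that converges to \<open>f\<close> in \<open>X\<close> and has geometrically decreasing \<open>M\<close>-norms, so
that it also converges in \<open>Y\<close>. Both limits are pointwise limits, hence they agree, and the geometric series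
bounds \<open>M f\<close>.
\<close>
theorem continuous_inclusion:
  assumes X: "banach_space_of_analytic_functions X N"
    and Y: "banach_space_of_analytic_functions Y M" and XY: "X \<subseteq> Y"
  shows "\<exists>C\<ge>0. \<forall>f\<in>X. M f \<le> C * N f"
proof -
  have ns: "normed_space_of_functions X N" "normed_space_of_functions Y M"
    using X Y by (simp_all add: banach_space_of_analytic_functions_def)
  note nX = normed_space_of_functionsD[OF ns(1)] and nY = normed_space_of_functionsD[OF ns(2)]
  obtain K where K: "0 \<le> K"
    "\<And>h e. h \<in> X \<Longrightarrow> 0 < e \<Longrightarrow> \<exists>u\<in>X. M u \<le> K * N h \<and> N (\<lambda>z. h z - u z) < e"
    using inclusion_almost_open[OF X ns(2) XY] by (elim exE conjE) auto
  show ?thesis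
  proof (intro exI[of _ "2 * K"] conjI ballI)
    show "0 \<le> 2 * K" using K by simp
    fix f assume f: "f \<in> X"
    show "M f \<le> 2 * K * N f"
    proof (cases "N f = 0")
      case True
      then show ?thesis using nX(7)[OF f] nY(6) by simp
    next
      case False
      then have pos: "0 < N f" using nX(5)[OF f] by simp
      \<comment> \<open>\<open>R k\<close> is the remainder after \<open>k\<close> approximation steps.\<close>
      obtain R where R0: "R 0 = f" and R: "\<And>k. R k \<in> X \<and> N (R k) \<le> N f / 2 ^ k"
        and RS: "\<And>k. M (\<lambda>z. R k z - R (Suc k) z) \<le> K * (N f / 2 ^ k)"
      proof -
        have "\<exists>R. R 0 = f \<and> (\<forall>k. (R k \<in> X \<and> N (R k) \<le> N f / 2 ^ k) \<and>
                M (\<lambda>z. R k z - R (Suc k) z) \<le> K * (N f / 2 ^ k))"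
        proof -
          have ex: "\<exists>h'. (h' \<in> X \<and> N h' \<le> N f / 2 ^ Suc k) \<and>
                     M (\<lambda>z. h z - h' z) \<le> K * (N f / 2 ^ k)"
            if h: "h \<in> X \<and> N h \<le> N f / 2 ^ k" for h k
          proof -
            have "0 < N f / 2 ^ Suc k" using pos by simp
            then obtain u where u: "u \<in> X" "M u \<le> K * N h" "N (\<lambda>z. h z - u z) < N f / 2 ^ Suc k"
              using K(2) h by blast
            have "K * N h \<le> K * (N f / 2 ^ k)" using h K by (intro mult_left_mono) auto
            then show ?thesis using u h nX(4)[of h u]
              by (intro exI[of _ "\<lambda>z. h z - u z"]) auto
          qed
          show ?thesis
            using f dependent_nat_choice[of "\<lambda>k h. (k = 0 \<longrightarrow> h = f) \<and> h \<in> X \<and> N h \<le> N f / 2 ^ k"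
                "\<lambda>k h h'. M (\<lambda>z. h z - h' z) \<le> K * (N f / 2 ^ k)"] ex by auto
        qed
        then show ?thesis using that by blast
      qed
      define S where "S k = (\<lambda>z. f z - R k z)" for k
      have S: "S k \<in> X" for k unfolding S_def using f R nX(4) by blast
      have MS: "M (\<lambda>z. S n z - S m z) \<le> 2 * K * N f / 2 ^ m" if "m \<le> n" for m n
      proof -
        have "M (\<lambda>z. S n z - S m z) \<le> 2 * K * N f / 2 ^ m - 2 * K * N f / 2 ^ n"
          using that
        proof (induction n rule: dec_induct)
          case base
          then show ?case using nY(6) by simp
        next
          case (step n)
          have "M (\<lambda>z. S (Suc n) z - S m z) = M (\<lambda>z. (S n z - S m z) + (R n z - R (Suc n) z))"
            by (rule arg_cong[of _ _ M]) (auto simp: S_def)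
          moreover have "\<dots> \<le> M (\<lambda>z. S n z - S m z) + M (\<lambda>z. R n z - R (Suc n) z)"
            using S R XY by (intro nY(9) nY(4)) auto
          moreover have "2 * K * N f / 2 ^ Suc n = 2 * K * N f / 2 ^ n - K * (N f / 2 ^ n)"
            by (simp add: field_simps)
          ultimately show ?case using step.IH RS[of n] by linarith
        qed
        also have "\<dots> \<le> 2 * K * N f / 2 ^ m" using K pos by simp
        finally show ?thesis .
      qed
      have lim0: "(\<lambda>m. a / 2 ^ m) \<longlonglongrightarrow> 0" for a :: real
        by (rule LIMSEQ_divide_realpow_zero) simp
      obtain g where g: "g \<in> Y" and Sg: "(\<lambda>n. M (\<lambda>z. S n z - g z)) \<longlonglongrightarrow> 0"
      proof (rule banach_space_of_analytic_functions_complete[OF Y, of S])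
        show "S n \<in> Y" for n using S XY by blast
        fix e :: real assume "0 < e"
        then obtain m where m: "2 * K * N f / 2 ^ m * 2 < e"
          using order_tendstoD(2)[OF lim0[of "2 * (2 * K * N f)"], of e]
          by (auto simp: eventually_sequentially algebra_simps)
        have "M (\<lambda>z. S i z - S j z) < e" if "m \<le> i" "m \<le> j" for i j
        proof -
          have "(\<lambda>z. S i z - S j z) = (\<lambda>z. (S i z - S m z) - (S j z - S m z))" by auto
          moreover have "M \<dots> \<le> M (\<lambda>z. S i z - S m z) + M (\<lambda>z. S j z - S m z)"
            using S XY by (intro nY(10) nY(4)) auto
          ultimately show ?thesis using MS[OF that(1)] MS[OF that(2)] m by simp
        qed
        then show "\<exists>n0. \<forall>m\<ge>n0. \<forall>n\<ge>n0. M (\<lambda>z. S m z - S n z) < e" by blast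
      qed
      have "(\<lambda>n. N (\<lambda>z. S n z - f z)) \<longlonglongrightarrow> 0"
      proof (rule tendsto_sandwich[OF _ _ tendsto_const lim0[of "N f"]])
        have "N (\<lambda>z. S n z - f z) = N (R n)" for n
          using nX(8)[of "R n" "-1"] R by (simp add: S_def)
        then show "\<forall>\<^sub>F n in sequentially. 0 \<le> N (\<lambda>z. S n z - f z)"
          "\<forall>\<^sub>F n in sequentially. N (\<lambda>z. S n z - f z) \<le> N f / 2 ^ n"
          using R nX(5) by auto
      qed
      then have "(\<lambda>n. S n z) \<longlonglongrightarrow> f z" for z
        by (rule banach_space_of_analytic_functions_pointwise[OF X S f])
      moreover have "(\<lambda>n. S n z) \<longlonglongrightarrow> g z" for z
        using S XY by (intro banach_space_of_analytic_functions_pointwise[OF Y _ g Sg]) auto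
      ultimately have fg: "g = f" by (auto intro: LIMSEQ_unique)
      have "M f \<le> 2 * K * N f + M (\<lambda>z. S n z - f z)" for n
      proof -
        have "S 0 = (\<lambda>z. 0)" by (simp add: S_def R0)
        then have "M (S n) \<le> 2 * K * N f" using MS[of 0 n] by simp
        moreover have "M (\<lambda>z. S n z - (S n z - f z)) \<le> M (S n) + M (\<lambda>z. S n z - f z)"
          using S f XY by (intro nY(10) nY(4)) auto
        ultimately show ?thesis by simp
      qed
      then have "M f \<le> 2 * K * N f + 0"
        using Sg unfolding fg by (intro LIMSEQ_le_const[OF tendsto_add[OF tendsto_const Sg[unfolded fg]]]) auto
      then show ?thesis by simp
    qed
  qed
qed

section \<open>Weighted Bloch spaces\<close>

definition weighted_bloch :: "(complex \<Rightarrow> real) \<Rightarrow> (complex \<Rightarrow> complex) set" where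
  "weighted_bloch w = {f \<in> hol_disc. bdd_above ((\<lambda>z. w z * cmod (deriv f z)) ` \<D>)}"

definition weighted_bloch_norm :: "(complex \<Rightarrow> real) \<Rightarrow> (complex \<Rightarrow> complex) \<Rightarrow> real" where
  "weighted_bloch_norm w f = cmod (f 0) + (SUP z\<in>\<D>. w z * cmod (deriv f z))"

lemma bloch_eq_weighted_bloch: "bloch = weighted_bloch (\<lambda>z. 1 - (cmod z)\<^sup>2)"
  by (simp add: bloch_def weighted_bloch_def)

lemma hol_disc_deriv:
  assumes "f \<in> hol_disc" "z \<in> \<D>"
  shows "(f has_field_derivative deriv f z) (at z)"
  using assms by (auto simp: hol_disc_def intro: holomorphic_derivI)

lemma hol_disc_add: "f \<in> hol_disc \<Longrightarrow> g \<in> hol_disc \<Longrightarrow> (\<lambda>z. f z + g z) \<in> hol_disc"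
  and hol_disc_diff: "f \<in> hol_disc \<Longrightarrow> g \<in> hol_disc \<Longrightarrow> (\<lambda>z. f z - g z) \<in> hol_disc"
  and hol_disc_cmult: "f \<in> hol_disc \<Longrightarrow> (\<lambda>z. c * f z) \<in> hol_disc"
  and hol_disc_zero: "(\<lambda>z. 0) \<in> hol_disc"
  by (auto simp: hol_disc_def intro!: holomorphic_intros)

lemma deriv_hol_disc_add:
    "f \<in> hol_disc \<Longrightarrow> g \<in> hol_disc \<Longrightarrow> z \<in> \<D> \<Longrightarrow> deriv (\<lambda>z. f z + g z) z = deriv f z + deriv g z"
  and deriv_hol_disc_diff:
    "f \<in> hol_disc \<Longrightarrow> g \<in> hol_disc \<Longrightarrow> z \<in> \<D> \<Longrightarrow> deriv (\<lambda>z. f z - g z) z = deriv f z - deriv g z"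
  and deriv_hol_disc_cmult:
    "f \<in> hol_disc \<Longrightarrow> z \<in> \<D> \<Longrightarrow> deriv (\<lambda>z. c * f z) z = c * deriv f z"
  by (auto intro!: DERIV_imp_deriv derivative_eq_intros hol_disc_deriv)

lemma weighted_bloch_bound:
  assumes "f \<in> weighted_bloch w" "z \<in> \<D>"
  shows "w z * cmod (deriv f z) \<le> weighted_bloch_norm w f - cmod (f 0)"
  using assms cSUP_upper[of z \<D> "\<lambda>z. w z * cmod (deriv f z)"]
  by (auto simp: weighted_bloch_def weighted_bloch_norm_def)

lemma weighted_bloch_norm_le:
  assumes "f \<in> hol_disc" "\<And>z. z \<in> \<D> \<Longrightarrow> w z * cmod (deriv f z) \<le> B"
  shows "f \<in> weighted_bloch w" "weighted_bloch_norm w f \<le> cmod (f 0) + B"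
proof -
  show "f \<in> weighted_bloch w"
    using assms by (auto simp: weighted_bloch_def intro!: bdd_aboveI)
  have "(SUP z\<in>\<D>. w z * cmod (deriv f z)) \<le> B"
    by (rule cSUP_least) (use assms in auto)
  then show "weighted_bloch_norm w f \<le> cmod (f 0) + B"
    by (simp add: weighted_bloch_norm_def)
qed

context
  fixes w :: "complex \<Rightarrow> real"
  assumes w: "\<And>z. z \<in> \<D> \<Longrightarrow> 1 - cmod z \<le> w z"
begin

text \<open>
Integrating the derivative along a segment. The assumption \<open>1 - |z| \<le> w z\<close> on the weight is what makes
point evaluations continuous.
\<close>
lemma weighted_bloch_growth:
  assumes f: "f \<in> weighted_bloch w" and z: "z \<in> \<D>"
  shows "cmod (f z) \<le> weighted_bloch_norm w f / (1 - cmod z)"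
proof -
  define S where "S = weighted_bloch_norm w f - cmod (f 0)"
  have f': "f \<in> hol_disc" using f by (simp add: weighted_bloch_def)
  have z1: "cmod z < 1" using z by simp
  have der: "cmod (deriv f x) \<le> S / (1 - cmod z)" if "x \<in> cball 0 (cmod z)" for x
  proof -
    have x: "x \<in> \<D>" "cmod x \<le> cmod z" using that z1 by auto
    have "(1 - cmod z) * cmod (deriv f x) \<le> w x * cmod (deriv f x)"
      using w[OF x(1)] x(2) by (intro mult_right_mono) auto
    also have "\<dots> \<le> S" unfolding S_def by (rule weighted_bloch_bound) fact+
    finally show ?thesis using z1 by (simp add: field_simps)
  qed
  have "cmod (f z - f 0) \<le> S / (1 - cmod z) * cmod (z - 0)"
  proof (rule field_differentiable_bound[of "cball 0 (cmod z)" f "deriv f"])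
    fix x :: complex assume "x \<in> cball 0 (cmod z)"
    then have "x \<in> \<D>" using z1 by auto
    then show "(f has_field_derivative deriv f x) (at x within cball 0 (cmod z))"
      by (intro has_field_derivative_at_within[OF hol_disc_deriv[OF f']])
  qed (use der in auto)
  then have "cmod (f z) \<le> cmod (f 0) + S / (1 - cmod z) * cmod z"
    using norm_triangle_sub[of "f z" "f 0"] by simp
  also have "\<dots> = (cmod (f 0) * (1 - cmod z) + S * cmod z) / (1 - cmod z)"
    using z1 by (simp add: field_simps)
  also have "\<dots> \<le> (cmod (f 0) + S) / (1 - cmod z)"
  proof (intro divide_right_mono add_mono)
    show "cmod (f 0) * (1 - cmod z) \<le> cmod (f 0)"
      using z1 by (simp add: mult_left_le)
    have "0 \<le> cmod (deriv f 0)" by simp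
    also have "\<dots> \<le> S / (1 - cmod z)" using der[of 0] by simp
    finally have "0 \<le> S / (1 - cmod z)" .
    then have "0 \<le> S" using z1 by (simp add: zero_le_divide_iff)
    then show "S * cmod z \<le> S" using z1 by (simp add: mult_left_le)
  qed (use z1 in auto)
  finally show ?thesis by (simp add: S_def)
qed

lemma weighted_bloch_normed_space:
  "normed_space_of_functions (weighted_bloch w) (weighted_bloch_norm w)"
proof -
  have nonneg: "0 \<le> weighted_bloch_norm w f" if "f \<in> weighted_bloch w" for f
  proof -
    have "0 \<le> cmod (f 0)" by simp
    also have "\<dots> \<le> weighted_bloch_norm w f" using weighted_bloch_growth[OF that, of 0] by simp
    finally show ?thesis .
  qed
  have zero: "(\<lambda>z. 0) \<in> weighted_bloch w" "weighted_bloch_norm w (\<lambda>z. 0) \<le> 0"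
    using weighted_bloch_norm_le[OF hol_disc_zero, of w 0] by auto
  have add: "(\<lambda>z. f z + g z) \<in> weighted_bloch w"
     "weighted_bloch_norm w (\<lambda>z. f z + g z) \<le> weighted_bloch_norm w f + weighted_bloch_norm w g"
    if fg: "f \<in> weighted_bloch w" "g \<in> weighted_bloch w" for f g
  proof -
    have h: "f \<in> hol_disc" "g \<in> hol_disc" using fg by (simp_all add: weighted_bloch_def)
    have b: "w z * cmod (deriv (\<lambda>z. f z + g z) z) \<le>
       (weighted_bloch_norm w f - cmod (f 0)) + (weighted_bloch_norm w g - cmod (g 0))"
      if z: "z \<in> \<D>" for z
    proof -
      have "w z * cmod (deriv f z + deriv g z) \<le> w z * (cmod (deriv f z) + cmod (deriv g z))"
        using w[OF z] z by (intro mult_left_mono norm_triangle_ineq) auto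
      then show ?thesis
        using weighted_bloch_bound[OF fg(1) z] weighted_bloch_bound[OF fg(2) z]
        by (simp add: deriv_hol_disc_add[OF h z] distrib_left)
    qed
    show "(\<lambda>z. f z + g z) \<in> weighted_bloch w"
      by (rule weighted_bloch_norm_le(1)[OF hol_disc_add[OF h] b])
    show "weighted_bloch_norm w (\<lambda>z. f z + g z) \<le> weighted_bloch_norm w f + weighted_bloch_norm w g"
      using weighted_bloch_norm_le(2)[OF hol_disc_add[OF h] b] norm_triangle_ineq[of "f 0" "g 0"]
      by simp
  qed
  have scale: "(\<lambda>z. c * f z) \<in> weighted_bloch w"
     "weighted_bloch_norm w (\<lambda>z. c * f z) \<le> cmod c * weighted_bloch_norm w f"
    if f: "f \<in> weighted_bloch w" for c f
  proof -
    have h: "f \<in> hol_disc" using f by (simp add: weighted_bloch_def)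
    have b: "w z * cmod (deriv (\<lambda>z. c * f z) z) \<le> cmod c * (weighted_bloch_norm w f - cmod (f 0))"
      if z: "z \<in> \<D>" for z
      using mult_left_mono[OF weighted_bloch_bound[OF f z], of "cmod c"]
      by (simp add: deriv_hol_disc_cmult[OF h z] norm_mult mult_ac)
    show "(\<lambda>z. c * f z) \<in> weighted_bloch w"
      by (rule weighted_bloch_norm_le(1)[OF hol_disc_cmult[OF h] b])
    show "weighted_bloch_norm w (\<lambda>z. c * f z) \<le> cmod c * weighted_bloch_norm w f"
      using weighted_bloch_norm_le(2)[OF hol_disc_cmult[OF h] b]
      by (simp add: norm_mult algebra_simps)
  qed
  have hom: "weighted_bloch_norm w (\<lambda>z. c * f z) = cmod c * weighted_bloch_norm w f"
    if f: "f \<in> weighted_bloch w" for c f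
  proof (cases "c = 0")
    case True
    then show ?thesis using scale(2)[OF f, of c] nonneg[OF zero(1)] zero(2) by simp
  next
    case False
    have "weighted_bloch_norm w (\<lambda>z. inverse c * (c * f z)) \<le>
        cmod (inverse c) * weighted_bloch_norm w (\<lambda>z. c * f z)"
      by (rule scale(2)[OF scale(1)[OF f]])
    moreover have "(\<lambda>z. inverse c * (c * f z)) = f" using False by (simp add: fun_eq_iff)
    ultimately have "weighted_bloch_norm w f \<le> inverse (cmod c) * weighted_bloch_norm w (\<lambda>z. c * f z)"
      by (simp add: norm_inverse)
    then show ?thesis using scale(2)[OF f, of c] False by (simp add: field_simps)
  qed
  have definite: "f = (\<lambda>z. 0)" if f: "f \<in> weighted_bloch w" "weighted_bloch_norm w f = 0" for f
  proof
    fix z show "f z = 0"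
      using weighted_bloch_growth[OF f(1), of z] f
      by (cases "z \<in> \<D>") (auto simp: weighted_bloch_def hol_disc_def)
  qed
  have "weighted_bloch_norm w (\<lambda>z. 0) = 0" using zero nonneg[OF zero(1)] by simp
  then have iff: "weighted_bloch_norm w f = 0 \<longleftrightarrow> f = (\<lambda>z. 0)" if "f \<in> weighted_bloch w" for f
    using definite[OF that] by blast
  show ?thesis
    unfolding normed_space_of_functions_def
  proof (intro conjI ballI allI)
  qed (assumption | rule nonneg zero(1) add scale(1) hom iff)+
qed

text \<open>
A Cauchy sequence converges uniformly on smaller discs by the growth estimate. By Weierstrass' theorem the
limit is analytic and the derivatives converge pointwise, so the weighted bounds pass to the limit.
\<close>
lemma weighted_bloch_complete:
  assumes f: "\<And>n. f n \<in> weighted_bloch w"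
    and Cauchy: "\<And>e. 0 < e \<Longrightarrow> \<exists>n0. \<forall>m\<ge>n0. \<forall>n\<ge>n0. weighted_bloch_norm w (\<lambda>z. f m z - f n z) < e"
  shows "\<exists>g\<in>weighted_bloch w. (\<lambda>n. weighted_bloch_norm w (\<lambda>z. f n z - g z)) \<longlonglongrightarrow> 0"
proof -
  note ns = normed_space_of_functionsD[OF weighted_bloch_normed_space]
  have fh: "f n \<in> hol_disc" for n using f[of n] by (simp add: weighted_bloch_def)
  have diff: "(\<lambda>z. f m z - f n z) \<in> weighted_bloch w" for m n by (rule ns(4)[OF f f])
  have unif: "uniformly_convergent_on (cball 0 r) f" if r: "r < 1" for r
  proof (rule Cauchy_uniformly_convergent, rule uniformly_Cauchy_onI)
    fix e :: real assume "0 < e"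
    then have "0 < e * (1 - r)" using r by simp
    then obtain n0 where n0: "\<forall>m\<ge>n0. \<forall>n\<ge>n0. weighted_bloch_norm w (\<lambda>z. f m z - f n z) < e * (1 - r)"
      using Cauchy by blast
    have "dist (f m z) (f n z) < e" if "z \<in> cball 0 r" "n0 \<le> m" "n0 \<le> n" for z m n
    proof -
      have z: "z \<in> \<D>" "cmod z \<le> r" using that r by auto
      have "cmod (f m z - f n z) \<le> weighted_bloch_norm w (\<lambda>z. f m z - f n z) / (1 - cmod z)"
        by (rule weighted_bloch_growth[OF diff z(1)])
      also have "\<dots> \<le> weighted_bloch_norm w (\<lambda>z. f m z - f n z) / (1 - r)"
        using z r ns(5)[OF diff] by (intro divide_left_mono mult_pos_pos) auto
      also have "\<dots> < e" using n0 that r by (simp add: field_simps)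
      finally show ?thesis by (simp add: dist_norm)
    qed
    then show "\<exists>M. \<forall>x\<in>cball 0 r. \<forall>m\<ge>M. \<forall>n\<ge>M. dist (f m x) (f n x) < e" by blast
  qed
  define g where "g z = lim (\<lambda>n. f n z)" for z
  have ulim: "uniform_limit (cball 0 r) f g sequentially" if "r < 1" for r
    using unif[OF that] unfolding g_def by (simp add: uniformly_convergent_uniform_limit_iff)
  have "\<exists>g'. \<forall>x\<in>\<D>. (g has_field_derivative g' x) (at x) \<and> (\<lambda>n. deriv (f n) x) \<longlonglongrightarrow> g' x"
  proof (rule has_complex_derivative_uniform_sequence[OF open_ball])
    fix x :: complex assume x: "x \<in> \<D>"
    define d where "d = (1 - cmod x) / 2"
    have sub: "cball x d \<subseteq> cball 0 ((1 + cmod x) / 2)"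
    proof
      fix y assume "y \<in> cball x d"
      then have "cmod (x - y) \<le> d" by (simp add: dist_norm)
      moreover have "cmod y \<le> cmod x + cmod (x - y)"
        using norm_triangle_ineq2[of y x] by (simp add: norm_minus_commute)
      ultimately show "y \<in> cball 0 ((1 + cmod x) / 2)" by (simp add: d_def)
    qed
    show "\<exists>d>0. cball x d \<subseteq> \<D> \<and> uniform_limit (cball x d) f g sequentially"
      using x sub uniform_limit_on_subset[OF ulim sub] by (intro exI[of _ d]) (auto simp: d_def)
  qed (auto intro: hol_disc_deriv[OF fh])
  then obtain g' where g': "\<And>x. x \<in> \<D> \<Longrightarrow> (g has_field_derivative g' x) (at x)"
    "\<And>x. x \<in> \<D> \<Longrightarrow> (\<lambda>n. deriv (f n) x) \<longlonglongrightarrow> g' x" by blast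
  have gh: "g \<in> hol_disc"
  proof -
    have "g z = 0" if "z \<notin> \<D>" for z
    proof -
      have "(\<lambda>n. f n z) = (\<lambda>n. 0)" using that fh by (auto simp: hol_disc_def)
      then show ?thesis by (simp add: g_def)
    qed
    moreover have "g holomorphic_on \<D>"
      using g'(1) by (auto simp: holomorphic_on_open) blast
    ultimately show ?thesis by (simp add: hol_disc_def)
  qed
  have dg: "deriv g x = g' x" if "x \<in> \<D>" for x
    by (rule DERIV_imp_deriv[OF g'(1)[OF that]])
  have lim0: "(\<lambda>n. f n 0) \<longlonglongrightarrow> g 0"
    using tendsto_uniform_limitI[OF ulim[of 0], of 0] by simp
  have close: "\<exists>n0. \<forall>n\<ge>n0. (\<lambda>z. f n z - g z) \<in> weighted_bloch w \<and>
      weighted_bloch_norm w (\<lambda>z. f n z - g z) < e" if "0 < e" for e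
  proof -
    have "0 < e / 3" using that by simp
    then obtain n0 where n0: "\<forall>m\<ge>n0. \<forall>n\<ge>n0. weighted_bloch_norm w (\<lambda>z. f m z - f n z) < e / 3"
      using Cauchy by blast
    have "(\<lambda>z. f n z - g z) \<in> weighted_bloch w \<and> weighted_bloch_norm w (\<lambda>z. f n z - g z) < e"
      if n: "n0 \<le> n" for n
    proof -
      have b: "w z * cmod (deriv (\<lambda>z. f n z - g z) z) \<le> e / 3" if z: "z \<in> \<D>" for z
      proof -
        have "w z * cmod (deriv (f n) z - deriv (f m) z) \<le> e / 3" if m: "n0 \<le> m" for m
        proof -
          have "weighted_bloch_norm w (\<lambda>z. f n z - f m z) < e / 3" using n0 n m by blast
          then show ?thesis
            using weighted_bloch_bound[OF diff z, of n m] norm_ge_zero[of "f n 0 - f m 0"]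
            unfolding deriv_hol_disc_diff[OF fh fh z] by linarith
        qed
        then have "w z * cmod (deriv (f n) z - g' z) \<le> e / 3"
          by (intro LIMSEQ_le_const2[of "\<lambda>m. w z * cmod (deriv (f n) z - deriv (f m) z)"]
              tendsto_intros g'(2)[OF z]) blast
        then show ?thesis by (simp add: deriv_hol_disc_diff[OF fh gh z] dg[OF z])
      qed
      have "cmod (f n 0 - f m 0) \<le> e / 3" if m: "n0 \<le> m" for m
      proof -
        have "weighted_bloch_norm w (\<lambda>z. f n z - f m z) < e / 3" using n0 n m by blast
        then show ?thesis using weighted_bloch_growth[OF diff, of 0 n m] by simp
      qed
      then have "cmod (f n 0 - g 0) \<le> e / 3"
        by (intro LIMSEQ_le_const2[of "\<lambda>m. cmod (f n 0 - f m 0)"] tendsto_intros lim0) blast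
      then show ?thesis
        using weighted_bloch_norm_le[OF hol_disc_diff[OF fh gh] b] \<open>0 < e\<close> by auto
    qed
    then show ?thesis by blast
  qed
  have g: "g \<in> weighted_bloch w"
  proof -
    obtain n where "(\<lambda>z. f n z - g z) \<in> weighted_bloch w" using close[of 1] by auto
    from ns(4)[OF f this, of n] show ?thesis by simp
  qed
  moreover have "(\<lambda>n. weighted_bloch_norm w (\<lambda>z. f n z - g z)) \<longlonglongrightarrow> 0"
    using close ns(5)[OF ns(4)[OF f g]] by (simp add: LIMSEQ_iff) blast
  ultimately show ?thesis by blast
qed

theorem banach_space_weighted_bloch:
  "banach_space_of_analytic_functions (weighted_bloch w) (weighted_bloch_norm w)"
proof -
  note ns = normed_space_of_functionsD[OF weighted_bloch_normed_space]
  interpret Metric_space "weighted_bloch w" "norm_dist (weighted_bloch w) (weighted_bloch_norm w)"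
    by (rule Metric_space_norm_dist[OF weighted_bloch_normed_space])
  have "mcomplete"
    unfolding mcomplete_def
  proof (intro allI impI)
    fix \<sigma> assume "MCauchy \<sigma>"
    then have s: "\<sigma> n \<in> weighted_bloch w" for n by (auto simp: MCauchy_def)
    have "\<exists>n0. \<forall>m\<ge>n0. \<forall>n\<ge>n0. weighted_bloch_norm w (\<lambda>z. \<sigma> m z - \<sigma> n z) < e" if "0 < e" for e
      using \<open>MCauchy \<sigma>\<close> that s by (auto simp: MCauchy_def norm_dist_def)
    then obtain g where g: "g \<in> weighted_bloch w"
      "(\<lambda>n. weighted_bloch_norm w (\<lambda>z. \<sigma> n z - g z)) \<longlonglongrightarrow> 0"
      using weighted_bloch_complete[of \<sigma>] s by blast
    then have "limitin mtopology \<sigma> g sequentially"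
      using limitin_norm_dist[OF weighted_bloch_normed_space, of \<sigma> g] s by simp
    then show "\<exists>x. limitin mtopology \<sigma> x sequentially" by blast
  qed
  moreover have "continuous_map mtopology euclidean (\<lambda>f. f z)" if z: "z \<in> \<D>" for z
    unfolding continuous_map_from_metric
  proof (intro conjI ballI allI impI)
    fix f and U :: "complex set"
    assume f: "f \<in> weighted_bloch w" and U: "openin euclidean U \<and> f z \<in> U"
    then obtain e where e: "0 < e" "ball (f z) e \<subseteq> U" by (auto simp: open_contains_ball)
    have z1: "0 < 1 - cmod z" using z by simp
    have "g z \<in> U"
      if g: "g \<in> weighted_bloch w"
        and "norm_dist (weighted_bloch w) (weighted_bloch_norm w) f g < e * (1 - cmod z)" for g
    proof -
      have "cmod (f z - g z) \<le> weighted_bloch_norm w (\<lambda>z. f z - g z) / (1 - cmod z)"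
        by (rule weighted_bloch_growth[OF ns(4)[OF f g] z])
      also have "\<dots> < e" using that f z1 by (simp add: norm_dist_def field_simps)
      finally show ?thesis using e by (auto simp: dist_norm)
    qed
    then show "\<exists>r>0. \<forall>x. x \<in> weighted_bloch w \<and>
        norm_dist (weighted_bloch w) (weighted_bloch_norm w) f x < r \<longrightarrow> x z \<in> U"
      using e(1) z1 by (intro exI[of _ "e * (1 - cmod z)"]) auto
  qed auto
  ultimately show ?thesis
    using weighted_bloch_normed_space
    by (auto simp: banach_space_of_analytic_functions_def weighted_bloch_def)
qed

end

section \<open>Integration over the disc in polar coordinates\<close>

lemma borel_measurable_cis_cnj[measurable]:
  "cis \<in> borel_measurable borel" "cnj \<in> borel_measurable borel"
  by (auto intro!: borel_measurable_continuous_onI continuous_intros)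

lemma borel_measurable_Complex[measurable]:
  assumes [measurable]: "g \<in> borel_measurable M" "h \<in> borel_measurable M"
  shows "(\<lambda>x. Complex (g x) (h x)) \<in> borel_measurable M"
  unfolding Complex_eq by measurable

text \<open>
Lebesgue measure on the plane is the product measure in Cartesian coordinates, which makes Fubini's theorem
available.
\<close>
lemma lborel_complex:
  "(lborel :: complex measure) = distr (lborel \<Otimes>\<^sub>M lborel) borel (\<lambda>p. Complex (fst p) (snd p))"
proof (rule lborel_eqI)
  have meas: "(\<lambda>p. Complex (fst p) (snd p)) \<in> borel_measurable (lborel \<Otimes>\<^sub>M lborel :: (real \<times> real) measure)"
    by measurable
  fix l u :: complex
  assume "\<And>b. b \<in> Basis \<Longrightarrow> l \<bullet> b \<le> u \<bullet> b"
  from this[of 1] this[of \<i>] have le: "Re l \<le> Re u" "Im l \<le> Im u"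
    by (auto simp: Basis_complex_def)
  have "(\<lambda>p. Complex (fst p) (snd p)) -` box l u \<inter> space (lborel \<Otimes>\<^sub>M lborel) =
      {Re l<..<Re u} \<times> {Im l<..<Im u}"
    by (auto simp: in_box_complex_iff space_pair_measure)
  then have "emeasure (distr (lborel \<Otimes>\<^sub>M lborel) borel (\<lambda>p. Complex (fst p) (snd p))) (box l u) =
      ennreal (Re u - Re l) * ennreal (Im u - Im l)"
    using le by (simp add: emeasure_distr[OF meas] lborel.emeasure_pair_measure_Times)
  also have "\<dots> = ennreal (\<Prod>b\<in>Basis. (u - l) \<bullet> b)"
    using le by (simp add: Basis_complex_def ennreal_mult)
  finally show "emeasure (distr (lborel \<Otimes>\<^sub>M lborel) borel (\<lambda>p. Complex (fst p) (snd p))) (box l u) =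
      ennreal (\<Prod>b\<in>Basis. (u - l) \<bullet> b)" .
qed simp

lemma nn_integral_lborel_complex:
  assumes [measurable]: "F \<in> borel_measurable (borel :: complex measure)"
  shows "(\<integral>\<^sup>+z. F z \<partial>lborel) = (\<integral>\<^sup>+x. \<integral>\<^sup>+y. F (Complex x y) \<partial>lborel \<partial>lborel)"
    and "(\<integral>\<^sup>+z. F z \<partial>lborel) = (\<integral>\<^sup>+y. \<integral>\<^sup>+x. F (Complex x y) \<partial>lborel \<partial>lborel)"
proof -
  have *: "(\<lambda>(x, y). F (Complex x y)) \<in> borel_measurable (lborel \<Otimes>\<^sub>M lborel)"
    unfolding case_prod_unfold by measurable
  have "(\<integral>\<^sup>+z. F z \<partial>lborel) = (\<integral>\<^sup>+p. F (Complex (fst p) (snd p)) \<partial>(lborel \<Otimes>\<^sub>M lborel))"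
    by (subst lborel_complex, subst nn_integral_distr) auto
  also have "\<dots> = (\<integral>\<^sup>+x. \<integral>\<^sup>+y. F (Complex x y) \<partial>lborel \<partial>lborel)"
    by (subst lborel.nn_integral_fst[symmetric]) (use * in \<open>auto simp: case_prod_unfold\<close>)
  finally show 1: "(\<integral>\<^sup>+z. F z \<partial>lborel) = (\<integral>\<^sup>+x. \<integral>\<^sup>+y. F (Complex x y) \<partial>lborel \<partial>lborel)" .
  show "(\<integral>\<^sup>+z. F z \<partial>lborel) = (\<integral>\<^sup>+y. \<integral>\<^sup>+x. F (Complex x y) \<partial>lborel \<partial>lborel)"
    unfolding 1 by (rule lborel_pair.Fubini'[symmetric]) (rule *)
qed

text \<open>
By Fubini's theorem a shear acts on each line by a translation.
\<close>
lemma nn_integral_shear: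
  fixes t :: real
  assumes [measurable]: "F \<in> borel_measurable (borel :: complex measure)"
  shows "(\<integral>\<^sup>+z. F (Complex (Re z + t * Im z) (Im z)) \<partial>lborel) = (\<integral>\<^sup>+z. F z \<partial>lborel)"
    and "(\<integral>\<^sup>+z. F (Complex (Re z) (Im z + t * Re z)) \<partial>lborel) = (\<integral>\<^sup>+z. F z \<partial>lborel)"
proof -
  have "(\<integral>\<^sup>+x. F (Complex (x + t * y) y) \<partial>lborel) = (\<integral>\<^sup>+x. F (Complex x y) \<partial>lborel)" for y
    using nn_integral_real_affine[of "\<lambda>x. F (Complex x y)" 1 "t * y"] by (simp add: add.commute)
  then show "(\<integral>\<^sup>+z. F (Complex (Re z + t * Im z) (Im z)) \<partial>lborel) = (\<integral>\<^sup>+z. F z \<partial>lborel)"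
    by (simp add: nn_integral_lborel_complex(2))
  have "(\<integral>\<^sup>+y. F (Complex x (y + t * x)) \<partial>lborel) = (\<integral>\<^sup>+y. F (Complex x y) \<partial>lborel)" for x
    using nn_integral_real_affine[of "\<lambda>y. F (Complex x y)" 1 "t * x"] by (simp add: add.commute)
  then show "(\<integral>\<^sup>+z. F (Complex (Re z) (Im z + t * Re z)) \<partial>lborel) = (\<integral>\<^sup>+z. F z \<partial>lborel)"
    by (simp add: nn_integral_lborel_complex(1))
qed

text \<open>
Every rotation other than the half turn is a product of three shears, and the half turn is the square of a quarter
turn. So rotations preserve Lebesgue measure because shears do.
\<close>
lemma nn_integral_rotate:
  assumes [measurable]: "F \<in> borel_measurable (borel :: complex measure)" and c: "cmod c = 1"
  shows "(\<integral>\<^sup>+z. F (c * z) \<partial>lborel) = (\<integral>\<^sup>+z. F z \<partial>lborel)"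
proof -
  have main: "(\<integral>\<^sup>+z. F (c * z) \<partial>lborel) = (\<integral>\<^sup>+z. F z \<partial>lborel)"
    if [measurable]: "F \<in> borel_measurable (borel :: complex measure)" and c: "cmod c = 1" "c \<noteq> -1" for F c
  proof -
    have pq: "(Re c)\<^sup>2 + (Im c)\<^sup>2 = 1" using c(1) by (simp add: cmod_def)
    have ne: "1 + Re c \<noteq> 0"
    proof
      assume "1 + Re c = 0"
      then have "Re c = -1" by simp
      with pq have "Im c = 0" by simp
      with \<open>Re c = -1\<close> c(2) show False by (simp add: complex_eq_iff)
    qed
    \<comment> \<open>With \<open>c = cis \<theta>\<close> these are \<open>- tan (\<theta> / 2)\<close> and \<open>sin \<theta>\<close>.\<close>
    define a where "a = - Im c / (1 + Re c)"
    define b where "b = Im c"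
    have ab: "1 + a * b = Re c" "a * (2 + a * b) = - Im c"
    proof -
      have "a * b = Re c - 1"
        using ne pq by (simp add: a_def b_def divide_simps) (simp add: power2_eq_square algebra_simps)
      then show "1 + a * b = Re c" "a * (2 + a * b) = - Im c"
        using ne by (simp_all add: a_def)
    qed
    define H where "H z = Complex (Re z + a * Im z) (Im z)" for z
    define V where "V z = Complex (Re z) (Im z + b * Re z)" for z
    have [measurable]: "H \<in> borel_measurable borel" "V \<in> borel_measurable borel"
      unfolding H_def V_def by measurable
    have HVH: "c * z = H (V (H z))" for z
    proof -
      have "Re z + a * Im z + a * (Im z + b * (Re z + a * Im z)) = (1 + a * b) * Re z + a * (2 + a * b) * Im z"
        "Im z + b * (Re z + a * Im z) = b * Re z + (1 + a * b) * Im z"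
        by (simp_all add: algebra_simps)
      then show ?thesis by (simp add: complex_eq_iff H_def V_def ab(1) ab(2)) (simp add: b_def)
    qed
    have "(\<integral>\<^sup>+z. F (c * z) \<partial>lborel) = (\<integral>\<^sup>+z. F (H (V (H z))) \<partial>lborel)" by (simp add: HVH)
    also have "\<dots> = (\<integral>\<^sup>+z. F (H (V z)) \<partial>lborel)"
      unfolding H_def[of "_ :: complex"] by (rule nn_integral_shear(1)) (measurable)
    also have "\<dots> = (\<integral>\<^sup>+z. F (H z) \<partial>lborel)"
      unfolding V_def[of "_ :: complex"] by (rule nn_integral_shear(2)) (measurable)
    also have "\<dots> = (\<integral>\<^sup>+z. F z \<partial>lborel)"
      unfolding H_def by (rule nn_integral_shear(1)) (measurable)
    finally show ?thesis .
  qed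
  show ?thesis
  proof (cases "c = -1")
    case True
    have i: "\<i> \<noteq> -1" by (simp add: complex_eq_iff)
    have "(\<integral>\<^sup>+z. F (c * z) \<partial>lborel) = (\<integral>\<^sup>+z. (\<lambda>z. F (\<i> * z)) (\<i> * z) \<partial>lborel)"
      using True by (simp flip: mult.assoc)
    also have "\<dots> = (\<integral>\<^sup>+z. F (\<i> * z) \<partial>lborel)" by (rule main) (use i in auto)
    also have "\<dots> = (\<integral>\<^sup>+z. F z \<partial>lborel)" by (rule main) (use i in auto)
    finally show ?thesis .
  qed (use main assms in auto)
qed

lemma emeasure_disc: "emeasure lborel \<D> = ennreal pi"
  using emeasure_ball[of 1 "0::complex"] by (simp add: unit_ball_vol_2)

lemma nn_integral_disc_area:
  assumes [measurable]: "F \<in> borel_measurable (borel :: complex measure)"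
  shows "(\<integral>\<^sup>+z. F z \<partial>disc_area) = (\<integral>\<^sup>+z. F z * indicator \<D> z \<partial>lborel) / ennreal pi"
  unfolding disc_area_def by (subst nn_integral_uniform_measure) (auto simp: emeasure_disc)

lemma sets_disc_area[measurable_cong]: "sets disc_area = sets borel"
  by (simp add: disc_area_def)

lemma nn_integral_disc_rotate:
  assumes [measurable]: "F \<in> borel_measurable (borel :: complex measure)" and c: "cmod c = 1"
  shows "(\<integral>\<^sup>+z. F (c * z) \<partial>disc_area) = (\<integral>\<^sup>+z. F z \<partial>disc_area)"
proof -
  have "(\<integral>\<^sup>+z. F (c * z) * indicator \<D> z \<partial>lborel) = (\<integral>\<^sup>+z. F (c * z) * indicator \<D> (c * z) \<partial>lborel)"
    using c by (intro nn_integral_cong) (auto simp: indicator_def norm_mult)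
  also have "\<dots> = (\<integral>\<^sup>+z. F z * indicator \<D> z \<partial>lborel)"
  proof (rule nn_integral_rotate[of "\<lambda>z. F z * indicator \<D> z"])
    have [measurable]: "\<D> \<in> sets borel" by simp
    show "(\<lambda>z. F z * indicator \<D> z) \<in> borel_measurable borel" by measurable
  qed (rule c)
  finally show ?thesis by (simp add: nn_integral_disc_area)
qed

lemma nn_integral_periodic_shift:
  fixes h :: "real \<Rightarrow> ennreal"
  assumes [measurable]: "h \<in> borel_measurable borel" and per: "\<And>x. h (x + P) = h x"
    and a: "0 \<le> a" "a \<le> P"
  shows "(\<integral>\<^sup>+x\<in>{0..P}. h (x + a) \<partial>lborel) = (\<integral>\<^sup>+x\<in>{0..P}. h x \<partial>lborel)"
proof -
  have AE: "AE x in lborel. g x * indicator {0..P} x = g x * indicator {0<..P} x" for g :: "real \<Rightarrow> ennreal"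
    using AE_lborel_singleton[of 0] by eventually_elim (auto simp: indicator_def)
  have cl: "(\<integral>\<^sup>+x\<in>{0..P}. g x \<partial>lborel) = (\<integral>\<^sup>+x\<in>{0<..P}. g x \<partial>lborel)" for g :: "real \<Rightarrow> ennreal"
    by (rule nn_integral_cong_AE[OF AE])
  have "(\<integral>\<^sup>+x\<in>{0<..P}. h (x + a) \<partial>lborel) = (\<integral>\<^sup>+x. h x * indicator {0<..P} (x - a) \<partial>lborel)"
    using nn_integral_real_affine[of "\<lambda>x. h x * indicator {0<..P} (x - a)" 1 a] by (simp add: add.commute)
  also have "\<dots> = (\<integral>\<^sup>+x. h x * indicator {a<..P} x + h x * indicator {P<..P + a} x \<partial>lborel)"
    using a by (intro nn_integral_cong) (auto simp: indicator_def)
  also have "\<dots> = (\<integral>\<^sup>+x. h x * indicator {a<..P} x \<partial>lborel) + (\<integral>\<^sup>+x. h x * indicator {P<..P + a} x \<partial>lborel)"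
    by (rule nn_integral_add) auto
  also have "(\<integral>\<^sup>+x. h x * indicator {P<..P + a} x \<partial>lborel) = (\<integral>\<^sup>+x. h (x + P) * indicator {P<..P + a} (x + P) \<partial>lborel)"
    using nn_integral_real_affine[of "\<lambda>x. h x * indicator {P<..P + a} x" 1 P] by (simp add: add.commute)
  also have "\<dots> = (\<integral>\<^sup>+x. h x * indicator {0<..a} x \<partial>lborel)"
    by (intro nn_integral_cong) (auto simp: per indicator_def)
  also have "(\<integral>\<^sup>+x. h x * indicator {a<..P} x \<partial>lborel) + \<dots> =
      (\<integral>\<^sup>+x. h x * indicator {a<..P} x + h x * indicator {0<..a} x \<partial>lborel)"
    by (rule nn_integral_add[symmetric]) auto
  also have "\<dots> = (\<integral>\<^sup>+x\<in>{0<..P}. h x \<partial>lborel)"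
    using a by (intro nn_integral_cong) (auto simp: indicator_def)
  finally show ?thesis by (simp add: cl)
qed

text \<open>
Under normalized area measure the square of the modulus is uniformly distributed on \<open>[0,1]\<close>, since a disc of
radius \<open>sqrt x\<close> has area \<open>\<pi> x\<close>. This removes the Jacobian from polar coordinates.
\<close>
lemma distr_disc_area_norm_square:
  "distr disc_area borel (\<lambda>z. (cmod z)\<^sup>2) = density lborel (indicator {0..1})"
proof (rule measure_eqI_lessThan)
  have *: "emeasure (distr disc_area borel (\<lambda>z. (cmod z)\<^sup>2)) {x<..} = ennreal (1 - max 0 (min 1 x))" for x
  proof -
    have "(\<lambda>z. (cmod z)\<^sup>2) -` {x<..} = {z. x < (cmod z)\<^sup>2}" by auto
    then have "emeasure (distr disc_area borel (\<lambda>z. (cmod z)\<^sup>2)) {x<..} = emeasure disc_area {z. x < (cmod z)\<^sup>2}"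
      by (subst emeasure_distr) (auto simp: disc_area_def)
    also have "\<dots> = emeasure lborel (\<D> \<inter> {z. x < (cmod z)\<^sup>2}) / ennreal pi"
      unfolding disc_area_def by (subst emeasure_uniform_measure) (auto simp: emeasure_disc)
    also have "emeasure lborel (\<D> \<inter> {z. x < (cmod z)\<^sup>2}) = ennreal (pi * (1 - max 0 (min 1 x)))"
    proof (cases "x < 0")
      case True
      then have "\<D> \<inter> {z. x < (cmod z)\<^sup>2} = \<D>" by (auto intro: less_le_trans)
      then show ?thesis using True by (simp add: emeasure_disc)
    next
      case False
      show ?thesis
      proof (cases "x < 1")
        case True
        have "\<D> \<inter> {z. x < (cmod z)\<^sup>2} = \<D> - cball 0 (sqrt x)"
        proof -
          have "x < (cmod z)\<^sup>2 \<longleftrightarrow> sqrt x < cmod z" for z :: complex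
            using real_sqrt_less_iff[of x "(cmod z)\<^sup>2"] by simp
          then have "{z. x < (cmod z)\<^sup>2} = {z. sqrt x < cmod z}" by blast
          then show ?thesis by (auto simp: not_le)
        qed
        moreover have s1: "sqrt x < 1" using True by simp
        moreover have "emeasure lborel (\<D> - cball (0::complex) (sqrt x)) =
            emeasure lborel \<D> - emeasure lborel (cball (0::complex) (sqrt x))"
          using True False
          by (intro emeasure_Diff) (auto simp: emeasure_cball intro: le_less_trans[OF _ s1])
        ultimately show ?thesis
          using True False emeasure_cball[of "sqrt x" "0::complex"]
          by (simp add: emeasure_disc unit_ball_vol_2 ennreal_minus algebra_simps)
      next
        case False
        have "\<D> \<inter> {z. x < (cmod z)\<^sup>2} = {}"
        proof -
          have "(cmod z)\<^sup>2 < x" if "cmod z < 1" for z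
            using that False power_strict_mono[of "cmod z" 1 2] by simp
          then show ?thesis by force
        qed
        then show ?thesis using False by simp
      qed
    qed
    also have "\<dots> / ennreal pi = ennreal (1 - max 0 (min 1 x))"
      by (subst divide_ennreal) auto
    finally show ?thesis .
  qed
  show "emeasure (distr disc_area borel (\<lambda>z. (cmod z)\<^sup>2)) {x<..} < \<infinity>" for x
    unfolding * by simp
  show "emeasure (distr disc_area borel (\<lambda>z. (cmod z)\<^sup>2)) {x<..} =
      emeasure (density lborel (indicator {0..1})) {x<..}" for x :: real
  proof -
    have "emeasure (density lborel (indicator {0..1})) {x<..} = emeasure lborel ({0..1} \<inter> {x<..})"
      by (subst emeasure_density) (auto simp flip: indicator_inter_arith)
    also have "{0..1} \<inter> {x<..} = (if x < 0 then {0..1} else {x<..1})" by auto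
    also have "emeasure lborel \<dots> = ennreal (1 - max 0 (min 1 x))"
      by (cases "x < 0"; cases "x \<le> 1") auto
    finally show ?thesis by (simp add: *)
  qed
qed auto

definition circle_mean :: "(complex \<Rightarrow> ennreal) \<Rightarrow> real \<Rightarrow> ennreal" where
  "circle_mean F r = (\<integral>\<^sup>+\<theta>\<in>{0..2 * pi}. F (of_real r * cis \<theta>) \<partial>lborel) / ennreal (2 * pi)"

text \<open>
Averaging over all rotations replaces \<open>F\<close> by its
mean over circles, which is a function of the modulus alone. The distribution of the squared modulus does the rest.
\<close>
lemma nn_integral_disc_area_polar:
  assumes [measurable]: "F \<in> borel_measurable (borel :: complex measure)"
  shows "(\<integral>\<^sup>+z. F z \<partial>disc_area) = (\<integral>\<^sup>+u\<in>{0..1}. circle_mean F (sqrt u) \<partial>lborel)"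
proof -
  interpret A: finite_measure disc_area
    by standard (simp add: disc_area_def emeasure_disc)
  interpret pair_sigma_finite lborel disc_area ..
  have shift: "(\<integral>\<^sup>+\<theta>\<in>{0..2 * pi}. F (cis \<theta> * z) \<partial>lborel) = (\<integral>\<^sup>+\<theta>\<in>{0..2 * pi}. F (of_real (cmod z) * cis \<theta>) \<partial>lborel)" for z
  proof -
    have eq: "cis \<theta> * z = of_real (cmod z) * cis (\<theta> + Arg2pi z)" for \<theta>
    proof -
      have "of_real (cmod z) * cis (Arg2pi z) = z"
        using Arg2pi_eq[of z] by (simp only: cis_conv_exp)
      moreover have "of_real (cmod z) * cis (\<theta> + Arg2pi z) = cis \<theta> * (of_real (cmod z) * cis (Arg2pi z))"
        by (simp add: cis_mult[symmetric])
      ultimately show ?thesis by simp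
    qed
    have per: "cis (\<theta> + 2 * pi) = cis \<theta>" for \<theta>
      by (simp add: complex_eq_iff)
    then show ?thesis
      using nn_integral_periodic_shift[of "\<lambda>\<theta>. F (of_real (cmod z) * cis \<theta>)" "2 * pi" "Arg2pi z"]
        Arg2pi_ge_0[of z] Arg2pi_lt_2pi[of z]
      by (simp add: eq per)
  qed
  have mm[measurable]: "(\<lambda>r. circle_mean F r) \<in> borel_measurable borel"
    unfolding circle_mean_def by measurable
  have K: "ennreal (2 * pi) \<noteq> 0" "ennreal (2 * pi) \<noteq> top" by auto
  have "(\<integral>\<^sup>+z. F z \<partial>disc_area) * ennreal (2 * pi) = (\<integral>\<^sup>+\<theta>\<in>{0..2 * pi}. (\<integral>\<^sup>+z. F z \<partial>disc_area) \<partial>lborel)"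
    by (subst nn_integral_cmult_indicator) auto
  also have "\<dots> = (\<integral>\<^sup>+\<theta>. \<integral>\<^sup>+z. F (cis \<theta> * z) * indicator {0..2 * pi} \<theta> \<partial>disc_area \<partial>lborel)"
    by (intro nn_integral_cong, subst nn_integral_multc) (auto simp: nn_integral_disc_rotate)
  also have "\<dots> = (\<integral>\<^sup>+z. (\<integral>\<^sup>+\<theta>\<in>{0..2 * pi}. F (cis \<theta> * z) \<partial>lborel) \<partial>disc_area)"
    by (rule Fubini'[symmetric]) measurable
  also have "\<dots> = (\<integral>\<^sup>+z. circle_mean F (cmod z) * ennreal (2 * pi) \<partial>disc_area)"
    unfolding shift circle_mean_def by (simp add: ennreal_divide_times)
  also have "\<dots> = (\<integral>\<^sup>+z. circle_mean F (cmod z) \<partial>disc_area) * ennreal (2 * pi)"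
    by (rule nn_integral_multc) measurable
  finally have "(\<integral>\<^sup>+z. F z \<partial>disc_area) = (\<integral>\<^sup>+z. circle_mean F (cmod z) \<partial>disc_area)"
    by (metis K ennreal_mult_divide_eq)
  also have "\<dots> = (\<integral>\<^sup>+z. circle_mean F (sqrt ((cmod z)\<^sup>2)) \<partial>disc_area)" by simp
  also have "\<dots> = (\<integral>\<^sup>+u. circle_mean F (sqrt u) \<partial>distr disc_area borel (\<lambda>z. (cmod z)\<^sup>2))"
    by (rule nn_integral_distr[symmetric]) measurable
  also have "\<dots> = (\<integral>\<^sup>+u\<in>{0..1}. circle_mean F (sqrt u) \<partial>lborel)"
    unfolding distr_disc_area_norm_square
    by (subst nn_integral_density) (auto simp: mult.commute)
  finally show ?thesis .
qed

section \<open>Kernel estimates on circles and on the disc\<close>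

lemma Jordan_sin_ge:
  fixes x :: real
  assumes "0 \<le> x" "x \<le> pi / 2"
  shows "2 * x / pi \<le> sin x"
proof -
  have "concave_on {0..pi} (sin :: real \<Rightarrow> real)"
    unfolding concave_on_def
  proof (rule f''_ge0_imp_convex)
    show "((\<lambda>x. - sin x) has_real_derivative - cos x) (at x)" for x :: real
      by (auto intro!: derivative_eq_intros)
    show "((\<lambda>x. - cos x) has_real_derivative sin x) (at x)" for x :: real
      by (auto intro!: derivative_eq_intros)
    show "0 \<le> sin x" if "x \<in> {0..pi}" for x :: real
      using that by (auto intro: sin_ge_zero)
  qed simp
  then have "(1 - 2 * x / pi) * sin 0 + 2 * x / pi * sin (pi / 2) \<le>
      sin ((1 - 2 * x / pi) *\<^sub>R 0 + (2 * x / pi) *\<^sub>R (pi / 2))"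
    by (rule concave_onD) (use assms in \<open>auto simp: field_simps\<close>)
  then show ?thesis by simp
qed

text \<open>
Seen from \<open>1\<close>, a ray at angle at most \<open>\<pi> / 2\<close> has distance \<open>sin t\<close>, and any other ray has distance at
least \<open>1\<close>.
\<close>
lemma norm_one_minus_cis_ge:
  assumes r: "0 \<le> r" and t: "0 \<le> t" "t \<le> pi"
  shows "t / pi \<le> cmod (1 - of_real r * cis t)"
proof (cases "t \<le> pi / 2")
  case True
  have "t / pi \<le> 2 * t / pi" using t by (simp add: field_simps)
  also have "\<dots> \<le> sin t" using Jordan_sin_ge[OF t(1) True] .
  also have "\<dots> \<le> \<bar>Im (cis (- t) - of_real r)\<bar>" by simp
  also have "\<dots> \<le> cmod (cis (- t) - of_real r)" by (rule abs_Im_le_cmod)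
  also have "cis (- t) - of_real r = cis (- t) * (1 - of_real r * cis t)"
  proof -
    have "cis (- t) * (1 - of_real r * cis t) = cis (- t) - of_real r * (cis (- t) * cis t)"
      by (simp add: algebra_simps)
    also have "cis (- t) * cis t = 1" by (simp only: cis_mult) simp
    finally show ?thesis by simp
  qed
  also have "cmod (cis (- t) * (1 - of_real r * cis t)) = cmod (1 - of_real r * cis t)"
    by (simp add: norm_mult)
  finally show ?thesis .
next
  case False
  have "cos t \<le> 0"
    using cos_monotone_0_pi_le[of "pi / 2" t] False t by simp
  then have "r * cos t \<le> 0" using r by (simp add: mult_nonneg_nonpos)
  have "t / pi \<le> 1" using t by simp
  also have "\<dots> \<le> \<bar>Re (1 - of_real r * cis t)\<bar>" using \<open>r * cos t \<le> 0\<close> by simp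
  also have "\<dots> \<le> cmod (1 - of_real r * cis t)" by (rule abs_Re_le_cmod)
  finally show ?thesis .
qed

lemma one_minus_le_norm: "0 \<le> r \<Longrightarrow> 1 - r \<le> cmod (1 - of_real r * cis t)"
  using norm_triangle_ineq2[of 1 "of_real r * cis t"] by (simp add: norm_mult)

text \<open>
The point at modulus \<open>r\<close> and angle \<open>t\<close> has distance from \<open>1\<close> comparable to \<open>(1 - r) + |t|\<close>, and the
corresponding power integrates in closed form. The two terms of the majorant treat the two ends of \<open>[0, 2 \<pi>]\<close>.
\<close>
lemma circle_kernel_integral_le:
  fixes p r :: real
  assumes p: "1 < p" and r: "0 \<le> r" "r < 1"
  shows "(\<lambda>t. cmod (1 - of_real r * cis t) powr (-p)) integrable_on {0..2 * pi}"
    and "integral {0..2 * pi} (\<lambda>t. cmod (1 - of_real r * cis t) powr (-p))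
           \<le> 2 powr p * (2 * pi / (p - 1)) * (1 - r) powr (1 - p)"
proof -
  define d where "d = 1 - r"
  have d: "0 < d" using r by (simp add: d_def)
  have pos: "0 < cmod (1 - of_real r * cis t)" for t
    using one_minus_le_norm[OF r(1), of t] r by linarith
  then have nz: "1 - of_real r * cis t \<noteq> 0" for t by fastforce
  show int: "(\<lambda>t. cmod (1 - of_real r * cis t) powr (-p)) integrable_on {0..2 * pi}"
    using nz by (intro integrable_continuous_real continuous_intros) auto
  define V where "V = pi / (p - 1) * (d powr (1 - p) - (d + 2) powr (1 - p))"
  have k: "pi / (1 - p) = - (pi / (p - 1))" "- pi / (1 - p) = pi / (p - 1)"
    using p by (simp_all add: divide_simps algebra_simps)
  have I1: "((\<lambda>t. (d + t / pi) powr (-p)) has_integral V) {0..2 * pi}"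
  proof -
    have "((\<lambda>t. (d + t / pi) powr (-p)) has_integral
        (pi / (1 - p) * (d + (2 * pi) / pi) powr (1 - p) - pi / (1 - p) * (d + 0 / pi) powr (1 - p))) {0..2 * pi}"
    proof (rule fundamental_theorem_of_calculus)
      fix t assume "t \<in> {0..2 * pi}"
      then have *: "0 < d + t / pi" using d by (intro add_pos_nonneg) auto
      have "((\<lambda>t. pi / (1 - p) * (d + t / pi) powr (1 - p)) has_real_derivative (d + t / pi) powr (-p))
          (at t within {0..2 * pi})"
        using * p by (auto intro!: derivative_eq_intros)
      then show "((\<lambda>t. pi / (1 - p) * (d + t / pi) powr (1 - p)) has_vector_derivative (d + t / pi) powr (-p))
          (at t within {0..2 * pi})"
        by (simp add: has_real_derivative_iff_has_vector_derivative)
    qed simp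
    moreover have "pi / (1 - p) * (d + (2 * pi) / pi) powr (1 - p) - pi / (1 - p) * (d + 0 / pi) powr (1 - p) = V"
      unfolding k V_def using p by (simp add: right_diff_distrib)
    ultimately show ?thesis by simp
  qed
  have I2: "((\<lambda>t. (d + (2 * pi - t) / pi) powr (-p)) has_integral V) {0..2 * pi}"
  proof -
    have "((\<lambda>t. (d + (2 * pi - t) / pi) powr (-p)) has_integral
        ((- pi / (1 - p)) * (d + (2 * pi - 2 * pi) / pi) powr (1 - p) - (- pi / (1 - p)) * (d + (2 * pi - 0) / pi) powr (1 - p))) {0..2 * pi}"
    proof (rule fundamental_theorem_of_calculus)
      fix t assume "t \<in> {0..2 * pi}"
      then have *: "0 < d + (2 * pi - t) / pi" using d by (intro add_pos_nonneg) auto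
      have "((\<lambda>t. (- pi / (1 - p)) * (d + (2 * pi - t) / pi) powr (1 - p)) has_real_derivative
            (d + (2 * pi - t) / pi) powr (-p)) (at t within {0..2 * pi})"
        using * p by (auto intro!: derivative_eq_intros)
      then show "((\<lambda>t. (- pi / (1 - p)) * (d + (2 * pi - t) / pi) powr (1 - p)) has_vector_derivative
            (d + (2 * pi - t) / pi) powr (-p)) (at t within {0..2 * pi})"
        by (simp add: has_real_derivative_iff_has_vector_derivative)
    qed simp
    moreover have "(- pi / (1 - p)) * (d + (2 * pi - 2 * pi) / pi) powr (1 - p) - (- pi / (1 - p)) * (d + (2 * pi - 0) / pi) powr (1 - p) = V"
      unfolding k V_def using p by (simp add: right_diff_distrib)
    ultimately show ?thesis by simp
  qed
  have I: "((\<lambda>t. 2 powr p * ((d + t / pi) powr (-p) + (d + (2 * pi - t) / pi) powr (-p)))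
      has_integral (2 powr p * (V + V))) {0..2 * pi}"
    by (intro has_integral_mult_right has_integral_add I1 I2)
  have half: "cmod (1 - of_real r * cis t) powr (-p) \<le> 2 powr p * (d + x) powr (-p)"
    if "0 \<le> x" "x \<le> cmod (1 - of_real r * cis t)" for t x
  proof -
    have "(d + x) / 2 \<le> cmod (1 - of_real r * cis t)"
      using that one_minus_le_norm[OF r(1), of t] by (simp add: d_def)
    then have "cmod (1 - of_real r * cis t) powr (-p) \<le> ((d + x) / 2) powr (-p)"
      using that d p by (intro powr_mono2') auto
    also have "\<dots> = 2 powr p * (d + x) powr (-p)"
      using that d by (simp add: powr_divide powr_minus divide_simps)
    finally show ?thesis .
  qed
  have pw: "cmod (1 - of_real r * cis t) powr (-p) \<le>
      2 powr p * ((d + t / pi) powr (-p) + (d + (2 * pi - t) / pi) powr (-p))"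
    if t: "t \<in> {0..2 * pi}" for t
  proof (cases "t \<le> pi")
    case True
    then have "cmod (1 - of_real r * cis t) powr (-p) \<le> 2 powr p * (d + t / pi) powr (-p)"
      using t by (intro half norm_one_minus_cis_ge r) auto
    also have "\<dots> \<le> 2 powr p * ((d + t / pi) powr (-p) + (d + (2 * pi - t) / pi) powr (-p))"
      by (intro mult_left_mono) auto
    finally show ?thesis .
  next
    case False
    have "cmod (1 - of_real r * cis t) = cmod (cnj (1 - of_real r * cis t))" by (rule complex_mod_cnj[symmetric])
    also have "cnj (1 - of_real r * cis t) = 1 - of_real r * cis (2 * pi - t)"
      by (simp add: complex_eq_iff)
    finally have "(2 * pi - t) / pi \<le> cmod (1 - of_real r * cis t)"
      using norm_one_minus_cis_ge[OF r(1), of "2 * pi - t"] False t by simp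
    then have "cmod (1 - of_real r * cis t) powr (-p) \<le> 2 powr p * (d + (2 * pi - t) / pi) powr (-p)"
      using t by (intro half) auto
    also have "\<dots> \<le> 2 powr p * ((d + t / pi) powr (-p) + (d + (2 * pi - t) / pi) powr (-p))"
      by (intro mult_left_mono) auto
    finally show ?thesis .
  qed
  have "integral {0..2 * pi} (\<lambda>t. cmod (1 - of_real r * cis t) powr (-p)) \<le> 2 powr p * (V + V)"
    by (rule has_integral_le[OF integrable_integral[OF int] I pw])
  also have "V \<le> pi / (p - 1) * d powr (1 - p)"
    unfolding V_def using p by (intro mult_left_mono) auto
  then have "2 powr p * (V + V) \<le> 2 powr p * (pi / (p - 1) * d powr (1 - p) + pi / (p - 1) * d powr (1 - p))"
    by (intro mult_left_mono add_mono) auto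
  also have "\<dots> = 2 powr p * (2 * pi / (p - 1)) * (1 - r) powr (1 - p)"
    by (simp add: d_def algebra_simps)
  finally show "integral {0..2 * pi} (\<lambda>t. cmod (1 - of_real r * cis t) powr (-p))
           \<le> 2 powr p * (2 * pi / (p - 1)) * (1 - r) powr (1 - p)" .
qed

lemma nn_integral_circle_kernel_le:
  fixes p r :: real
  assumes p: "1 < p" and r: "0 \<le> r" "r < 1"
  shows "(\<integral>\<^sup>+\<theta>\<in>{0..2 * pi}. ennreal (cmod (1 - of_real r * cis \<theta>) powr (-p)) \<partial>lborel)
     \<le> ennreal (2 powr p * (2 * pi / (p - 1)) * (1 - r) powr (1 - p))"
proof -
  have "(\<integral>\<^sup>+\<theta>\<in>{0..2 * pi}. ennreal (cmod (1 - of_real r * cis \<theta>) powr (-p)) \<partial>lborel) =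
      ennreal (integral {0..2 * pi} (\<lambda>t. cmod (1 - of_real r * cis t) powr (-p)))"
    by (rule nn_integral_has_integral_lebesgue'[OF _ integrable_integral[OF circle_kernel_integral_le(1)[OF p r]]]) simp
  then show ?thesis using circle_kernel_integral_le(2)[OF p r] by (simp add: ennreal_leI)
qed

text \<open>
The integrand is at most a multiple of \<open>1 / (1 - u)\<close>, whose integral up to \<open>a\<close> produces the logarithm. Beyond
\<open>a\<close> the second factor is at most \<open>(1 - a) powr (1 - p)\<close>, and the integral is bounded.
\<close>
lemma weight_integral_le:
  fixes a p :: real
  assumes a: "0 \<le> a" "a < 1" and p: "1 < p"
  shows "(\<integral>\<^sup>+u\<in>{0..1}. ennreal ((1 - u) powr (p - 2) * (1 - a * sqrt u) powr (1 - p)) \<partial>lborel)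
     \<le> ennreal ((2 powr (p - 1) + 1 / (p - 1)) * ln (exp 1 / (1 - a)))"
proof -
  have I1: "((\<lambda>u. 2 powr (p - 1) * (1 / (1 - u))) has_integral (2 powr (p - 1) * (- ln (1 - a) - - ln (1 - 0)))) {0..a}"
  proof (intro has_integral_mult_right fundamental_theorem_of_calculus)
    fix u assume "u \<in> {0..a}"
    then show "((\<lambda>u. - ln (1 - u)) has_vector_derivative 1 / (1 - u)) (at u within {0..a})"
      using a unfolding has_real_derivative_iff_has_vector_derivative[symmetric]
      by (auto intro!: derivative_eq_intros)
  qed (use a in simp)
  have I2: "((\<lambda>u. (1 - a) powr (1 - p) * (1 - u) powr (p - 2)) has_integral
     ((1 - a) powr (1 - p) * (- ((1 - 1) powr (p - 1) / (p - 1)) - - ((1 - a) powr (p - 1) / (p - 1))))) {a..1}"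
  proof (intro has_integral_mult_right fundamental_theorem_of_calculus_interior)
    show "continuous_on {a..1} (\<lambda>u. - ((1 - u) powr (p - 1) / (p - 1)))"
      using p by (intro continuous_intros continuous_on_powr') auto
    fix u assume "u \<in> {a<..<1}"
    then have "((\<lambda>u. (1 - u) powr (p - 1)) has_real_derivative (p - 1) * (1 - u) powr (p - 1 - 1) * (0 - 1)) (at u)"
      by (intro DERIV_fun_powr derivative_intros) auto
    from DERIV_minus[OF DERIV_cdivide[OF this, of "p - 1"]]
    have "((\<lambda>u. - ((1 - u) powr (p - 1) / (p - 1))) has_real_derivative (1 - u) powr (p - 2)) (at u)"
      using p by simp
    then show "((\<lambda>u. - ((1 - u) powr (p - 1) / (p - 1))) has_vector_derivative (1 - u) powr (p - 2)) (at u)"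
      by (simp add: has_real_derivative_iff_has_vector_derivative)
  qed (use a in simp)
  have pw: "ennreal ((1 - u) powr (p - 2) * (1 - a * sqrt u) powr (1 - p)) * indicator {0..1} u \<le>
      ennreal (2 powr (p - 1) * (1 / (1 - u))) * indicator {0..a} u +
      ennreal ((1 - a) powr (1 - p) * (1 - u) powr (p - 2)) * indicator {a..1} u" for u
  proof -
    consider "u \<notin> {0..1}" | "u \<in> {0..1}" "a < u \<or> u = 1" | "0 \<le> u" "u \<le> a" "u < 1" by fastforce
    then show ?thesis
    proof cases
      case 2
      have "a * sqrt u \<le> a * 1" using 2 a by (intro mult_left_mono) (auto simp: real_sqrt_le_1_iff)
      then have "(1 - a * sqrt u) powr (1 - p) \<le> (1 - a) powr (1 - p)"
        using a p by (intro powr_mono2') auto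
      then have "(1 - u) powr (p - 2) * (1 - a * sqrt u) powr (1 - p) \<le> (1 - a) powr (1 - p) * (1 - u) powr (p - 2)"
        using mult_right_mono[of "(1 - a * sqrt u) powr (1 - p)" "(1 - a) powr (1 - p)" "(1 - u) powr (p - 2)"]
        by (simp add: mult.commute)
      then have "ennreal ((1 - u) powr (p - 2) * (1 - a * sqrt u) powr (1 - p)) \<le>
          ennreal ((1 - a) powr (1 - p) * (1 - u) powr (p - 2))" by (rule ennreal_leI)
      moreover have "u \<in> {a..1}" using 2 a by auto
      ultimately show ?thesis using 2 by (auto intro: add_increasing)
    next
      case 3
      have "sqrt u \<le> (1 + u) / 2"
        using arith_geo_mean_sqrt[of 1 u] 3 by simp
      moreover have "a * sqrt u \<le> 1 * sqrt u" using a 3 by (intro mult_right_mono) auto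
      ultimately have "a * sqrt u \<le> (1 + u) / 2" by simp
      then have "(1 - u) / 2 \<le> 1 - a * sqrt u" by (simp add: field_simps)
      then have "(1 - a * sqrt u) powr (1 - p) \<le> ((1 - u) / 2) powr (1 - p)"
        using 3 p by (intro powr_mono2') auto
      also have "\<dots> = 2 powr (p - 1) * (1 - u) powr (1 - p)"
        using 3 powr_minus_divide[of 2 "p - 1"] by (simp add: powr_divide)
      finally have "(1 - u) powr (p - 2) * (1 - a * sqrt u) powr (1 - p) \<le>
          (1 - u) powr (p - 2) * (2 powr (p - 1) * (1 - u) powr (1 - p))"
        by (intro mult_left_mono) auto
      also have "\<dots> = 2 powr (p - 1) * ((1 - u) powr (p - 2) * (1 - u) powr (1 - p))" by simp
      also have "(1 - u) powr (p - 2) * (1 - u) powr (1 - p) = 1 / (1 - u)"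
        using 3 by (simp add: powr_add[symmetric] powr_minus_divide)
      finally have "ennreal ((1 - u) powr (p - 2) * (1 - a * sqrt u) powr (1 - p)) \<le>
          ennreal (2 powr (p - 1) * (1 / (1 - u)))" by (rule ennreal_leI)
      then show ?thesis using 3 by (auto intro: add_increasing2)
    qed auto
  qed
  have "(\<integral>\<^sup>+u\<in>{0..1}. ennreal ((1 - u) powr (p - 2) * (1 - a * sqrt u) powr (1 - p)) \<partial>lborel) \<le>
      (\<integral>\<^sup>+u. ennreal (2 powr (p - 1) * (1 / (1 - u))) * indicator {0..a} u +
      ennreal ((1 - a) powr (1 - p) * (1 - u) powr (p - 2)) * indicator {a..1} u \<partial>lborel)"
    by (rule nn_integral_mono) (rule pw)
  also have "\<dots> = (\<integral>\<^sup>+u. ennreal (2 powr (p - 1) * (1 / (1 - u))) * indicator {0..a} u \<partial>lborel) +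
      (\<integral>\<^sup>+u. ennreal ((1 - a) powr (1 - p) * (1 - u) powr (p - 2)) * indicator {a..1} u \<partial>lborel)"
    by (rule nn_integral_add) auto
  also have "(\<integral>\<^sup>+u. ennreal (2 powr (p - 1) * (1 / (1 - u))) * indicator {0..a} u \<partial>lborel) =
      ennreal (2 powr (p - 1) * (- ln (1 - a) - - ln (1 - 0)))"
    by (rule nn_integral_has_integral_lebesgue'[OF _ I1]) (use a in auto)
  also have "(\<integral>\<^sup>+u. ennreal ((1 - a) powr (1 - p) * (1 - u) powr (p - 2)) * indicator {a..1} u \<partial>lborel) =
     ennreal ((1 - a) powr (1 - p) * (- ((1 - 1) powr (p - 1) / (p - 1)) - - ((1 - a) powr (p - 1) / (p - 1))))"
    by (rule nn_integral_has_integral_lebesgue'[OF _ I2]) auto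
  also have "\<dots> = ennreal (1 / (p - 1))"
    using a p by (simp add: powr_add[symmetric])
  also have "ennreal (2 powr (p - 1) * (- ln (1 - a) - - ln (1 - 0))) + ennreal (1 / (p - 1)) =
      ennreal (2 powr (p - 1) * (- ln (1 - a)) + 1 / (p - 1))"
    using a p by (subst ennreal_plus) (auto intro!: mult_nonneg_nonpos)
  also have "\<dots> \<le> ennreal ((2 powr (p - 1) + 1 / (p - 1)) * ln (exp 1 / (1 - a)))"
  proof (rule ennreal_leI)
    have L: "ln (exp 1 / (1 - a)) = 1 + - ln (1 - a)" using a by (simp add: ln_div)
    have "0 \<le> - ln (1 - a)" using a by simp
    then have "0 \<le> 1 / (p - 1) * (- ln (1 - a))" using p by (intro mult_nonneg_nonneg) auto
    moreover have "(2 powr (p - 1) + 1 / (p - 1)) * (1 + x) = 2 powr (p - 1) + 2 powr (p - 1) * x + 1 / (p - 1) + 1 / (p - 1) * x" for x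
      by (simp add: algebra_simps add_divide_distrib)
    ultimately show "2 powr (p - 1) * - ln (1 - a) + 1 / (p - 1) \<le> (2 powr (p - 1) + 1 / (p - 1)) * ln (exp 1 / (1 - a))"
      unfolding L by (smt (verit) powr_ge_zero)
  qed
  finally show ?thesis .
qed

text \<open>
The borderline case of the Forelli-Rudin estimates, in which the integral grows logarithmically. After a rotation
\<open>z\<close> is a point of \<open>[0,1)\<close>, and polar coordinates reduce the estimate to the circle and to the radius.
\<close>
theorem Forelli_Rudin_log:
  fixes p :: real
  assumes p: "1 < p"
  shows "\<exists>C>0. \<forall>z\<in>\<D>. (\<integral>\<^sup>+w. ennreal ((1 - (cmod w)\<^sup>2) powr (p - 2) * cmod (1 - z * cnj w) powr (-p)) \<partial>disc_area)
     \<le> ennreal (C * ln (exp 1 / (1 - cmod z)))"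
proof -
  define A where "A = 2 powr p * (2 * pi / (p - 1))"
  define B where "B = 2 powr (p - 1) + 1 / (p - 1)"
  have AB: "0 < A" "0 < B" using p by (auto simp: A_def B_def intro!: mult_pos_pos divide_pos_pos add_pos_pos)
  have bound: "(\<integral>\<^sup>+w. ennreal ((1 - (cmod w)\<^sup>2) powr (p - 2) * cmod (1 - z * cnj w) powr (-p)) \<partial>disc_area)
     \<le> ennreal (A / (2 * pi) * B * ln (exp 1 / (1 - cmod z)))" if z: "z \<in> \<D>" for z
  proof -
    define a where "a = cmod z"
    have a: "0 \<le> a" "a < 1" using z by (auto simp: a_def)
    obtain c where c: "cmod c = 1" "z = of_real a * c"
    proof (cases "z = 0")
      case True
      then show ?thesis using that[of 1] by (simp add: a_def)
    next
      case False
      have "cmod (sgn z) = 1" using False by (simp add: norm_sgn)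
      moreover have "z = of_real a * sgn z" using False by (simp add: a_def sgn_eq)
      ultimately show ?thesis by (rule that)
    qed
    let ?F = "\<lambda>w. ennreal ((1 - (cmod w)\<^sup>2) powr (p - 2) * cmod (1 - z * cnj w) powr (-p))"
    let ?G = "\<lambda>w. ennreal ((1 - (cmod w)\<^sup>2) powr (p - 2) * cmod (1 - of_real a * cnj w) powr (-p))"
    have "c * cnj c = 1" using c(1) by (simp add: complex_norm_square[symmetric])
    then have "z * cnj (c * w) = of_real a * cnj w" for w
      by (simp add: c(2) algebra_simps)
    then have FG: "?F (c * w) = ?G w" for w using c(1) by (simp only: norm_mult mult_1_left)
    have "(\<integral>\<^sup>+w. ?F w \<partial>disc_area) = (\<integral>\<^sup>+w. ?F (c * w) \<partial>disc_area)"
      by (rule nn_integral_disc_rotate[symmetric]) (use c in measurable)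
    also have "\<dots> = (\<integral>\<^sup>+w. ?G w \<partial>disc_area)" unfolding FG ..
    also have "\<dots> = (\<integral>\<^sup>+u\<in>{0..1}. circle_mean ?G (sqrt u) \<partial>lborel)"
      by (rule nn_integral_disc_area_polar) measurable
    also have "\<dots> \<le> (\<integral>\<^sup>+u\<in>{0..1}. ennreal (A / (2 * pi)) * ennreal ((1 - u) powr (p - 2) * (1 - a * sqrt u) powr (1 - p)) \<partial>lborel)"
    proof (intro nn_integral_mono)
      fix u :: real
      show "circle_mean ?G (sqrt u) * indicator {0..1} u \<le>
          ennreal (A / (2 * pi)) * ennreal ((1 - u) powr (p - 2) * (1 - a * sqrt u) powr (1 - p)) * indicator {0..1} u"
      proof (cases "u \<in> {0..1}")
        case True
        have "a * sqrt u \<le> a * 1" using True a by (intro mult_left_mono) auto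
        then have au: "0 \<le> a * sqrt u" "a * sqrt u < 1"
          using True a by auto
        have G: "?G (of_real (sqrt u) * cis \<theta>) =
            ennreal ((1 - u) powr (p - 2)) * ennreal (cmod (1 - of_real (a * sqrt u) * cis \<theta>) powr (-p))" for \<theta>
        proof -
          have "cnj (1 - of_real a * cnj (of_real (sqrt u) * cis \<theta>)) = 1 - of_real (a * sqrt u) * cis \<theta>"
            by simp
          then have "cmod (1 - of_real a * cnj (of_real (sqrt u) * cis \<theta>)) = cmod (1 - of_real (a * sqrt u) * cis \<theta>)"
            by (metis complex_mod_cnj)
          then show ?thesis using True by (simp add: norm_mult ennreal_mult)
        qed
        have "circle_mean ?G (sqrt u) = ennreal ((1 - u) powr (p - 2)) *
            (\<integral>\<^sup>+\<theta>\<in>{0..2 * pi}. ennreal (cmod (1 - of_real (a * sqrt u) * cis \<theta>) powr (-p)) \<partial>lborel) / ennreal (2 * pi)"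
          unfolding circle_mean_def G mult.assoc
          by (subst nn_integral_cmult) auto
        also have "\<dots> \<le> ennreal ((1 - u) powr (p - 2)) * ennreal (A * (1 - a * sqrt u) powr (1 - p)) / ennreal (2 * pi)"
          unfolding A_def by (intro divide_right_mono_ennreal mult_left_mono nn_integral_circle_kernel_le p au) simp
        also have "\<dots> = ennreal (A / (2 * pi)) * ennreal ((1 - u) powr (p - 2) * (1 - a * sqrt u) powr (1 - p))"
          using AB by (simp add: ennreal_mult[symmetric] divide_ennreal mult_ac)
        finally show ?thesis using True by simp
      qed simp
    qed
    also have "\<dots> = ennreal (A / (2 * pi)) * (\<integral>\<^sup>+u\<in>{0..1}. ennreal ((1 - u) powr (p - 2) * (1 - a * sqrt u) powr (1 - p)) \<partial>lborel)"
      unfolding mult.assoc by (rule nn_integral_cmult) measurable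
    also have "\<dots> \<le> ennreal (A / (2 * pi)) * ennreal (B * ln (exp 1 / (1 - a)))"
      unfolding B_def by (intro mult_left_mono weight_integral_le a p) simp
    also have "\<dots> = ennreal (A / (2 * pi) * B * ln (exp 1 / (1 - cmod z)))"
      using AB a by (simp add: ennreal_mult'[symmetric] a_def mult.assoc)
    finally show ?thesis .
  qed
  show ?thesis
    by (rule exI[of _ "A / (2 * pi) * B"]) (use AB bound in auto)
qed

section \<open>Growth of Besov functions\<close>

lemma conjugate_exponent:
  fixes p q :: real
  assumes "1 < p" "1 / p + 1 / q = 1"
  shows "1 < q" "0 < 1 / q" "1 / q < 1"
proof -
  have "0 < 1 / p" "1 / p < 1" using assms(1) by auto
  then show *: "0 < 1 / q" "1 / q < 1" using assms(2) by linarith+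
  then show "1 < q" by (simp add: divide_less_eq split: if_splits)
qed

text \<open>
Hoelder's inequality, with \<open>A\<close> and \<open>B\<close> as upper bounds for the two norms. It follows by
integrating Young's inequality for \<open>a / A\<close> and \<open>b / B\<close>.
\<close>
lemma nn_integral_Hoelder:
  fixes a b :: "'a \<Rightarrow> real" and p q A B :: real
  assumes [measurable]: "a \<in> borel_measurable M" "b \<in> borel_measurable M"
    and nonneg: "\<And>x. 0 \<le> a x" "\<And>x. 0 \<le> b x"
    and pq: "1 < p" "1 < q" "1 / p + 1 / q = 1" and AB: "0 < A" "0 < B"
    and le: "(\<integral>\<^sup>+x. ennreal (a x powr p) \<partial>M) \<le> ennreal (A powr p)"
      "(\<integral>\<^sup>+x. ennreal (b x powr q) \<partial>M) \<le> ennreal (B powr q)"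
  shows "(\<integral>\<^sup>+x. ennreal (a x * b x) \<partial>M) \<le> ennreal (A * B)"
proof -
  have pos: "0 < A * B / (p * A powr p)" "0 < A * B / (q * B powr q)"
    using pq AB by (auto intro!: divide_pos_pos mult_pos_pos)
  have "a x * b x \<le> A * B / (p * A powr p) * a x powr p + A * B / (q * B powr q) * b x powr q" for x
  proof -
    have "(a x / A) * (b x / B) \<le> (a x / A) powr p / p + (b x / B) powr q / q"
      using pq AB nonneg[of x] by (intro Youngs_inequality) auto
    then have "A * B * ((a x / A) * (b x / B)) \<le> A * B * ((a x / A) powr p / p + (b x / B) powr q / q)"
      using AB by (intro mult_left_mono) auto
    moreover have "A * B * ((a x / A) * (b x / B)) = a x * b x" using AB by simp
    moreover have "A * B * ((a x / A) powr p / p + (b x / B) powr q / q) =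
        A * B / (p * A powr p) * a x powr p + A * B / (q * B powr q) * b x powr q"
      using AB nonneg[of x] by (simp add: powr_divide distrib_left mult_ac)
    ultimately show ?thesis by simp
  qed
  then have "(\<integral>\<^sup>+x. ennreal (a x * b x) \<partial>M) \<le>
      (\<integral>\<^sup>+x. ennreal (A * B / (p * A powr p)) * ennreal (a x powr p) + ennreal (A * B / (q * B powr q)) * ennreal (b x powr q) \<partial>M)"
  proof (intro nn_integral_mono)
    fix x assume le: "\<And>x. a x * b x \<le> A * B / (p * A powr p) * a x powr p + A * B / (q * B powr q) * b x powr q"
    have "ennreal (a x * b x) \<le> ennreal (A * B / (p * A powr p) * a x powr p + A * B / (q * B powr q) * b x powr q)"
      by (rule ennreal_leI[OF le])
    also have "\<dots> = ennreal (A * B / (p * A powr p) * a x powr p) + ennreal (A * B / (q * B powr q) * b x powr q)"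
      using pos by (intro ennreal_plus mult_nonneg_nonneg) auto
    also have "\<dots> = ennreal (A * B / (p * A powr p)) * ennreal (a x powr p) + ennreal (A * B / (q * B powr q)) * ennreal (b x powr q)"
      by (simp only: ennreal_mult''[OF powr_ge_zero])
    finally show "ennreal (a x * b x) \<le> \<dots>" .
  qed
  also have "\<dots> = ennreal (A * B / (p * A powr p)) * (\<integral>\<^sup>+x. ennreal (a x powr p) \<partial>M) +
      ennreal (A * B / (q * B powr q)) * (\<integral>\<^sup>+x. ennreal (b x powr q) \<partial>M)"
    by (simp add: nn_integral_add nn_integral_cmult)
  also have "\<dots> \<le> ennreal (A * B / (p * A powr p)) * ennreal (A powr p) + ennreal (A * B / (q * B powr q)) * ennreal (B powr q)"
    by (intro add_mono mult_left_mono le) auto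
  also have "\<dots> = ennreal (A * B / (p * A powr p) * A powr p) + ennreal (A * B / (q * B powr q) * B powr q)"
    by (simp only: ennreal_mult''[OF powr_ge_zero])
  also have "\<dots> = ennreal (A * B / (p * A powr p) * A powr p + A * B / (q * B powr q) * B powr q)"
    using pos by (intro ennreal_plus[symmetric] mult_nonneg_nonneg) auto
  also have "A * B / (p * A powr p) * A powr p + A * B / (q * B powr q) * B powr q = A * B * (1 / p + 1 / q)"
  proof -
    have "A * B / (p * A powr p) * A powr p + A * B / (q * B powr q) * B powr q = A * B / p + A * B / q"
      using AB by simp
    then show ?thesis by (simp only: distrib_left times_divide_eq_right mult_1_right)
  qed
  finally show ?thesis by (simp only: pq(3) mult_1_right)
qed

lemma hol_disc_holomorphic_deriv:
  assumes "f \<in> hol_disc" shows "deriv f holomorphic_on \<D>"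
  using assms by (auto simp: hol_disc_def intro: holomorphic_deriv)

lemma hol_disc_continuous_deriv:
  assumes "f \<in> hol_disc" shows "continuous_on \<D> (deriv f)"
  by (rule holomorphic_on_imp_continuous_on[OF hol_disc_holomorphic_deriv[OF assms]])

lemma hol_disc_deriv_measurable:
  assumes "f \<in> hol_disc"
  shows "(\<lambda>w. indicator \<D> w *\<^sub>R deriv f w) \<in> borel_measurable borel"
  by (rule borel_measurable_continuous_on_indicator[OF _ hol_disc_continuous_deriv[OF assms]]) simp

lemma one_minus_cnj_nonzero:
  assumes "z \<in> \<D>" "cmod w \<le> 1" shows "1 - z * cnj w \<noteq> 0"
proof
  assume "1 - z * cnj w = 0"
  then have "cmod (z * cnj w) = 1" by simp
  moreover have "cmod z * cmod w \<le> cmod z * 1" using assms by (intro mult_left_mono) auto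
  ultimately show False using assms by (simp add: norm_mult)
qed

text \<open>
On the circle of radius \<open>sqrt u\<close> one has \<open>u = w (cnj w)\<close>, so Cauchy's formula at the point \<open>u z\<close> becomes the
mean of \<open>f' w / (1 - z (cnj w))\<close>. This choice of radius is what makes the Bergman-type kernel appear.
\<close>
lemma deriv_le_circle_mean:
  assumes f: "f \<in> hol_disc" and z: "z \<in> \<D>" and u: "0 < u" "u < 1"
  shows "ennreal (cmod (deriv f (of_real u * z))) \<le>
    circle_mean (\<lambda>w. ennreal (cmod (indicator \<D> w *\<^sub>R deriv f w) / cmod (1 - z * cnj w))) (sqrt u)"
proof -
  define R where "R = sqrt u"
  define w where "w = of_real u * z"
  have R: "0 < R" "R < 1" "u = R * R" using u by (auto simp: R_def)
  have w: "cmod w < R"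
  proof -
    have "cmod w = R * (R * cmod z)" using R u by (simp add: w_def norm_mult)
    also have "R * cmod z < 1 * 1" using R z by (intro mult_strict_mono) auto
    then have "R * (R * cmod z) < R * 1" using R by (intro mult_strict_left_mono) auto
    finally show ?thesis by simp
  qed
  have RD: "of_real R * cis t \<in> \<D>" for t using R by (simp add: norm_mult)
  have nz: "1 - z * cnj (of_real R * cis t) \<noteq> 0" for t
    using R by (intro one_minus_cnj_nonzero z) (auto simp: norm_mult)
  have sub: "cball 0 R \<subseteq> \<D>" using R by auto
  have "((\<lambda>x. deriv f x / (x - w)) has_contour_integral 2 * of_real pi * \<i> * deriv f w) (circlepath 0 R)"
    by (rule Cauchy_integral_circlepath_simple)
      (use holomorphic_on_subset[OF hol_disc_holomorphic_deriv[OF f] sub] w in auto)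
  then have I: "((\<lambda>t. deriv f (of_real R * cis t) / (of_real R * cis t - w) * R * \<i> * cis t) has_integral
      2 * of_real pi * \<i> * deriv f w) {0..2 * pi}"
    unfolding circlepath_def by (subst (asm) has_contour_integral_part_circlepath_iff) auto
  let ?h = "\<lambda>t. cmod (deriv f (of_real R * cis t)) / cmod (1 - z * cnj (of_real R * cis t))"
  have norm_eq: "cmod (deriv f (of_real R * cis t) / (of_real R * cis t - w) * R * \<i> * cis t) = ?h t" for t
  proof -
    have "of_real R * cis t - w = of_real R * cis t * (1 - z * cnj (of_real R * cis t))"
    proof -
      have "of_real R * cis t * (1 - z * cnj (of_real R * cis t)) =
          of_real R * cis t - of_real (R * R) * z * (cis t * cnj (cis t))"
        by (simp add: algebra_simps)
      also have "cis t * cnj (cis t) = 1" by (simp add: complex_norm_square[symmetric])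
      finally show ?thesis by (simp add: w_def R(3))
    qed
    then show ?thesis using R by (simp add: norm_mult norm_divide)
  qed
  have hc: "continuous_on {0..2 * pi} ?h"
  proof -
    have "continuous_on {0..2 * pi} (\<lambda>t. deriv f (of_real R * cis t))"
      by (rule continuous_on_compose2[OF hol_disc_continuous_deriv[OF f]])
        (use RD in \<open>auto intro!: continuous_intros\<close>)
    then show ?thesis using nz by (intro continuous_intros) auto
  qed
  have hi: "?h integrable_on {0..2 * pi}" by (rule integrable_continuous_real[OF hc])
  have "cmod (2 * of_real pi * \<i> * deriv f w) \<le> integral {0..2 * pi} ?h"
    unfolding integral_unique[OF I, symmetric]
    by (rule integral_norm_bound_integral[OF has_integral_integrable[OF I] hi]) (simp only: norm_eq order_refl)
  then have "cmod (deriv f w) \<le> integral {0..2 * pi} ?h / (2 * pi)"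
    by (simp add: norm_mult field_simps)
  then have "ennreal (cmod (deriv f w)) \<le> ennreal (integral {0..2 * pi} ?h / (2 * pi))"
    by (rule ennreal_leI)
  also have "\<dots> = ennreal (integral {0..2 * pi} ?h) / ennreal (2 * pi)"
    by (intro divide_ennreal[symmetric] integral_nonneg hi) auto
  also have "ennreal (integral {0..2 * pi} ?h) = (\<integral>\<^sup>+t\<in>{0..2 * pi}. ennreal (?h t) \<partial>lborel)"
    by (rule nn_integral_has_integral_lebesgue'[symmetric, OF _ integrable_integral[OF hi]]) simp
  also have "\<dots> / ennreal (2 * pi) = circle_mean (\<lambda>w. ennreal (cmod (indicator \<D> w *\<^sub>R deriv f w) / cmod (1 - z * cnj w))) R"
    unfolding circle_mean_def using RD by simp
  finally show ?thesis by (simp add: w_def R_def)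
qed

text \<open>
The previous bound integrated over \<open>u\<close> in \<open>[0,1]\<close>: on the left \<open>f'\<close> is integrated along the segment from
\<open>0\<close> to \<open>z\<close>, and on the right polar coordinates give an area integral. It is the inequality behind the reproducing
formula \<open>f z - f 0 = \<integral> f' w (z / (1 - z (cnj w))) dA(w)\<close>.
\<close>
lemma increment_le_area_integral:
  assumes f: "f \<in> hol_disc" and z: "z \<in> \<D>"
  shows "ennreal (cmod (f z - f 0)) \<le>
    (\<integral>\<^sup>+w. ennreal (cmod (indicator \<D> w *\<^sub>R deriv f w) / cmod (1 - z * cnj w)) \<partial>disc_area)"
proof -
  have uz: "of_real u * z \<in> \<D>" if "u \<in> {0..1}" for u
  proof -
    have "\<bar>u\<bar> * cmod z \<le> 1 * cmod z" using that by (intro mult_right_mono) auto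
    then show ?thesis using z by (simp add: norm_mult)
  qed
  have I: "((\<lambda>u. z * deriv f (of_real u * z)) has_integral (f (of_real 1 * z) - f (of_real 0 * z))) {0..1}"
  proof (rule fundamental_theorem_of_calculus)
    fix u :: real assume "u \<in> {0..1}"
    then have "(f has_field_derivative deriv f (of_real u * z)) (at (of_real u * z))"
      by (intro hol_disc_deriv[OF f] uz)
    moreover have "((\<lambda>u. of_real u * z) has_vector_derivative z) (at u within {0..1})"
      by (auto intro!: derivative_eq_intros has_vector_derivative_of_real simp: has_vector_derivative_def scaleR_conv_of_real mult.commute)
    ultimately have "((f \<circ> (\<lambda>u. of_real u * z)) has_vector_derivative z * deriv f (of_real u * z)) (at u within {0..1})"
      using field_vector_diff_chain_within[of "\<lambda>u. of_real u * z" z u "{0..1}" f] has_field_derivative_at_within by blast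
    then show "((\<lambda>u. f (of_real u * z)) has_vector_derivative z * deriv f (of_real u * z)) (at u within {0..1})"
      by (simp add: o_def)
  qed simp
  have "continuous_on {0..1} (\<lambda>u. deriv f (of_real u * z))"
    by (rule continuous_on_compose2[OF hol_disc_continuous_deriv[OF f]])
      (use uz in \<open>auto intro!: continuous_intros\<close>)
  then have hi: "(\<lambda>u. cmod (deriv f (of_real u * z))) integrable_on {0..1}"
    by (intro integrable_continuous_real continuous_intros)
  have "cmod (f z - f 0) \<le> integral {0..1} (\<lambda>u. cmod (deriv f (of_real u * z)))"
  proof -
    have eq: "f z - f 0 = integral {0..1} (\<lambda>u. z * deriv f (of_real u * z))"
      using integral_unique[OF I] by (simp only: of_real_1 of_real_0 mult_1 mult_zero_left)
    show ?thesis unfolding eq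
      using z by (intro integral_norm_bound_integral[OF has_integral_integrable[OF I] hi])
        (auto simp: norm_mult intro: mult_left_le_one_le)
  qed
  then have "ennreal (cmod (f z - f 0)) \<le> ennreal (integral {0..1} (\<lambda>u. cmod (deriv f (of_real u * z))))"
    by (rule ennreal_leI)
  also have "\<dots> = (\<integral>\<^sup>+u\<in>{0..1}. ennreal (cmod (deriv f (of_real u * z))) \<partial>lborel)"
    by (rule nn_integral_has_integral_lebesgue'[symmetric, OF _ integrable_integral[OF hi]]) simp
  also have "\<dots> \<le> (\<integral>\<^sup>+u\<in>{0..1}. circle_mean (\<lambda>w. ennreal (cmod (indicator \<D> w *\<^sub>R deriv f w) / cmod (1 - z * cnj w))) (sqrt u) \<partial>lborel)"
  proof (rule nn_integral_mono_AE)
    show "AE u in lborel. ennreal (cmod (deriv f (of_real u * z))) * indicator {0..1} u \<le>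
      circle_mean (\<lambda>w. ennreal (cmod (indicator \<D> w *\<^sub>R deriv f w) / cmod (1 - z * cnj w))) (sqrt u) * indicator {0..1} u"
      using AE_lborel_singleton[of 0] AE_lborel_singleton[of 1]
    proof eventually_elim
      case (elim u)
      then show ?case using deriv_le_circle_mean[OF f z, of u]
        by (cases "u \<in> {0..1}") (auto simp: less_le)
    qed
  qed
  also have "\<dots> = (\<integral>\<^sup>+w. ennreal (cmod (indicator \<D> w *\<^sub>R deriv f w) / cmod (1 - z * cnj w)) \<partial>disc_area)"
  proof (rule nn_integral_disc_area_polar[symmetric])
    have "(\<lambda>w. cmod (indicator \<D> w *\<^sub>R deriv f w) / cmod (1 - z * cnj w)) \<in> borel_measurable borel"
      by (rule borel_measurable_divide[OF measurable_compose[OF hol_disc_deriv_measurable[OF f] borel_measurable_norm]]) measurable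
    then show "(\<lambda>w. ennreal (cmod (indicator \<D> w *\<^sub>R deriv f w) / cmod (1 - z * cnj w))) \<in> borel_measurable borel"
      by (rule measurable_compose[OF _ measurable_ennreal])
  qed
  finally show ?thesis .
qed

lemma one_le_log_weight: "0 \<le> x \<Longrightarrow> x < 1 \<Longrightarrow> 1 \<le> ln (exp 1 / (1 - x))" for x :: real
  by (simp add: ln_div)

lemma besov_norm_nonneg: "0 \<le> besov_norm p f"
  by (simp add: besov_norm_def)

text \<open>
Hoelder's inequality in the area integral, after \<open>f'\<close> is multiplied by
\<open>(1 - |w|\<^sup>2) powr ((p - 2) / p)\<close> and the kernel by its inverse. The \<open>q\<close>-th power of the inverse is
\<open>(1 - |w|\<^sup>2) powr (q - 2)\<close>, which is exactly the weight of the logarithmic Forelli-Rudin estimate.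
\<close>
lemma besov_growth:
  fixes p q :: real
  assumes p: "1 < p" and pq: "1 / p + 1 / q = 1"
  shows "\<exists>C>0. \<forall>f\<in>besov p. \<forall>z\<in>\<D>.
    cmod (f z) \<le> C * besov_norm p f * ln (exp 1 / (1 - cmod z)) powr (1 / q)"
proof -
  note q = conjugate_exponent(1)[OF p pq]
  obtain K where K: "0 < K" "\<And>z. z \<in> \<D> \<Longrightarrow>
      (\<integral>\<^sup>+w. ennreal ((1 - (cmod w)\<^sup>2) powr (q - 2) * cmod (1 - z * cnj w) powr (-q)) \<partial>disc_area)
      \<le> ennreal (K * ln (exp 1 / (1 - cmod z)))"
    using Forelli_Rudin_log[OF q] by (elim exE conjE) auto
  define e where "e = (p - 2) / p"
  have ep: "e * p = p - 2" using p by (simp add: e_def)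
  have eq': "e * q = 2 - q"
  proof -
    have "1 / p = 1 - 1 / q" using pq by simp
    then have "e = 2 / q - 1" using p by (simp add: e_def diff_divide_distrib)
    then show ?thesis using q by (simp add: left_diff_distrib)
  qed
  have main: "cmod (f z) \<le> (1 + K powr (1 / q)) * ln (exp 1 / (1 - cmod z)) powr (1 / q) * M"
    if f: "f \<in> besov p" and z: "z \<in> \<D>" and M: "besov_norm p f < M" for f z M
  proof -
    have fh: "f \<in> hol_disc" and int: "set_integrable disc_area \<D> (besov_integrand p f)"
      using f by (auto simp: besov_def)
    define S where "S = (LINT z:\<D>|disc_area. besov_integrand p f z)"
    have S0: "0 \<le> S" unfolding S_def set_lebesgue_integral_def
      by (rule Bochner_Integration.integral_nonneg) (auto simp: besov_integrand_def indicator_def)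
    have normf: "besov_norm p f = cmod (f 0) + S powr (1 / p)" by (simp add: besov_norm_def S_def)
    have M0: "0 < M" using M normf by (smt (verit) norm_ge_zero powr_ge_zero)
    define L where "L = ln (exp 1 / (1 - cmod z))"
    have L: "1 \<le> L" using z by (simp add: L_def ln_div)
    define a where "a w = cmod (indicator \<D> w *\<^sub>R deriv f w) * (1 - (cmod w)\<^sup>2) powr e" for w
    define b where "b w = (1 - (cmod w)\<^sup>2) powr (-e) / cmod (1 - z * cnj w)" for w
    have [measurable]: "a \<in> borel_measurable borel" "b \<in> borel_measurable borel"
      unfolding a_def b_def using hol_disc_deriv_measurable[OF fh] by measurable
    have a_int: "ennreal (a w powr p) = ennreal (indicator \<D> w *\<^sub>R besov_integrand p f w)" for w
      using p by (cases "w \<in> \<D>") (auto simp: a_def besov_integrand_def powr_mult powr_powr ep)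
    have "(\<integral>\<^sup>+w. ennreal (a w powr p) \<partial>disc_area) = ennreal S"
      unfolding a_int S_def set_lebesgue_integral_def
      by (rule nn_integral_eq_integral[OF int[unfolded set_integrable_def]])
        (auto simp: besov_integrand_def indicator_def)
    also have "\<dots> \<le> ennreal (M powr p)"
    proof (rule ennreal_leI)
      have "S = (S powr (1 / p)) powr p" using S0 p by (simp add: powr_powr)
      also have "\<dots> \<le> M powr p" using M normf p by (intro powr_mono2) (auto intro: order_trans[OF _ less_imp_le[OF M]])
      finally show "S \<le> M powr p" .
    qed
    finally have A: "(\<integral>\<^sup>+w. ennreal (a w powr p) \<partial>disc_area) \<le> ennreal (M powr p)" .
    have "b w powr q = (1 - (cmod w)\<^sup>2) powr (q - 2) * cmod (1 - z * cnj w) powr (-q)" for w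
    proof -
      have "b w powr q = (1 - (cmod w)\<^sup>2) powr (- e * q) / cmod (1 - z * cnj w) powr q"
        by (simp add: b_def powr_divide powr_powr)
      also have "- e * q = q - 2" using eq' by simp
      finally show ?thesis by (simp only: powr_minus divide_inverse)
    qed
    then have B: "(\<integral>\<^sup>+w. ennreal (b w powr q) \<partial>disc_area) \<le> ennreal (((K * L) powr (1 / q)) powr q)"
      using K(2)[OF z] K(1) L q by (simp add: powr_powr L_def)
    have "(\<integral>\<^sup>+w. ennreal (cmod (indicator \<D> w *\<^sub>R deriv f w) / cmod (1 - z * cnj w)) \<partial>disc_area)
        = (\<integral>\<^sup>+w. ennreal (a w * b w) \<partial>disc_area)"
    proof (rule nn_integral_cong)
      fix w
      show "ennreal (cmod (indicator \<D> w *\<^sub>R deriv f w) / cmod (1 - z * cnj w)) = ennreal (a w * b w)"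
      proof (cases "w \<in> \<D>")
        case True
        then have "(cmod w)\<^sup>2 < 1" using power_strict_mono[of "cmod w" 1 2] by simp
        then have "(1 - (cmod w)\<^sup>2) powr e * (1 - (cmod w)\<^sup>2) powr (-e) = 1"
          by (simp add: powr_add[symmetric])
        then show ?thesis using True by (simp add: a_def b_def mult.assoc[symmetric] divide_inverse)
      qed (simp add: a_def)
    qed
    also have "\<dots> \<le> ennreal (M * (K * L) powr (1 / q))"
    proof (rule nn_integral_Hoelder[OF _ _ _ _ p q pq _ _ A B])
      show "a \<in> borel_measurable disc_area" "b \<in> borel_measurable disc_area" by measurable
    qed (use M0 K(1) L in \<open>auto simp: a_def b_def\<close>)
    finally have "ennreal (cmod (f z - f 0)) \<le> ennreal (M * (K * L) powr (1 / q))"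
      by (rule order_trans[OF increment_le_area_integral[OF fh z]])
    then have "cmod (f z - f 0) \<le> M * (K * L) powr (1 / q)"
      using M0 by (subst (asm) ennreal_le_iff) auto
    moreover have "cmod (f z) \<le> cmod (f z - f 0) + cmod (f 0)"
      using norm_triangle_ineq[of "f z - f 0" "f 0"] by simp
    moreover have "cmod (f 0) \<le> M * L powr (1 / q)"
    proof -
      have "cmod (f 0) \<le> M * 1" using M normf powr_ge_zero[of S "1 / p"] by linarith
      also have "\<dots> \<le> M * L powr (1 / q)"
        using M0 L q by (intro mult_left_mono ge_one_powr_ge_zero) auto
      finally show ?thesis .
    qed
    ultimately have "cmod (f z) \<le> M * (K * L) powr (1 / q) + M * L powr (1 / q)" by linarith
    also have "\<dots> = (1 + K powr (1 / q)) * L powr (1 / q) * M"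
      using K L by (simp add: powr_mult algebra_simps)
    finally show ?thesis by (simp add: L_def)
  qed
  have "cmod (f z) \<le> (1 + K powr (1 / q)) * besov_norm p f * ln (exp 1 / (1 - cmod z)) powr (1 / q)"
    if f: "f \<in> besov p" and z: "z \<in> \<D>" for f z
  proof -
    define D where "D = (1 + K powr (1 / q)) * ln (exp 1 / (1 - cmod z)) powr (1 / q)"
    have "0 < ln (exp 1 / (1 - cmod z))" using one_le_log_weight[of "cmod z"] z by (intro less_le_trans[OF zero_less_one]) simp_all
    then have D: "0 < D" unfolding D_def by (intro mult_pos_pos) (auto intro: add_pos_nonneg)
    \<comment> \<open>Hoelder's inequality needs a positive bound \<open>M\<close>, so a vanishing norm is reached as a limit.\<close>
    have "cmod (f z) / D \<le> besov_norm p f"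
    proof (rule dense_ge)
      fix M assume "besov_norm p f < M"
      from main[OF f z this] show "cmod (f z) / D \<le> M" using D by (simp add: D_def field_simps)
    qed
    then show ?thesis using D by (simp add: D_def field_simps)
  qed
  then show ?thesis by (intro exI[of _ "1 + K powr (1 / q)"]) (auto intro: add_pos_nonneg)
qed

section \<open>The Cesaro-like operator as an integral\<close>

text \<open>
The Cauchy product of the Taylor series of \<open>f\<close> and the geometric series.
\<close>
lemma taylor_partial_sums:
  assumes f: "f \<in> hol_disc" and z: "z \<in> \<D>"
  shows "(\<lambda>n. (\<Sum>k\<le>n. taylor_coeff f k) * z ^ n) sums (f z / (1 - z))"
proof -
  have ser: "(\<lambda>n. taylor_coeff f n * w ^ n) sums f w" if "w \<in> \<D>" for w
    using holomorphic_power_series[of f 0 1 w] f that by (simp add: hol_disc_def taylor_coeff_def)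
  have z1: "cmod z < 1" using z by simp
  obtain r where r: "cmod z < r" "r < 1" using dense[OF z1] by blast
  have r0: "0 < r" using r(1) norm_ge_zero[of z] by linarith
  have "summable (\<lambda>n. norm (taylor_coeff f n * z ^ n))"
    by (rule powser_insidea[of _ "of_real r"]) (use ser[of "of_real r"] r r0 in \<open>auto simp: sums_iff\<close>)
  moreover have "summable (\<lambda>n. norm (z ^ n))" using z1 by (simp add: norm_power)
  ultimately have "(\<lambda>n. \<Sum>i\<le>n. taylor_coeff f i * z ^ i * z ^ (n - i)) sums
      ((\<Sum>n. taylor_coeff f n * z ^ n) * (\<Sum>n. z ^ n))"
    by (rule Cauchy_product_sums)
  moreover have "(\<Sum>i\<le>n. taylor_coeff f i * z ^ i * z ^ (n - i)) = (\<Sum>k\<le>n. taylor_coeff f k) * z ^ n" for n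
    unfolding sum_distrib_right
    by (intro sum.cong) (auto simp: mult.assoc power_add[symmetric])
  ultimately show ?thesis
    using ser[OF z] z1 by (simp add: sums_iff suminf_geometric divide_inverse)
qed

lemma finite_borel_measure_01D:
  assumes "finite_borel_measure_01 \<mu>"
  shows "finite_measure \<mu>" "space \<mu> = {0..<1}"
    "\<And>g. g \<in> borel_measurable borel \<Longrightarrow> g \<in> borel_measurable \<mu>"
proof -
  have s: "sets \<mu> = sets (restrict_space borel {0..<1})" and "finite_measure \<mu>"
    using assms by (auto simp: finite_borel_measure_01_def)
  then show "finite_measure \<mu>" by simp
  show "space \<mu> = {0..<1}" using sets_eq_imp_space_eq[OF s] by (simp add: space_restrict_space)
  fix g :: "real \<Rightarrow> 'b::topological_space" assume "g \<in> borel_measurable borel"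
  then show "g \<in> borel_measurable \<mu>"
    unfolding measurable_cong_sets[OF s refl] by (rule measurable_restrict_space1)
qed

text \<open>
Interchange of sum and integral for a power series whose coefficients are multiplied by moments. The shift
\<open>j\<close> serves the derivative, in which the moment \<open>\<mu>\<^sub>n\<^sub>+\<^sub>1\<close> goes with the power \<open>z ^ n\<close>.
\<close>
lemma moment_series:
  fixes c :: "nat \<Rightarrow> complex"
  assumes mu: "finite_borel_measure_01 \<mu>"
    and c: "\<And>z. z \<in> \<D> \<Longrightarrow> summable (\<lambda>n. c n * z ^ n)" and z: "z \<in> \<D>"
  shows "integrable \<mu> (\<lambda>t. of_real (t ^ j) * (\<Sum>n. c n * (of_real t * z) ^ n))"
    and "(\<lambda>n. of_real (LINT t|\<mu>. t ^ (n + j)) * c n * z ^ n) sums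
          (LINT t|\<mu>. of_real (t ^ j) * (\<Sum>n. c n * (of_real t * z) ^ n))"
proof -
  note mu' = finite_borel_measure_01D[OF mu]
  interpret finite_measure \<mu> by (rule mu')
  define h where "h n t = of_real (t ^ (n + j)) * (c n * z ^ n)" for n and t :: real
  have hle: "cmod (h n t) \<le> cmod (c n * z ^ n)" if "t \<in> space \<mu>" for n t
    using that mu'(2) by (simp add: h_def norm_mult norm_power mult_left_le_one_le power_le_one)
  have tint: "integrable \<mu> (\<lambda>t. t ^ k)" for k
    by (rule integrable_const_bound[of _ 1])
      (use mu'(2) in \<open>auto intro!: mu'(3) AE_I2 simp: power_le_one norm_power\<close>)
  have hint: "integrable \<mu> (h n)" for n
    unfolding h_def by (intro integrable_mult_left integrable_of_real tint)
  have z1: "cmod z < 1" using z by simp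
  obtain r where r: "cmod z < r" "r < 1" using dense[OF z1] by blast
  have r0: "0 < r" using r(1) norm_ge_zero[of z] by linarith
  have sm: "summable (\<lambda>n. cmod (c n * z ^ n))"
    by (rule powser_insidea[of _ "of_real r"]) (use c[of "of_real r"] r r0 in auto)
  have 1: "AE t in \<mu>. summable (\<lambda>n. cmod (h n t))"
    by (rule AE_I2, rule summable_comparison_test'[OF sm]) (use hle in auto)
  have 2: "summable (\<lambda>n. LINT t|\<mu>. cmod (h n t))"
  proof (rule summable_comparison_test'[OF summable_mult2[OF sm, of "measure \<mu> (space \<mu>)"]])
    fix n
    have "(LINT t|\<mu>. cmod (h n t)) \<le> (LINT t|\<mu>. cmod (c n * z ^ n))"
      by (rule integral_mono) (use hint hle in auto)
    moreover have "0 \<le> (LINT t|\<mu>. cmod (h n t))" by (rule Bochner_Integration.integral_nonneg) simp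
    ultimately show "norm (LINT t|\<mu>. cmod (h n t)) \<le> cmod (c n * z ^ n) * measure \<mu> (space \<mu>)"
      by (simp add: mult.commute)
  qed
  have hsum: "(\<Sum>n. h n t) = of_real (t ^ j) * (\<Sum>n. c n * (of_real t * z) ^ n)" if "t \<in> space \<mu>" for t
  proof -
    have "\<bar>t\<bar> * cmod z \<le> 1 * cmod z" using that mu'(2) by (intro mult_right_mono) auto
    then have "of_real t * z \<in> \<D>" using z1 by (simp add: norm_mult)
    from suminf_mult[OF c[OF this], of "of_real (t ^ j)"] show ?thesis
      by (simp add: h_def power_add power_mult_distrib mult_ac)
  qed
  show "integrable \<mu> (\<lambda>t. of_real (t ^ j) * (\<Sum>n. c n * (of_real t * z) ^ n))"
    using integrable_suminf[OF hint 1 2]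
    by (rule iffD1[OF Bochner_Integration.integrable_cong, rotated -1]) (auto simp: hsum)
  have "(\<lambda>n. LINT t|\<mu>. h n t) sums (LINT t|\<mu>. (\<Sum>n. h n t))"
    by (rule sums_integral[OF hint 1 2])
  moreover have "(LINT t|\<mu>. (\<Sum>n. h n t)) = (LINT t|\<mu>. of_real (t ^ j) * (\<Sum>n. c n * (of_real t * z) ^ n))"
    by (rule Bochner_Integration.integral_cong) (auto simp: hsum)
  moreover have "(LINT t|\<mu>. h n t) = of_real (LINT t|\<mu>. t ^ (n + j)) * c n * z ^ n" for n
    unfolding h_def by (subst integral_mult_left_zero) (simp only: integral_complex_of_real mult.assoc)
  ultimately show "(\<lambda>n. of_real (LINT t|\<mu>. t ^ (n + j)) * c n * z ^ n) sums
          (LINT t|\<mu>. of_real (t ^ j) * (\<Sum>n. c n * (of_real t * z) ^ n))" by simp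
qed

context
  fixes \<mu> :: "real measure" and f :: "complex \<Rightarrow> complex"
  assumes mu: "finite_borel_measure_01 \<mu>" and f: "f \<in> hol_disc"
begin

lemma cesaro_scaled_in_disc: "t \<in> space \<mu> \<Longrightarrow> z \<in> \<D> \<Longrightarrow> of_real t * z \<in> \<D>"
  using finite_borel_measure_01D(2)[OF mu] mult_right_mono[of t 1 "cmod z"] by (auto simp: norm_mult)

lemma cesaro_op_eq_integral:
  assumes z: "z \<in> \<D>"
  shows "integrable \<mu> (\<lambda>t. f (of_real t * z) / (1 - of_real t * z))"
    and "cesaro_op \<mu> f z = (LINT t|\<mu>. f (of_real t * z) / (1 - of_real t * z))"
proof -
  define S where "S n = (\<Sum>k\<le>n. taylor_coeff f k)" for n
  have sums: "(\<lambda>n. S n * w ^ n) sums (f w / (1 - w))" if "w \<in> \<D>" for w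
    unfolding S_def by (rule taylor_partial_sums[OF f that])
  have summ: "\<And>w. w \<in> \<D> \<Longrightarrow> summable (\<lambda>n. S n * w ^ n)" using sums by (auto simp: sums_iff)
  have eq: "of_real (t ^ 0) * (\<Sum>n. S n * (of_real t * z) ^ n) = f (of_real t * z) / (1 - of_real t * z)"
    if "t \<in> space \<mu>" for t
    using sums[OF cesaro_scaled_in_disc[OF that z]] by (simp add: sums_iff)
  show "integrable \<mu> (\<lambda>t. f (of_real t * z) / (1 - of_real t * z))"
    using moment_series(1)[OF mu summ z, of 0]
    by (rule iffD1[OF Bochner_Integration.integrable_cong, rotated -1]) (use eq in auto)
  have "cesaro_op \<mu> f z = (\<Sum>n. of_real (LINT t|\<mu>. t ^ (n + 0)) * S n * z ^ n)"
    using z by (simp add: cesaro_op_def S_def)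
  also have "\<dots> = (LINT t|\<mu>. of_real (t ^ 0) * (\<Sum>n. S n * (of_real t * z) ^ n))"
    using moment_series(2)[OF mu summ z, of 0] by (simp add: sums_iff)
  also have "\<dots> = (LINT t|\<mu>. f (of_real t * z) / (1 - of_real t * z))"
    by (rule Bochner_Integration.integral_cong[OF refl eq])
  finally show "cesaro_op \<mu> f z = (LINT t|\<mu>. f (of_real t * z) / (1 - of_real t * z))" .
qed

text \<open>
Both the image and \<open>F w = f w / (1 - w)\<close> are sums of power series. Termwise differentiation turns the claim into the
interchange of sum and integral for moments shifted by one.
\<close>
lemma cesaro_op_has_derivative:
  assumes z: "z \<in> \<D>"
  shows "integrable \<mu> (\<lambda>t. of_real t * deriv (\<lambda>w. f w / (1 - w)) (of_real t * z))"
    and "(cesaro_op \<mu> f has_field_derivative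
           (LINT t|\<mu>. of_real t * deriv (\<lambda>w. f w / (1 - w)) (of_real t * z))) (at z)"
proof -
  define S where "S n = (\<Sum>k\<le>n. taylor_coeff f k)" for n
  define m where "m n = of_real (LINT t|\<mu>. t ^ n) * S n" for n
  have sums: "(\<lambda>n. S n * w ^ n) sums (f w / (1 - w))" if "w \<in> \<D>" for w
    unfolding S_def by (rule taylor_partial_sums[OF f that])
  have summ: "\<And>w. w \<in> \<D> \<Longrightarrow> summable (\<lambda>n. S n * w ^ n)" using sums by (auto simp: sums_iff)
  have msumm: "\<And>w. w \<in> \<D> \<Longrightarrow> summable (\<lambda>n. m n * w ^ n)"
    using moment_series(2)[OF mu summ, of _ 0] by (simp add: sums_iff m_def)
  have pser: "((\<lambda>w. \<Sum>n. a n * w ^ n) has_field_derivative (\<Sum>n. diffs a n * w ^ n)) (at w)"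
      "summable (\<lambda>n. diffs a n * w ^ n)"
    if a: "\<And>w. w \<in> \<D> \<Longrightarrow> summable (\<lambda>n. a n * w ^ n)" and w: "w \<in> \<D>" for a :: "nat \<Rightarrow> complex" and w
  proof -
    have w1: "cmod w < 1" using w by simp
    obtain r where r: "cmod w < r" "r < 1" using dense[OF w1] by blast
    have r0: "0 < r" using r(1) norm_ge_zero[of w] by linarith
    show "((\<lambda>w. \<Sum>n. a n * w ^ n) has_field_derivative (\<Sum>n. diffs a n * w ^ n)) (at w)"
      by (rule termdiffs_strong[of _ "of_real r"]) (use a r r0 in auto)
    show "summable (\<lambda>n. diffs a n * w ^ n)"
      by (rule termdiff_converges[of _ 1]) (use a w1 in auto)
  qed
  have dF: "deriv (\<lambda>w. f w / (1 - w)) w = (\<Sum>n. diffs S n * w ^ n)" if "w \<in> \<D>" for w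
  proof (rule DERIV_imp_deriv, rule has_field_derivative_transform_within_open[OF pser(1)[OF summ that]])
    show "(\<Sum>n. S n * w ^ n) = f w / (1 - w)" if "w \<in> \<D>" for w
      using sums[OF that] by (simp add: sums_iff)
  qed (use that in auto)
  have eq: "of_real (t ^ 1) * (\<Sum>n. diffs S n * (of_real t * z) ^ n) =
      of_real t * deriv (\<lambda>w. f w / (1 - w)) (of_real t * z)" if "t \<in> space \<mu>" for t
    using dF[OF cesaro_scaled_in_disc[OF that z]] by simp
  note ms = moment_series[OF mu pser(2)[OF summ] z, of 1]
  show "integrable \<mu> (\<lambda>t. of_real t * deriv (\<lambda>w. f w / (1 - w)) (of_real t * z))"
    using ms(1) by (rule iffD1[OF Bochner_Integration.integrable_cong, rotated -1]) (use eq in auto)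
  have "(\<Sum>n. diffs m n * z ^ n) = (\<Sum>n. of_real (LINT t|\<mu>. t ^ (n + 1)) * diffs S n * z ^ n)"
    by (simp add: diffs_def m_def mult_ac)
  also have "\<dots> = (LINT t|\<mu>. of_real (t ^ 1) * (\<Sum>n. diffs S n * (of_real t * z) ^ n))"
    using ms(2) by (simp add: sums_iff)
  also have "\<dots> = (LINT t|\<mu>. of_real t * deriv (\<lambda>w. f w / (1 - w)) (of_real t * z))"
    by (rule Bochner_Integration.integral_cong[OF refl eq])
  finally have D: "(\<Sum>n. diffs m n * z ^ n) = \<dots>" .
  show "(cesaro_op \<mu> f has_field_derivative
           (LINT t|\<mu>. of_real t * deriv (\<lambda>w. f w / (1 - w)) (of_real t * z))) (at z)"
    unfolding D[symmetric]
    by (rule has_field_derivative_transform_within_open[OF pser(1)[OF msumm z], of \<D>])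
      (use z in \<open>auto simp: cesaro_op_def m_def S_def\<close>)
qed

lemma cesaro_op_hol_disc: "cesaro_op \<mu> f \<in> hol_disc"
  unfolding hol_disc_def holomorphic_on_open[OF open_ball]
  using cesaro_op_has_derivative(2) by (intro CollectI conjI ballI allI impI) (blast, simp add: cesaro_op_def)

end

lemma cesaro_op_add:
  assumes mu: "finite_borel_measure_01 \<mu>" and f: "f \<in> hol_disc" and g: "g \<in> hol_disc"
  shows "cesaro_op \<mu> (\<lambda>z. f z + g z) = (\<lambda>z. cesaro_op \<mu> f z + cesaro_op \<mu> g z)"
proof
  fix z show "cesaro_op \<mu> (\<lambda>z. f z + g z) z = cesaro_op \<mu> f z + cesaro_op \<mu> g z"
  proof (cases "z \<in> \<D>")
    case True
    show ?thesis
      unfolding cesaro_op_eq_integral(2)[OF mu hol_disc_add[OF f g] True]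
        cesaro_op_eq_integral(2)[OF mu f True] cesaro_op_eq_integral(2)[OF mu g True] add_divide_distrib
      by (rule Bochner_Integration.integral_add[OF cesaro_op_eq_integral(1)[OF mu f True] cesaro_op_eq_integral(1)[OF mu g True]])
  qed (simp add: cesaro_op_def)
qed

lemma cesaro_op_cmult:
  assumes mu: "finite_borel_measure_01 \<mu>" and f: "f \<in> hol_disc"
  shows "cesaro_op \<mu> (\<lambda>z. c * f z) = (\<lambda>z. c * cesaro_op \<mu> f z)"
proof
  fix z show "cesaro_op \<mu> (\<lambda>z. c * f z) z = c * cesaro_op \<mu> f z"
  proof (cases "z \<in> \<D>")
    case True
    show ?thesis
      unfolding cesaro_op_eq_integral(2)[OF mu hol_disc_cmult[OF f] True]
        cesaro_op_eq_integral(2)[OF mu f True] times_divide_eq_right[symmetric]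
      by (rule integral_mult_right_zero)
  qed (simp add: cesaro_op_def)
qed

section \<open>Carleson measures and the derivative of the image\<close>

lemma dyadic_scale:
  fixes d :: real assumes "0 < d" "d \<le> 1"
  obtains J :: nat where "d \<le> (1/2) ^ J" "(1/2) ^ Suc J < d"
proof -
  have ex: "\<exists>n. (1/2 :: real) ^ Suc n < d"
  proof -
    obtain n where "(1/2 :: real) ^ n < d" using real_arch_pow_inv[OF assms(1), of "1/2"] by auto
    moreover have "(1/2 :: real) ^ Suc n \<le> (1/2) ^ n" by simp
    ultimately show ?thesis by (intro exI[of _ n]) linarith
  qed
  define J where "J = (LEAST n. (1/2 :: real) ^ Suc n < d)"
  have 1: "(1/2 :: real) ^ Suc J < d" unfolding J_def by (rule LeastI_ex[OF ex])
  have 2: "d \<le> (1/2) ^ J"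
  proof (cases J)
    case (Suc n)
    then have "\<not> (1/2 :: real) ^ Suc n < d"
      using not_less_Least[of n "\<lambda>n. (1/2 :: real) ^ Suc n < d"] by (simp add: J_def)
    then show ?thesis using Suc by simp
  qed (use assms in simp)
  show ?thesis using that 1 2 by blast
qed

lemma log_kernel_antimono:
  fixes x y g b :: real
  assumes "0 < x" "x \<le> y" "y \<le> 1" "0 \<le> g" "0 \<le> b"
  shows "ln (exp 1 / y) powr g * y powr (-b) \<le> ln (exp 1 / x) powr g * x powr (-b)"
proof -
  have "1 \<le> ln (exp 1 / y)" "ln (exp 1 / y) \<le> ln (exp 1 / x)"
    using assms by (auto simp: ln_div)
  then have "ln (exp 1 / y) powr g \<le> ln (exp 1 / x) powr g"
    using assms(4) by (intro powr_mono2) auto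
  moreover have "y powr (-b) \<le> x powr (-b)"
    using assms by (intro powr_mono2') auto
  ultimately show ?thesis by (intro mult_mono) auto
qed

text \<open>
A bound for the integral of the kernel, stated through an integrable majorant. The kernel is decreasing
in the distance \<open>1 - t r\<close>, so it is at most a sum over the dyadic intervals \<open>[1 - 2\<^sup>-\<^sup>j, 1)\<close> of its value at the scale \<open>2\<^sup>-\<^sup>j\<^sup>-\<^sup>1\<close>. The Carleson condition cancels the logarithm in
each term and leaves a geometric series dominated by its last term, the one at scale \<open>1 - r\<close>.
\<close>
lemma log_carleson_kernel_bound:
  fixes g \<beta> :: real
  assumes mu: "finite_borel_measure_01 \<mu>" and carl: "log_carleson g 1 \<mu>"
    and g: "0 \<le> g" "g \<le> 1" and beta: "0 < \<beta>"
  shows "\<exists>C\<ge>0. \<forall>r\<in>{0..<1}. \<exists>s. integrable \<mu> s \<and>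
     (\<forall>t\<in>{0..<1}. ln (exp 1 / (1 - t * r)) powr g * (1 - t * r) powr (- (1 + \<beta>)) \<le> s t) \<and>
     (LINT t|\<mu>. s t) \<le> C * (1 - r) powr (- \<beta>)"
proof -
  note mu' = finite_borel_measure_01D[OF mu]
  interpret finite_measure \<mu> by (rule mu')
  obtain K where K: "\<And>t. t \<in> {0..<1} \<Longrightarrow>
      measure \<mu> {t..<1} * ln (exp 1 / (1 - t)) powr g / (1 - t) powr 1 \<le> K"
    using carl unfolding log_carleson_def bdd_above_def by blast
  have K0: "0 \<le> K"
    using order_trans[OF _ K[of 0]] by simp
  define x where "x j = (1/2 :: real) ^ j" for j
  have x: "0 < x j" "x j \<le> 1" "x (Suc j) = x j / 2" for j by (auto simp: x_def power_le_one)
  have xp: "x j powr (- \<beta>) = (2 powr \<beta>) ^ j" for j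
  proof -
    have "x j = 2 powr (- real j)"
      by (simp add: x_def powr_minus powr_realpow power_one_over inverse_eq_divide)
    then have "x j powr (- \<beta>) = 2 powr (- real j * - \<beta>)" by (simp only: powr_powr)
    also have "\<dots> = (2 powr \<beta>) powr real j" by (simp add: powr_powr mult.commute)
    also have "\<dots> = (2 powr \<beta>) ^ j" by (rule powr_realpow) simp
    finally show ?thesis .
  qed
  define \<phi> where "\<phi> y = ln (exp 1 / y) powr g * y powr (- (1 + \<beta>))" for y :: real
  define c where "c = 2 * 2 powr (1 + \<beta>)"
  define E where "E = 2 powr \<beta> / (2 powr \<beta> - 1)"
  have E1: "1 < 2 powr \<beta>" using beta powr_less_mono[of 0 \<beta> 2] by simp
  have E0: "0 \<le> E" using E1 by (auto simp: E_def)
  have term_le: "\<phi> (x (Suc j)) * measure \<mu> {1 - x j..<1} \<le> K * c * (2 powr \<beta>) ^ j" for j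
  proof -
    define L where "L = ln (exp 1 / x j)"
    have lam: "1 \<le> L" using x[of j] by (simp add: L_def ln_div)
    have m: "measure \<mu> {1 - x j..<1} * L powr g \<le> K * x j"
      using K[of "1 - x j"] x[of j] by (simp add: L_def divide_le_eq)
    have "ln (exp 1 / x (Suc j)) = L + ln 2"
      using x[of j] by (simp add: L_def ln_div ln_mult x(3))
    also have "\<dots> \<le> 2 * L" using lam ln_2_less_1 by linarith
    finally have l2: "ln (exp 1 / x (Suc j)) \<le> 2 * L" .
    have "1 \<le> ln (exp 1 / x (Suc j))" using x(1,2)[of "Suc j"] by (simp add: ln_div)
    then have "ln (exp 1 / x (Suc j)) powr g \<le> (2 * L) powr g"
      using l2 g by (intro powr_mono2) auto
    also have "\<dots> = 2 powr g * L powr g" using lam by (simp add: powr_mult)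
    also have "\<dots> \<le> 2 * L powr g"
      using g powr_mono[of g 1 2] by (intro mult_right_mono) auto
    finally have l3: "ln (exp 1 / x (Suc j)) powr g \<le> 2 * L powr g" .
    have "\<phi> (x (Suc j)) * measure \<mu> {1 - x j..<1} \<le>
        (2 * L powr g) * x (Suc j) powr (- (1 + \<beta>)) * measure \<mu> {1 - x j..<1}"
      unfolding \<phi>_def by (intro mult_right_mono l3) auto
    also have "\<dots> = 2 * x (Suc j) powr (- (1 + \<beta>)) * (measure \<mu> {1 - x j..<1} * L powr g)"
      by (simp add: mult_ac)
    also have "\<dots> \<le> 2 * x (Suc j) powr (- (1 + \<beta>)) * (K * x j)"
      by (intro mult_left_mono m) auto
    also have "x (Suc j) powr (- (1 + \<beta>)) = 2 powr (1 + \<beta>) * (x j powr (- \<beta>) * x j powr (-1))"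
    proof -
      have e: "- (1 + \<beta>) = - \<beta> + (- 1)" by simp
      have "(x j / 2) powr (- (1 + \<beta>)) = x j powr (- (1 + \<beta>)) / 2 powr (- (1 + \<beta>))"
        by (rule powr_divide)
      also have "\<dots> = 2 powr (1 + \<beta>) * x j powr (- (1 + \<beta>))"
        unfolding powr_minus_divide[of 2 "1 + \<beta>"] by simp
      also have "x j powr (- (1 + \<beta>)) = x j powr (- \<beta>) * x j powr (-1)"
        unfolding e by (rule powr_add)
      finally show ?thesis unfolding x(3) .
    qed
    also have "2 * (2 powr (1 + \<beta>) * (x j powr (- \<beta>) * x j powr (-1))) * (K * x j) = K * c * x j powr (- \<beta>)"
      using x(1)[of j] by (simp add: c_def powr_minus field_simps)
    also have "x j powr (- \<beta>) = (2 powr \<beta>) ^ j" by (rule xp)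
    finally show ?thesis .
  qed
  have "\<exists>s. integrable \<mu> s \<and>
     (\<forall>t\<in>{0..<1}. ln (exp 1 / (1 - t * r)) powr g * (1 - t * r) powr (- (1 + \<beta>)) \<le> s t) \<and>
     (LINT t|\<mu>. s t) \<le> K * c * E * (1 - r) powr (- \<beta>)" if r: "r \<in> {0..<1}" for r
  proof -
    obtain J where J: "1 - r \<le> x J" "x (Suc J) < 1 - r"
      using dyadic_scale[of "1 - r"] r by (auto simp: x_def)
    define s where "s t = (\<Sum>j\<le>J. \<phi> (x (Suc j)) * indicator {1 - x j..<1} t)" for t
    have sets: "{1 - x j..<1} \<in> sets \<mu>" for j
    proof -
      have "sets \<mu> = sets (restrict_space borel {0..<1})" using mu by (simp add: finite_borel_measure_01_def)
      then show ?thesis using x(2)[of j] by (auto simp: sets_restrict_space_iff)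
    qed
    have ind: "integrable \<mu> (\<lambda>t. \<phi> (x (Suc j)) * indicator {1 - x j..<1} t)" for j
      using sets by (intro integrable_mult_right) (simp add: less_top[symmetric])
    have 1: "integrable \<mu> s" unfolding s_def by (intro Bochner_Integration.integrable_sum ind)
    have 2: "ln (exp 1 / (1 - t * r)) powr g * (1 - t * r) powr (- (1 + \<beta>)) \<le> s t" if t: "t \<in> {0..<1}" for t
    proof -
      have tr: "t * r \<le> r" "t * r \<le> t" "0 \<le> t * r" using t r by (auto simp: mult_left_le_one_le mult_left_le)
      define A where "A = {j. j \<le> J \<and> 1 - x j \<le> t}"
      have A: "finite A" "A \<noteq> {}" using t by (auto simp: A_def x_def intro: exI[of _ 0])
      \<comment> \<open>The finest dyadic interval, down to the scale of \<open>1 - r\<close>, that contains \<open>t\<close>.\<close>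
      define j where "j = Max A"
      have j: "j \<le> J" "1 - x j \<le> t" using Max_in[OF A] by (auto simp: j_def A_def)
      have xj: "x (Suc j) \<le> 1 - t * r"
      proof (cases "j = J")
        case True then show ?thesis using J(2) tr by simp
      next
        case False
        have "Suc j \<notin> A" using Max_ge[OF A(1), of "Suc j"] by (auto simp: j_def)
        then show ?thesis using False j tr by (simp add: A_def)
      qed
      have "ln (exp 1 / (1 - t * r)) powr g * (1 - t * r) powr (- (1 + \<beta>)) \<le> \<phi> (x (Suc j))"
        unfolding \<phi>_def using g(1) beta tr(3) by (intro log_kernel_antimono xj x(1)) auto
      also have "\<dots> = \<phi> (x (Suc j)) * indicator {1 - x j..<1} t" using j t by simp
      also have "\<dots> \<le> s t"
        unfolding s_def by (rule member_le_sum) (use j in \<open>auto simp: \<phi>_def\<close>)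
      finally show ?thesis .
    qed
    have "(LINT t|\<mu>. s t) = (\<Sum>j\<le>J. \<phi> (x (Suc j)) * measure \<mu> {1 - x j..<1})"
    proof -
      have "(LINT t|\<mu>. s t) = (\<Sum>j\<le>J. LINT t|\<mu>. \<phi> (x (Suc j)) * indicator {1 - x j..<1} t)"
        unfolding s_def by (rule Bochner_Integration.integral_sum[OF ind])
      then show ?thesis using sets sets.sets_into_space[OF sets] by (simp add: Int_absorb2)
    qed
    also have "\<dots> \<le> (\<Sum>j\<le>J. K * c * (2 powr \<beta>) ^ j)"
      by (intro sum_mono term_le)
    also have "\<dots> = K * c * (((2 powr \<beta>) ^ Suc J - 1) / (2 powr \<beta> - 1))"
    proof -
      have "(\<Sum>j<Suc J. (2 powr \<beta>) ^ j) = ((2 powr \<beta>) ^ Suc J - 1) / (2 powr \<beta> - 1)"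
        using E1 by (intro geometric_sum) auto
      then show ?thesis by (simp only: sum_distrib_left[symmetric] lessThan_Suc_atMost)
    qed
    also have "\<dots> \<le> K * c * (E * (1 - r) powr (- \<beta>))"
    proof (intro mult_left_mono)
      have "((2 powr \<beta>) ^ Suc J - 1) / (2 powr \<beta> - 1) \<le> E * (2 powr \<beta>) ^ J"
        using E1 by (simp add: E_def divide_right_mono)
      also have "(2 powr \<beta>) ^ J = x J powr (- \<beta>)" by (rule xp[symmetric])
      also have "x J powr (- \<beta>) \<le> (1 - r) powr (- \<beta>)"
        using J(1) r beta by (intro powr_mono2') auto
      finally show "((2 powr \<beta>) ^ Suc J - 1) / (2 powr \<beta> - 1) \<le> E * (1 - r) powr (- \<beta>)"
        using E0 by (simp add: mult_left_mono)
      show "0 \<le> K * c" using K0 by (simp add: c_def)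
    qed
    finally have 3: "(LINT t|\<mu>. s t) \<le> K * c * E * (1 - r) powr (- \<beta>)" by (simp add: mult.assoc)
    show ?thesis using 1 2 3 by blast
  qed
  moreover have "0 \<le> K * c * E" using K0 E0 by (simp add: c_def)
  ultimately show ?thesis by blast
qed

text \<open>
Cauchy's estimate on the circle of radius \<open>(1 - |z|) / 2\<close> about \<open>z\<close>, on which the logarithm at most doubles and
the distance from \<open>1\<close> is at least half of \<open>|1 - z|\<close>.
\<close>
lemma deriv_quotient_bound:
  fixes g B :: real
  assumes f: "f \<in> hol_disc" and g: "0 \<le> g" "g \<le> 1" and B: "0 \<le> B"
    and growth: "\<And>w. w \<in> \<D> \<Longrightarrow> cmod (f w) \<le> B * ln (exp 1 / (1 - cmod w)) powr g"
    and z: "z \<in> \<D>"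
  shows "cmod (deriv (\<lambda>w. f w / (1 - w)) z) \<le>
     8 * B * ln (exp 1 / (1 - cmod z)) powr g / ((1 - cmod z) * cmod (1 - z))"
proof -
  define \<rho> where "\<rho> = (1 - cmod z) / 2"
  define L where "L = ln (exp 1 / (1 - cmod z))"
  have lam: "1 \<le> L" using one_le_log_weight[of "cmod z"] z by (simp add: L_def)
  have rho: "0 < \<rho>" using z by (simp add: \<rho>_def)
  have rz: "2 * \<rho> \<le> cmod (1 - z)" using norm_triangle_ineq2[of 1 z] by (simp add: \<rho>_def)
  have cb: "1 - cmod w \<ge> \<rho>" if "cmod (z - w) \<le> \<rho>" for w
    using norm_triangle_ineq2[of w z] that by (simp add: \<rho>_def norm_minus_commute)
  have sub: "cball z \<rho> \<subseteq> \<D>" using cb rho by (fastforce simp: dist_norm)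
  have hol: "(\<lambda>w. f w / (1 - w)) holomorphic_on \<D>"
    using f by (auto simp: hol_disc_def intro!: holomorphic_intros)
  have "norm ((deriv ^^ 1) (\<lambda>w. f w / (1 - w)) z) \<le> fact 1 * (4 * B * L powr g / cmod (1 - z)) / \<rho> ^ 1"
  proof (rule Cauchy_inequality)
    show "(\<lambda>w. f w / (1 - w)) holomorphic_on ball z \<rho>"
      using hol sub by (meson ball_subset_cball holomorphic_on_subset order_trans)
    show "continuous_on (cball z \<rho>) (\<lambda>w. f w / (1 - w))"
      using hol sub by (meson holomorphic_on_imp_continuous_on holomorphic_on_subset)
    show "0 < \<rho>" by (rule rho)
    fix w assume w: "cmod (z - w) = \<rho>"
    have w1: "\<rho> \<le> 1 - cmod w" using cb w by simp
    have wD: "w \<in> \<D>" using w1 rho by simp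
    have "ln (exp 1 / (1 - cmod w)) \<le> ln (exp 1 / \<rho>)"
      using w1 rho by (simp add: ln_div)
    also have "\<dots> = L + ln 2" using rho z by (simp add: L_def \<rho>_def ln_div ln_mult)
    also have "\<dots> \<le> 2 * L" using lam ln_2_less_1 by linarith
    finally have "ln (exp 1 / (1 - cmod w)) powr g \<le> (2 * L) powr g"
    proof (intro powr_mono2)
      have "1 \<le> ln (exp 1 / (1 - cmod w))" using wD by (intro one_le_log_weight) auto
      then show "0 \<le> ln (exp 1 / (1 - cmod w))" by linarith
    qed (rule g(1))
    also have "\<dots> = 2 powr g * L powr g" using lam by (simp add: powr_mult)
    also have "\<dots> \<le> 2 * L powr g"
      using g powr_mono[of g 1 2] by (intro mult_right_mono) auto
    finally have "B * ln (exp 1 / (1 - cmod w)) powr g \<le> B * (2 * L powr g)"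
      using B by (rule mult_left_mono)
    with growth[OF wD] have num: "cmod (f w) \<le> 2 * B * L powr g" by simp
    have den: "cmod (1 - z) / 2 \<le> cmod (1 - w)"
      using norm_triangle_ineq2[of "1 - z" "w - z"] w rz by (simp add: norm_minus_commute algebra_simps)
    have "cmod (f w / (1 - w)) \<le> (2 * B * L powr g) / (cmod (1 - z) / 2)"
      unfolding norm_divide using num den rz rho B by (intro frac_le) auto
    then show "cmod (f w / (1 - w)) \<le> 4 * B * L powr g / cmod (1 - z)" by simp
  qed
  then show ?thesis by (simp add: \<rho>_def L_def mult_ac)
qed

text \<open>
For \<open>b = 0\<close> this is the Bloch weight up to constants. A larger \<open>b\<close> allows the same growth inside a
cone at \<open>1\<close>, where the images of the operator are largest, and demands more near the rest of the circle.
\<close>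
definition cone_weight :: "real \<Rightarrow> complex \<Rightarrow> real" where
  "cone_weight b z = (1 - cmod z) powr (1 - b) * cmod (1 - z) powr b"

lemma one_minus_norm_le: "1 - cmod z \<le> cmod (1 - z)"
  using norm_triangle_ineq2[of 1 z] by simp

lemma cone_weight_ge:
  assumes "0 \<le> b" "z \<in> \<D>"
  shows "1 - cmod z \<le> cone_weight b z"
proof -
  have "1 - cmod z = (1 - cmod z) powr (1 - b) * (1 - cmod z) powr b"
    using assms by (simp add: powr_add[symmetric])
  also have "\<dots> \<le> cone_weight b z"
    unfolding cone_weight_def using assms by (intro mult_left_mono powr_mono2 one_minus_norm_le) auto
  finally show ?thesis .
qed

text \<open>
The condition \<open>1 < b s\<close> places the \<open>s\<close>-th power of \<open>|1 - z| powr (- b)\<close> in the range of the circle estimate. The powers of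
\<open>1 - r\<close> that come from the two factors of the weight then add up to \<open>1 / s - 1\<close>, for every such \<open>b\<close>.
\<close>
lemma weighted_bloch_subset_mean_lipschitz:
  assumes s: "1 < s" and b: "0 \<le> b" "b < 1" "1 < b * s"
  shows "weighted_bloch (cone_weight b) \<subseteq> mean_lipschitz s"
proof
  fix f assume f: "f \<in> weighted_bloch (cone_weight b)"
  then have fh: "f \<in> hol_disc" by (simp add: weighted_bloch_def)
  obtain M' where M': "\<And>z. z \<in> \<D> \<Longrightarrow> cone_weight b z * cmod (deriv f z) \<le> M'"
    using weighted_bloch_bound[OF f] by blast
  define M where "M = max M' 0"
  have M: "0 \<le> M" "\<And>z. z \<in> \<D> \<Longrightarrow> cone_weight b z * cmod (deriv f z) \<le> M"
    using M' by (auto simp: M_def intro: max.coboundedI1)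
  define A where "A = 1 / (2 * pi) * (2 powr (b * s) * (2 * pi / (b * s - 1)))"
  have A: "0 \<le> A" using b by (auto simp: A_def)
  have "(1 - r) powr (1 - 1 / s) * integral_mean s r (deriv f) \<le> A powr (1 / s) * M" if r: "r \<in> {0<..<1}" for r
  proof -
    have rD: "of_real r * cis \<theta> \<in> \<D>" for \<theta> using r by (simp add: norm_mult)
    have pos: "0 < cmod (1 - of_real r * cis \<theta>)" for \<theta>
      using one_minus_le_norm[of r \<theta>] r by auto
    define P where "P = M powr s * (1 - r) powr (- ((1 - b) * s))"
    have pw: "cmod (deriv f (of_real r * cis \<theta>)) powr s \<le> P * cmod (1 - of_real r * cis \<theta>) powr (- (b * s))" for \<theta>
    proof -
      have cw: "cone_weight b (of_real r * cis \<theta>) = (1 - r) powr (1 - b) * cmod (1 - of_real r * cis \<theta>) powr b"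
        using r by (simp add: cone_weight_def norm_mult)
      have cp: "0 < cone_weight b (of_real r * cis \<theta>)"
        unfolding cw using r pos[of \<theta>] by (intro mult_pos_pos) auto
      have "cmod (deriv f (of_real r * cis \<theta>)) \<le> M / cone_weight b (of_real r * cis \<theta>)"
        using M(2)[OF rD[of \<theta>]] cp by (simp add: field_simps)
      then have "cmod (deriv f (of_real r * cis \<theta>)) powr s \<le> (M / cone_weight b (of_real r * cis \<theta>)) powr s"
        using s by (intro powr_mono2) auto
      also have "\<dots> = P * cmod (1 - of_real r * cis \<theta>) powr (- (b * s))"
        unfolding cw P_def using M(1) r pos[of \<theta>]
        by (simp add: powr_divide powr_mult powr_powr powr_minus divide_simps)
      finally show ?thesis .
    qed
    have c1: "continuous_on {0..2 * pi} (\<lambda>\<theta>. deriv f (of_real r * cis \<theta>))"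
      by (rule continuous_on_compose2[OF hol_disc_continuous_deriv[OF fh]])
        (use rD in \<open>auto intro!: continuous_intros\<close>)
    have i1: "(\<lambda>\<theta>. cmod (deriv f (of_real r * cis \<theta>)) powr s) integrable_on {0..2 * pi}"
      using s by (intro integrable_continuous_real continuous_on_powr' c1 continuous_intros) auto
    have k: "0 \<le> r" "r < 1" using r by auto
    have "integral {0..2 * pi} (\<lambda>\<theta>. cmod (deriv f (of_real r * cis \<theta>)) powr s) \<le>
        integral {0..2 * pi} (\<lambda>\<theta>. P * cmod (1 - of_real r * cis \<theta>) powr (- (b * s)))"
      by (intro integral_le i1 integrable_on_mult_right circle_kernel_integral_le(1) b k pw)
    also have "\<dots> = P * integral {0..2 * pi} (\<lambda>\<theta>. cmod (1 - of_real r * cis \<theta>) powr (- (b * s)))"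
      by (rule integral_mult_right)
    also have "\<dots> \<le> P * (2 powr (b * s) * (2 * pi / (b * s - 1)) * (1 - r) powr (1 - b * s))"
      by (intro mult_left_mono circle_kernel_integral_le(2) b k) (simp add: P_def)
    finally have "1 / (2 * pi) * integral {0..2 * pi} (\<lambda>\<theta>. cmod (deriv f (of_real r * cis \<theta>)) powr s) \<le>
        1 / (2 * pi) * (P * (2 powr (b * s) * (2 * pi / (b * s - 1)) * (1 - r) powr (1 - b * s)))"
      by (intro mult_left_mono) auto
    also have "\<dots> = A * M powr s * ((1 - r) powr (- ((1 - b) * s)) * (1 - r) powr (1 - b * s))"
      by (simp add: A_def P_def)
    also have "(1 - r) powr (- ((1 - b) * s)) * (1 - r) powr (1 - b * s) = (1 - r) powr (1 - s)"
      by (simp add: powr_add[symmetric] algebra_simps)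
    finally have "integral_mean s r (deriv f) \<le> (A * M powr s * (1 - r) powr (1 - s)) powr (1 / s)"
      unfolding integral_mean_def
      using s i1 by (intro powr_mono2 mult_nonneg_nonneg integral_nonneg) auto
    also have "\<dots> = A powr (1 / s) * M * (1 - r) powr ((1 - s) / s)"
      using A M(1) r s by (simp add: powr_mult powr_powr)
    finally have "(1 - r) powr (1 - 1 / s) * integral_mean s r (deriv f) \<le>
        (1 - r) powr (1 - 1 / s) * (A powr (1 / s) * M * (1 - r) powr ((1 - s) / s))"
      by (intro mult_left_mono) auto
    also have "\<dots> = A powr (1 / s) * M * ((1 - r) powr (1 - 1 / s) * (1 - r) powr ((1 - s) / s))" by simp
    also have "(1 - r) powr (1 - 1 / s) * (1 - r) powr ((1 - s) / s) = 1"
      using r s by (simp add: powr_add[symmetric] diff_divide_distrib)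
    finally show ?thesis by simp
  qed
  then show "f \<in> mean_lipschitz s" using fh by (auto simp: mean_lipschitz_def bdd_above_def intro!: exI[of _ "A powr (1 / s) * M"])
qed

text \<open>
In the bound for the derivative of the quotient, \<open>|1 - t z|\<close> is at least both \<open>1 - t |z|\<close> and
\<open>|1 - z| / 2\<close>. Splitting the factor as a product of powers with exponents \<open>1 - b\<close> and \<open>b\<close> leaves a kernel
in \<open>t |z|\<close> for the Carleson condition and the factor \<open>|1 - z| powr (- b)\<close>.
\<close>
lemma cesaro_deriv_bound:
  fixes g b :: real
  assumes mu: "finite_borel_measure_01 \<mu>" and carl: "log_carleson g 1 \<mu>"
    and g: "0 \<le> g" "g \<le> 1" and b: "0 \<le> b" "b < 1"
  shows "\<exists>C\<ge>0. \<forall>f\<in>hol_disc. \<forall>B\<ge>0.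
     (\<forall>w\<in>\<D>. cmod (f w) \<le> B * ln (exp 1 / (1 - cmod w)) powr g) \<longrightarrow>
     (\<forall>z\<in>\<D>. cone_weight b z * cmod (deriv (cesaro_op \<mu> f) z) \<le> C * B)"
proof -
  note mu' = finite_borel_measure_01D[OF mu]
  interpret finite_measure \<mu> by (rule mu')
  obtain C where C: "0 \<le> C" and step: "\<And>r. r \<in> {0..<1} \<Longrightarrow> \<exists>s. integrable \<mu> s \<and>
     (\<forall>t\<in>{0..<1}. ln (exp 1 / (1 - t * r)) powr g * (1 - t * r) powr (- (1 + (1 - b))) \<le> s t) \<and>
     (LINT t|\<mu>. s t) \<le> C * (1 - r) powr (- (1 - b))"
    using log_carleson_kernel_bound[OF mu carl g, of "1 - b"] b by auto
  have "cone_weight b z * cmod (deriv (cesaro_op \<mu> f) z) \<le> (8 * 2 powr b * C) * B"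
    if f: "f \<in> hol_disc" and B: "0 \<le> B"
      and growth: "\<forall>w\<in>\<D>. cmod (f w) \<le> B * ln (exp 1 / (1 - cmod w)) powr g" and z: "z \<in> \<D>" for f B z
  proof -
    define r where "r = cmod z"
    have r: "r \<in> {0..<1}" using z by (simp add: r_def)
    obtain s where s: "integrable \<mu> s" "(LINT t|\<mu>. s t) \<le> C * (1 - r) powr (- (1 - b))"
      and s_ge: "\<And>t. t \<in> {0..<1} \<Longrightarrow>
        ln (exp 1 / (1 - t * r)) powr g * (1 - t * r) powr (- (1 + (1 - b))) \<le> s t"
      using step[OF r] by blast
    define W where "W = (cmod (1 - z) / 2) powr (- b)"
    have z1: "0 < cmod (1 - z)" using one_minus_norm_le[of z] z by auto
    let ?F = "\<lambda>t. of_real t * deriv (\<lambda>w. f w / (1 - w)) (of_real t * z)"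
    have pw: "cmod (?F t) \<le> 8 * B * W * s t" if t: "t \<in> space \<mu>" for t
    proof -
      have t01: "t \<in> {0..<1}" using t mu'(2) by simp
      have tz: "of_real t * z \<in> \<D>" by (rule cesaro_scaled_in_disc[OF mu f t z])
      have ntz: "cmod (of_real t * z) = t * r" using t01 by (simp add: norm_mult r_def)
      have tr: "0 \<le> t * r" "t * r < 1" using tz ntz t01 r by auto
      have "t * r \<le> t" using t01 r by (simp add: mult_left_le)
      have d1: "1 - t * r \<le> cmod (1 - of_real t * z)"
        using one_minus_norm_le[of "of_real t * z"] ntz by simp
      have d2: "cmod (1 - z) / 2 \<le> cmod (1 - of_real t * z)"
      proof -
        have "1 - z = (1 - of_real t * z) - of_real (1 - t) * z" by (simp add: algebra_simps)
        then have "cmod (1 - z) \<le> cmod (1 - of_real t * z) + cmod (of_real (1 - t) * z)"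
          by (metis norm_triangle_ineq4)
        also have "cmod (of_real (1 - t) * z) = (1 - t) * r" using t01 by (simp only: norm_mult norm_of_real r_def) simp
        also have "(1 - t) * r \<le> 1 - t" using t01 r by (simp add: mult_left_le)
        also have "\<dots> \<le> cmod (1 - of_real t * z)" using d1 \<open>t * r \<le> t\<close> by linarith
        finally show ?thesis by simp
      qed
      have den: "1 / cmod (1 - of_real t * z) \<le> (1 - t * r) powr (- (1 - b)) * W"
      proof -
        have "1 / cmod (1 - of_real t * z) = cmod (1 - of_real t * z) powr (- (1 - b)) * cmod (1 - of_real t * z) powr (- b)"
        proof -
          have "cmod (1 - of_real t * z) powr (- (1 - b)) * cmod (1 - of_real t * z) powr (- b) =
              cmod (1 - of_real t * z) powr (- (1 - b) + - b)" by (simp only: powr_add)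
          also have "- (1 - b) + - b = - 1" by simp
          also have "cmod (1 - of_real t * z) powr (- 1) = 1 / cmod (1 - of_real t * z)"
            using d1 tr by (simp only: powr_minus_divide powr_one norm_ge_zero)
          finally show ?thesis by simp
        qed
        also have "\<dots> \<le> (1 - t * r) powr (- (1 - b)) * W"
          unfolding W_def using d1 d2 tr z1 b by (intro mult_mono powr_mono2') auto
        finally show ?thesis .
      qed
      have "cmod (?F t) \<le> 1 * cmod (deriv (\<lambda>w. f w / (1 - w)) (of_real t * z))"
        unfolding norm_mult using t01 by (intro mult_right_mono) auto
      also have "\<dots> \<le> 8 * B * ln (exp 1 / (1 - t * r)) powr g / ((1 - t * r) * cmod (1 - of_real t * z))"
        using deriv_quotient_bound[OF f g B _ tz] growth ntz by simp
      also have "\<dots> = 8 * B * ln (exp 1 / (1 - t * r)) powr g * (1 / (1 - t * r)) * (1 / cmod (1 - of_real t * z))"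
        by simp
      also have "\<dots> \<le> 8 * B * ln (exp 1 / (1 - t * r)) powr g * (1 / (1 - t * r)) * ((1 - t * r) powr (- (1 - b)) * W)"
        using B tr by (intro mult_left_mono den) auto
      also have "\<dots> = 8 * B * W * (ln (exp 1 / (1 - t * r)) powr g * ((1 - t * r) powr (-1) * (1 - t * r) powr (- (1 - b))))"
        using tr by (simp add: powr_minus_divide)
      also have "(1 - t * r) powr (-1) * (1 - t * r) powr (- (1 - b)) = (1 - t * r) powr (- (1 + (1 - b)))"
      proof -
        have "(1 - t * r) powr (-1) * (1 - t * r) powr (- (1 - b)) = (1 - t * r) powr (-1 + - (1 - b))"
          by (simp only: powr_add)
        also have "-1 + - (1 - b) = - (1 + (1 - b))" by simp
        finally show ?thesis .
      qed
      also have "8 * B * W * (ln (exp 1 / (1 - t * r)) powr g * (1 - t * r) powr (- (1 + (1 - b)))) \<le> 8 * B * W * s t"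
        using B s_ge[OF t01] by (intro mult_left_mono) (auto simp: W_def)
      finally show ?thesis .
    qed
    have "cmod (deriv (cesaro_op \<mu> f) z) = cmod (LINT t|\<mu>. ?F t)"
      by (subst DERIV_imp_deriv[OF cesaro_op_has_derivative(2)[OF mu f z]]) (rule refl)
    also have "\<dots> \<le> (LINT t|\<mu>. cmod (?F t))" by (rule integral_norm_bound)
    also have "\<dots> \<le> (LINT t|\<mu>. 8 * B * W * s t)"
      by (rule integral_mono[OF integrable_norm[OF cesaro_op_has_derivative(1)[OF mu f z]]
            integrable_mult_right[OF s(1)] pw])
    also have "\<dots> = 8 * B * W * (LINT t|\<mu>. s t)" by (rule integral_mult_right_zero)
    also have "\<dots> \<le> 8 * B * W * (C * (1 - r) powr (- (1 - b)))"
      using B s(2) by (intro mult_left_mono) (auto simp: W_def)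
    finally have "cone_weight b z * cmod (deriv (cesaro_op \<mu> f) z) \<le>
        cone_weight b z * (8 * B * W * (C * (1 - r) powr (- (1 - b))))"
      by (intro mult_left_mono) (auto simp: cone_weight_def)
    also have "\<dots> = (8 * 2 powr b * C) * B"
    proof -
      have "W = 2 powr b * cmod (1 - z) powr (- b)"
        using z1 by (simp add: W_def powr_divide powr_minus divide_simps)
      then have "cone_weight b z * (8 * B * W * (C * (1 - r) powr (- (1 - b)))) =
          (8 * 2 powr b * C) * B * (((1 - r) powr (1 - b) * (1 - r) powr (- (1 - b))) *
          (cmod (1 - z) powr b * cmod (1 - z) powr (- b)))"
        by (simp add: cone_weight_def r_def mult_ac)
      also have "(1 - r) powr (1 - b) * (1 - r) powr (- (1 - b)) = 1"
        using r by (simp only: powr_add[symmetric]) simp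
      also have "cmod (1 - z) powr b * cmod (1 - z) powr (- b) = 1"
        using z1 by (simp only: powr_add[symmetric]) simp
      finally show ?thesis by simp
    qed
    finally show ?thesis .
  qed
  then show ?thesis using C by (intro exI[of _ "8 * 2 powr b * C"] conjI) auto
qed

theorem cesaro_bounded_into_weighted_bloch:
  fixes p q b :: real
  assumes p: "1 < p" and pq: "1 / p + 1 / q = 1"
    and mu: "finite_borel_measure_01 \<mu>" and carl: "log_carleson (1 / q) 1 \<mu>"
    and b: "0 \<le> b" "b < 1"
  shows "\<exists>C. \<forall>f\<in>besov p. cesaro_op \<mu> f \<in> weighted_bloch (cone_weight b) \<and>
     weighted_bloch_norm (cone_weight b) (cesaro_op \<mu> f) \<le> C * besov_norm p f"
proof -
  note mu' = finite_borel_measure_01D[OF mu]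
  interpret finite_measure \<mu> by (rule mu')
  note q = conjugate_exponent[OF p pq]
  obtain G where G: "0 < G" "\<forall>f\<in>besov p. \<forall>z\<in>\<D>.
      cmod (f z) \<le> G * besov_norm p f * ln (exp 1 / (1 - cmod z)) powr (1 / q)"
    using besov_growth[OF p pq] by blast
  obtain C where C: "\<forall>f\<in>hol_disc. \<forall>B\<ge>0.
     (\<forall>w\<in>\<D>. cmod (f w) \<le> B * ln (exp 1 / (1 - cmod w)) powr (1 / q)) \<longrightarrow>
     (\<forall>z\<in>\<D>. cone_weight b z * cmod (deriv (cesaro_op \<mu> f) z) \<le> C * B)"
    using cesaro_deriv_bound[OF mu carl _ _ b] q by (meson less_imp_le)
  define m where "m = measure \<mu> (space \<mu>)"
  have "cesaro_op \<mu> f \<in> weighted_bloch (cone_weight b)"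
    "weighted_bloch_norm (cone_weight b) (cesaro_op \<mu> f) \<le> (m + C * G) * besov_norm p f"
    if f: "f \<in> besov p" for f
  proof -
    have fh: "f \<in> hol_disc" using f by (simp add: besov_def)
    have d: "cone_weight b z * cmod (deriv (cesaro_op \<mu> f) z) \<le> C * (G * besov_norm p f)" if "z \<in> \<D>" for z
      using C fh G f that besov_norm_nonneg[of p f] by simp
    note wb = weighted_bloch_norm_le[OF cesaro_op_hol_disc[OF mu fh] d]
    show "cesaro_op \<mu> f \<in> weighted_bloch (cone_weight b)" by (rule wb(1))
    have "cmod (cesaro_op \<mu> f 0) = m * cmod (f 0)"
      using cesaro_op_eq_integral(2)[OF mu fh, of 0] by (simp add: m_def norm_mult)
    also have "\<dots> \<le> m * besov_norm p f"
      by (intro mult_left_mono) (auto simp: m_def besov_norm_def)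
    finally show "weighted_bloch_norm (cone_weight b) (cesaro_op \<mu> f) \<le> (m + C * G) * besov_norm p f"
      using wb(2) by (simp add: distrib_right mult.assoc)
  qed
  then show ?thesis by blast
qed

section \<open>Logarithmic test functions\<close>

definition log_test :: "real \<Rightarrow> complex \<Rightarrow> complex" where
  "log_test a z = (if z \<in> \<D> then 1 - Ln (1 - of_real a * z) else 0)"

lemma log_test_deriv:
  assumes a: "0 < a" "a < 1" and z: "z \<in> \<D>"
  shows "(log_test a has_field_derivative of_real a / (1 - of_real a * z)) (at z)"
proof -
  have "a * cmod z < 1 * 1" using a z by (intro mult_strict_mono) auto
  moreover have "a * Re z \<le> a * cmod z"
    using a complex_Re_le_cmod[of z] by (intro mult_left_mono) auto
  ultimately have "0 < Re (1 - of_real a * z)" by simp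
  then have "1 - of_real a * z \<notin> \<real>\<^sub>\<le>\<^sub>0" by (auto simp: complex_nonpos_Reals_iff)
  then have "((\<lambda>z. 1 - Ln (1 - of_real a * z)) has_field_derivative of_real a / (1 - of_real a * z)) (at z)"
    by (auto intro!: derivative_eq_intros simp: divide_inverse)
  then show ?thesis
    by (rule has_field_derivative_transform_within_open[of _ _ _ \<D>]) (use z in \<open>auto simp: log_test_def\<close>)
qed

lemma log_test_hol_disc: "0 < a \<Longrightarrow> a < 1 \<Longrightarrow> log_test a \<in> hol_disc"
  unfolding hol_disc_def holomorphic_on_open[OF open_ball]
  using log_test_deriv by (intro CollectI conjI ballI allI impI) (blast, simp add: log_test_def)

text \<open>
Up to the factor \<open>a powr p\<close> the Besov integrand is the one of the logarithmic Forelli-Rudin estimate at the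
point \<open>a\<close>.
\<close>
lemma log_test_besov:
  fixes p :: real
  assumes p: "1 < p"
  shows "\<exists>C>0. \<forall>a\<in>{0<..<1}. log_test a \<in> besov p \<and>
    besov_norm p (log_test a) \<le> C * ln (exp 1 / (1 - a)) powr (1 / p)"
proof -
  obtain K where K: "0 < K" "\<And>z. z \<in> \<D> \<Longrightarrow>
      (\<integral>\<^sup>+w. ennreal ((1 - (cmod w)\<^sup>2) powr (p - 2) * cmod (1 - z * cnj w) powr (-p)) \<partial>disc_area)
      \<le> ennreal (K * ln (exp 1 / (1 - cmod z)))"
    using Forelli_Rudin_log[OF p] by (elim exE conjE) auto
  have "log_test a \<in> besov p \<and>
    besov_norm p (log_test a) \<le> (1 + K powr (1 / p)) * ln (exp 1 / (1 - a)) powr (1 / p)"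
    if a: "a \<in> {0<..<1}" for a
  proof -
    have h: "log_test a \<in> hol_disc" using a by (intro log_test_hol_disc) auto
    define L where "L = ln (exp 1 / (1 - a))"
    have L: "1 \<le> L" unfolding L_def using a by (intro one_le_log_weight) auto
    let ?B = "\<lambda>w. indicator \<D> w *\<^sub>R besov_integrand p (log_test a) w"
    have Bnn: "0 \<le> ?B w" for w by (auto simp: besov_integrand_def indicator_def)
    have Beq: "?B w = cmod (indicator \<D> w *\<^sub>R deriv (log_test a) w) powr p * (1 - (cmod w)\<^sup>2) powr (p - 2)" for w
      using p by (cases "w \<in> \<D>") (auto simp: besov_integrand_def)
    have [measurable]: "(\<lambda>w. cmod (indicator \<D> w *\<^sub>R deriv (log_test a) w)) \<in> borel_measurable borel"
      by (rule measurable_compose[OF hol_disc_deriv_measurable[OF h] borel_measurable_norm])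
    have Bm: "?B \<in> borel_measurable disc_area" unfolding Beq measurable_cong_sets[OF sets_disc_area refl]
      by (intro borel_measurable_times powr_real_measurable borel_measurable_const
          measurable_compose[OF hol_disc_deriv_measurable[OF h] borel_measurable_norm]) measurable
    have Ble: "?B w \<le> (1 - (cmod w)\<^sup>2) powr (p - 2) * cmod (1 - of_real a * cnj w) powr (-p)" for w
    proof (cases "w \<in> \<D>")
      case True
      have "cnj (1 - of_real a * w) = 1 - of_real a * cnj w" by simp
      then have "cmod (1 - of_real a * w) = cmod (1 - of_real a * cnj w)" by (metis complex_mod_cnj)
      moreover have "a powr p \<le> 1" using a p by (intro powr_le1) auto
      moreover have "deriv (log_test a) w = of_real a / (1 - of_real a * w)"
        by (rule DERIV_imp_deriv[OF log_test_deriv]) (use a True in auto)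
      then have "cmod (deriv (log_test a) w) = a / cmod (1 - of_real a * w)"
        using a by (simp add: norm_divide)
      ultimately have "cmod (deriv (log_test a) w) powr p \<le> 1 / cmod (1 - of_real a * cnj w) powr p"
        by (simp add: powr_divide divide_right_mono)
      then have "cmod (deriv (log_test a) w) powr p \<le> cmod (1 - of_real a * cnj w) powr (-p)"
        by (simp only: powr_minus_divide)
      then have "cmod (deriv (log_test a) w) powr p * (1 - (cmod w)\<^sup>2) powr (p - 2) \<le>
          cmod (1 - of_real a * cnj w) powr (-p) * (1 - (cmod w)\<^sup>2) powr (p - 2)"
        by (rule mult_right_mono) simp
      then show ?thesis using True by (simp add: besov_integrand_def mult.commute)
    qed simp
    have "(\<integral>\<^sup>+w. ennreal (?B w) \<partial>disc_area) \<le>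
        (\<integral>\<^sup>+w. ennreal ((1 - (cmod w)\<^sup>2) powr (p - 2) * cmod (1 - of_real a * cnj w) powr (-p)) \<partial>disc_area)"
      by (intro nn_integral_mono ennreal_leI Ble)
    also have "\<dots> \<le> ennreal (K * L)"
      using K(2)[of "of_real a"] a by (simp add: L_def)
    finally have nn: "(\<integral>\<^sup>+w. ennreal (?B w) \<partial>disc_area) \<le> ennreal (K * L)" .
    have int: "integrable disc_area ?B"
    proof (rule integrableI_bounded[OF Bm])
      have "(\<integral>\<^sup>+w. ennreal (norm (?B w)) \<partial>disc_area) = (\<integral>\<^sup>+w. ennreal (?B w) \<partial>disc_area)"
        by (intro nn_integral_cong arg_cong[of _ _ ennreal]) (use Bnn in \<open>simp only: real_norm_def abs_of_nonneg\<close>)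
      also have "\<dots> < \<infinity>" using nn by (rule le_less_trans) simp
      finally show "(\<integral>\<^sup>+w. ennreal (norm (?B w)) \<partial>disc_area) < \<infinity>" .
    qed
    have "(LINT w|disc_area. ?B w) \<le> K * L"
    proof -
      have "ennreal (LINT w|disc_area. ?B w) = (\<integral>\<^sup>+w. ennreal (?B w) \<partial>disc_area)"
        by (rule nn_integral_eq_integral[symmetric, OF int]) (use Bnn in simp)
      with nn have "ennreal (LINT w|disc_area. ?B w) \<le> ennreal (K * L)" by (simp only:)
      then show ?thesis using K(1) L by (subst (asm) ennreal_le_iff) auto
    qed
    moreover have "0 \<le> (LINT w|disc_area. ?B w)"
      by (rule Bochner_Integration.integral_nonneg) (rule Bnn)
    ultimately have "(LINT w|disc_area. ?B w) powr (1 / p) \<le> (K * L) powr (1 / p)"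
      using p by (intro powr_mono2) auto
    then have "besov_norm p (log_test a) \<le> 1 + (K * L) powr (1 / p)"
      by (simp add: besov_norm_def set_lebesgue_integral_def log_test_def)
    also have "(K * L) powr (1 / p) = K powr (1 / p) * L powr (1 / p)"
      using K(1) L by (simp add: powr_mult)
    also have "1 + K powr (1 / p) * L powr (1 / p) \<le> (1 + K powr (1 / p)) * L powr (1 / p)"
      using L p by (simp add: distrib_right ge_one_powr_ge_zero)
    finally show ?thesis
      using h int by (simp add: besov_def set_integrable_def L_def)
  qed
  then show ?thesis by (intro exI[of _ "1 + K powr (1 / p)"]) (auto intro: add_pos_nonneg)
qed

text \<open>
At real points the integrand of the derivative formula is nonnegative. For \<open>t\<close> in \<open>[a,1)\<close> the point
\<open>t a\<close> is at least \<open>a\<^sup>2\<close>, where the quotient \<open>f / (1 - x)\<close> has derivative at least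
\<open>(1 - ln (1 - a ^ 3)) / (1 - a\<^sup>2)\<^sup>2\<close>.
\<close>
lemma cesaro_log_test_lower_bound:
  assumes mu: "finite_borel_measure_01 \<mu>" and a: "0 < a" "a < 1"
  shows "a * (1 - ln (1 - a ^ 3)) / (1 - a\<^sup>2)\<^sup>2 * measure \<mu> {a..<1} \<le>
     cmod (deriv (cesaro_op \<mu> (log_test a)) (of_real a))"
proof -
  note mu' = finite_borel_measure_01D[OF mu]
  interpret finite_measure \<mu> by (rule mu')
  have h: "log_test a \<in> hol_disc" using a by (rule log_test_hol_disc)
  have aD: "of_real a \<in> \<D>" using a by simp
  let ?F = "\<lambda>t. of_real t * deriv (\<lambda>w. log_test a w / (1 - w)) (of_real t * of_real a)"
  define c where "c = a * (1 - ln (1 - a ^ 3)) / (1 - a\<^sup>2)\<^sup>2"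
  have pw: "c * indicator {a..<1} t \<le> Re (?F t)" if t: "t \<in> space \<mu>" for t
  proof -
    have t01: "0 \<le> t" "t < 1" using t mu'(2) by auto
    define x where "x = t * a"
    have x: "0 \<le> x" "x < 1" "a * x < 1"
    proof -
      show "0 \<le> x" using t01 a by (simp add: x_def)
      have "t * a < 1 * 1" using t01 a by (intro mult_strict_mono) auto
      then show "x < 1" by (simp add: x_def)
      then have "a * x < 1 * 1" using a \<open>0 \<le> x\<close> by (intro mult_strict_mono) auto
      then show "a * x < 1" by simp
    qed
    have xD: "of_real x \<in> \<D>" using x by simp
    have "((\<lambda>w. log_test a w / (1 - w)) has_field_derivative
        (of_real a / (1 - of_real a * of_real x) * (1 - of_real x) - log_test a (of_real x) * (- 1)) /
        ((1 - of_real x) * (1 - of_real x))) (at (of_real x))"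
      by (rule DERIV_divide[OF log_test_deriv[OF a xD]]) (use x in \<open>auto intro!: derivative_eq_intros\<close>)
    then have "((\<lambda>w. log_test a w / (1 - w)) has_field_derivative
        (of_real a / (1 - of_real a * of_real x) * (1 - of_real x) + log_test a (of_real x)) /
        ((1 - of_real x) * (1 - of_real x))) (at (of_real x))"
      by simp
    then have "deriv (\<lambda>w. log_test a w / (1 - w)) (of_real x) =
        (of_real a / (1 - of_real a * of_real x) * (1 - of_real x) + log_test a (of_real x)) /
        ((1 - of_real x) * (1 - of_real x))"
      by (rule DERIV_imp_deriv)
    moreover have "log_test a (of_real x) = of_real (1 - ln (1 - a * x))"
    proof -
      have "Ln (1 - of_real a * of_real x) = of_real (ln (1 - a * x))"
        using Ln_of_real[of "1 - a * x"] x by simp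
      then show ?thesis using xD by (simp add: log_test_def)
    qed
    ultimately have "deriv (\<lambda>w. log_test a w / (1 - w)) (of_real x) =
        of_real ((a / (1 - a * x) * (1 - x) + (1 - ln (1 - a * x))) / ((1 - x) * (1 - x)))"
      by simp
    then have "?F t = of_real (t * ((a / (1 - a * x) * (1 - x) + (1 - ln (1 - a * x))) / ((1 - x) * (1 - x))))"
      by (simp add: x_def)
    then have Re: "Re (?F t) = t * ((a / (1 - a * x) * (1 - x) + (1 - ln (1 - a * x))) / ((1 - x) * (1 - x)))"
      by (simp only: Re_complex_of_real)
    have "0 \<le> a * x" using x a by simp
    then have "ln (1 - a * x) \<le> 0" using x(3) by simp
    then have l0: "0 \<le> 1 - ln (1 - a * x)" by simp
    have f0: "0 \<le> a / (1 - a * x) * (1 - x)" using x a by simp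
    show ?thesis
    proof (cases "a \<le> t")
      case False
      then show ?thesis unfolding Re using l0 f0 t01 x by simp
    next
      case True
      have ax: "a\<^sup>2 \<le> x" "a ^ 3 \<le> a * x"
        using True a by (auto simp: x_def power2_eq_square power3_eq_cube mult_right_mono mult_left_mono)
      have c: "c = a * ((1 - ln (1 - a ^ 3)) / ((1 - a\<^sup>2) * (1 - a\<^sup>2)))"
        by (simp add: c_def power2_eq_square)
      have "ln (1 - a ^ 3) \<le> 0" using ax x a by simp
      then have l3: "0 \<le> 1 - ln (1 - a ^ 3)" by linarith
      have "a * ((1 - ln (1 - a ^ 3)) / ((1 - a\<^sup>2) * (1 - a\<^sup>2))) \<le>
          t * ((a / (1 - a * x) * (1 - x) + (1 - ln (1 - a * x))) / ((1 - x) * (1 - x)))"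
      proof (intro mult_mono frac_le)
        have "ln (1 - a * x) \<le> ln (1 - a ^ 3)" using ax x by (intro ln_mono) auto
        then show "1 - ln (1 - a ^ 3) \<le> a / (1 - a * x) * (1 - x) + (1 - ln (1 - a * x))" using f0 by linarith
      qed (use True a ax x l0 l3 f0 t01 in \<open>auto intro!: divide_nonneg_nonneg mult_mono\<close>)
      with c show ?thesis unfolding Re using True t01 by simp
    qed
  qed
  note int = cesaro_op_has_derivative(1)[OF mu h aD]
  have sets: "{a..<1} \<in> sets \<mu>"
  proof -
    have "sets \<mu> = sets (restrict_space borel {0..<1})" using mu by (simp add: finite_borel_measure_01_def)
    then show ?thesis using a by (auto simp: sets_restrict_space_iff)
  qed
  have "c * measure \<mu> {a..<1} = (LINT t|\<mu>. c * indicator {a..<1} t)"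
    using sets sets.sets_into_space[OF sets] by (simp add: Int_absorb2)
  also have "\<dots> \<le> (LINT t|\<mu>. Re (?F t))"
    using sets by (intro integral_mono pw integrable_mult_right integrable_Re int) (auto simp: less_top[symmetric])
  also have "\<dots> = Re (LINT t|\<mu>. ?F t)" by (rule integral_Re[OF int])
  also have "\<dots> \<le> cmod (LINT t|\<mu>. ?F t)" by (rule complex_Re_le_cmod)
  also have "(LINT t|\<mu>. ?F t) = deriv (cesaro_op \<mu> (log_test a)) (of_real a)"
    by (rule DERIV_imp_deriv[symmetric, OF cesaro_op_has_derivative(2)[OF mu h aD]])
  finally show ?thesis by (simp add: c_def)
qed

text \<open>
Evaluating the hypothesis for the test function with parameter \<open>a\<close> at the point \<open>a\<close>. Since
\<open>1 - a ^ 3 \<le> 3 (1 - a)\<close>, the logarithm in the lower bound is at least a third of \<open>L = ln (exp 1 / (1 - a))\<close>. One factor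
\<open>L powr (1/p)\<close> is absorbed by the norm of the test function, which leaves \<open>L powr (1/q)\<close>. The values
\<open>a < 1/2\<close> are covered by finiteness of the measure.
\<close>
theorem log_carleson_of_bloch_bound:
  fixes p q C :: real
  assumes p: "1 < p" and pq: "1 / p + 1 / q = 1" and mu: "finite_borel_measure_01 \<mu>"
    and bound: "\<And>f z. f \<in> besov p \<Longrightarrow> z \<in> \<D> \<Longrightarrow>
      (1 - (cmod z)\<^sup>2) * cmod (deriv (cesaro_op \<mu> f) z) \<le> C * besov_norm p f"
  shows "log_carleson (1 / q) 1 \<mu>"
proof -
  note mu' = finite_borel_measure_01D[OF mu]
  interpret finite_measure \<mu> by (rule mu')
  note q = conjugate_exponent[OF p pq]
  obtain K where K: "0 < K" "\<And>a. a \<in> {0<..<1} \<Longrightarrow> log_test a \<in> besov p"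
    "\<And>a. a \<in> {0<..<1} \<Longrightarrow> besov_norm p (log_test a) \<le> K * ln (exp 1 / (1 - a)) powr (1 / p)"
    using log_test_besov[OF p] by blast
  define D where "D = max C 0"
  have D: "0 \<le> D" "C \<le> D" by (auto simp: D_def)
  define E where "E = max (12 * D * K) (measure \<mu> (space \<mu>) * ln (exp 1 * 2) powr (1 / q) * 2)"
  have "measure \<mu> {a..<1} * ln (exp 1 / (1 - a)) powr (1 / q) / (1 - a) powr 1 \<le> E"
    if a: "a \<in> {0..<1}" for a
  proof -
    define L where "L = ln (exp 1 / (1 - a))"
    have L: "1 \<le> L" unfolding L_def using a by (intro one_le_log_weight) auto
    define m where "m = measure \<mu> {a..<1}"
    have m0: "0 \<le> m" by (simp add: m_def)
    show ?thesis
    proof (cases "a < 1/2")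
      case True
      have "m \<le> measure \<mu> (space \<mu>)" unfolding m_def by (rule bounded_measure)
      moreover have "L \<le> ln (exp 1 * 2)"
        unfolding L_def using True a by (subst ln_le_cancel_iff) (auto simp: divide_le_eq)
      then have "L powr (1 / q) \<le> ln (exp 1 * 2) powr (1 / q)"
        using L q by (intro powr_mono2) auto
      ultimately have "m * L powr (1 / q) \<le> measure \<mu> (space \<mu>) * ln (exp 1 * 2) powr (1 / q)"
        by (intro mult_mono) auto
      then have "m * L powr (1 / q) / (1 - a) \<le> measure \<mu> (space \<mu>) * ln (exp 1 * 2) powr (1 / q) / (1/2)"
        using True m0 by (intro frac_le) auto
      then show ?thesis using True a by (simp add: E_def m_def L_def)
    next
      case False
      then have a': "a \<in> {0<..<1}" and ah: "1/2 \<le> a" using a by auto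
      have a01: "0 < a" "a < 1" using a' by auto
      have sq: "0 < 1 - a\<^sup>2" "1 - a\<^sup>2 \<le> 2 * (1 - a)"
      proof -
        have "a * a < 1 * 1" using a01 by (intro mult_strict_mono) auto
        then show "0 < 1 - a\<^sup>2" by (simp add: power2_eq_square)
        have "(1 - a) * (1 - a) \<ge> 0" by simp
        then show "1 - a\<^sup>2 \<le> 2 * (1 - a)" by (simp add: power2_eq_square algebra_simps)
      qed
      have l: "L / 3 \<le> 1 - ln (1 - a ^ 3)"
      proof -
        have a3: "0 < 1 - a ^ 3" "1 - a ^ 3 \<le> 1" "1 - a ^ 3 \<le> 3 * (1 - a)"
        proof -
          show "0 < 1 - a ^ 3" using a01 power_strict_mono[of a 1 3] by simp
          show "1 - a ^ 3 \<le> 1" using a01 by simp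
          have "1 - a ^ 3 = (1 - a) * (1 + a + a\<^sup>2)" by (simp add: power2_eq_square power3_eq_cube algebra_simps)
          also have "\<dots> \<le> (1 - a) * 3" using a01 sq(1) by (intro mult_left_mono) auto
          finally show "1 - a ^ 3 \<le> 3 * (1 - a)" by simp
        qed
        have "ln (1 - a ^ 3) \<le> 0" using a3 by simp
        moreover have "ln (1 - a ^ 3) \<le> ln (3 * (1 - a))" using a3 a01 by (subst ln_le_cancel_iff) auto
        moreover have "ln (3 * (1 - a)) = ln 3 + ln (1 - a)" using a01 by (intro ln_mult_pos) auto
        moreover have "ln 3 \<le> (2::real)" using ln_le_minus_one[of "3::real"] by simp
        moreover have "L = 1 - ln (1 - a)" using a01 by (simp add: L_def ln_div)
        ultimately show ?thesis by (cases "L \<le> 3") linarith+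
      qed
      have "(1 - a\<^sup>2) * (a * (1 - ln (1 - a ^ 3)) / (1 - a\<^sup>2)\<^sup>2 * m) \<le>
          (1 - (cmod (of_real a))\<^sup>2) * cmod (deriv (cesaro_op \<mu> (log_test a)) (of_real a))"
      proof -
        have "(cmod (of_real a))\<^sup>2 = a\<^sup>2" using a01 by simp
        then show ?thesis
          unfolding m_def using sq(1) by (simp only: mult_left_mono[OF cesaro_log_test_lower_bound[OF mu a01]] less_imp_le)
      qed
      also have "\<dots> \<le> C * besov_norm p (log_test a)"
        using a01 by (intro bound K(2)[OF a']) auto
      also have "\<dots> \<le> D * besov_norm p (log_test a)"
        by (intro mult_right_mono D besov_norm_nonneg)
      also have "\<dots> \<le> D * (K * L powr (1 / p))"
        unfolding L_def by (intro mult_left_mono K(3)[OF a'] D)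
      finally have "(1 - a\<^sup>2) * (a * (1 - ln (1 - a ^ 3)) / (1 - a\<^sup>2)\<^sup>2 * m) \<le> D * (K * L powr (1 / p))" .
      moreover have "(1 - a\<^sup>2) * (a * (1 - ln (1 - a ^ 3)) / (1 - a\<^sup>2)\<^sup>2 * m) = a * (1 - ln (1 - a ^ 3)) * m / (1 - a\<^sup>2)"
        using sq(1) by (simp add: power2_eq_square)
      ultimately have "a * (1 - ln (1 - a ^ 3)) * m / (1 - a\<^sup>2) \<le> D * (K * L powr (1 / p))"
        by (simp only:)
      then have "a * (1 - ln (1 - a ^ 3)) * m \<le> D * (K * L powr (1 / p)) * (1 - a\<^sup>2)"
        using sq(1) by (simp only: pos_divide_le_eq)
      also have "\<dots> \<le> D * (K * L powr (1 / p)) * (2 * (1 - a))"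
        using D K(1) by (intro mult_left_mono sq(2)) auto
      finally have *: "a * (1 - ln (1 - a ^ 3)) * m \<le> D * (K * L powr (1 / p)) * (2 * (1 - a))" .
      have "1/2 * (L / 3) * m \<le> a * (1 - ln (1 - a ^ 3)) * m"
        using ah l L m0 by (intro mult_right_mono mult_mono) auto
      with * have "6 * (1/2 * (L / 3) * m) \<le> 6 * (D * (K * L powr (1 / p)) * (2 * (1 - a)))" by linarith
      also have "\<dots> = 12 * D * K * L powr (1 / p) * (1 - a)" by (simp add: algebra_simps)
      finally have "L * m \<le> 12 * D * K * L powr (1 / p) * (1 - a)" by simp
      also have "L * m = L powr (1 / p) * (m * L powr (1 / q))"
      proof -
        have "L = L powr (1 / p + 1 / q)" using pq L by simp
        also have "\<dots> = L powr (1 / p) * L powr (1 / q)" by (rule powr_add)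
        finally show ?thesis by simp
      qed
      finally have "L powr (1 / p) * (m * L powr (1 / q)) \<le> L powr (1 / p) * (12 * D * K * (1 - a))"
        by (simp add: algebra_simps)
      then have "m * L powr (1 / q) \<le> 12 * D * K * (1 - a)"
        using L by simp
      then have "m * L powr (1 / q) / (1 - a) \<le> 12 * D * K" using a01 by (simp add: divide_le_eq)
      then show ?thesis using a01 by (simp add: E_def m_def L_def)
    qed
  qed
  then show ?thesis by (auto simp: log_carleson_def bdd_above_def intro!: exI[of _ E])
qed

section \<open>The characterization\<close>

theorem theorem3p1:
  fixes p q s :: real
    and X :: "(complex \<Rightarrow> complex) set"
    and N :: "(complex \<Rightarrow> complex) \<Rightarrow> real"
    and \<mu> :: "real measure"
  assumes "1 < p" and "1 < s"
    and "1 / p + 1 / q = 1"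
    and "banach_space_of_analytic_functions X N"
    and "mean_lipschitz s \<subseteq> X" and "X \<subseteq> bloch"
    and "finite_borel_measure_01 \<mu>"
  shows "bounded_operator (besov p) (besov_norm p) X N (cesaro_op \<mu>) \<longleftrightarrow>
         log_carleson (1 / q) 1 \<mu>"
proof
  assume bdd: "bounded_operator (besov p) (besov_norm p) X N (cesaro_op \<mu>)"
  let ?w = "\<lambda>z. 1 - (cmod z)\<^sup>2"
  have w: "1 - cmod z \<le> ?w z" if "z \<in> \<D>" for z
    using that by (simp add: power2_eq_square mult_left_le)
  obtain A where A: "0 \<le> A" "\<forall>f\<in>X. weighted_bloch_norm ?w f \<le> A * N f"
    using continuous_inclusion[OF assms(4) banach_space_weighted_bloch[OF w]] assms(6)
    unfolding bloch_eq_weighted_bloch by blast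
  obtain C where C: "\<forall>f\<in>besov p. N (cesaro_op \<mu> f) \<le> C * besov_norm p f"
    and TX: "\<forall>f\<in>besov p. cesaro_op \<mu> f \<in> X"
    using bdd by (auto simp: bounded_operator_def)
  show "log_carleson (1 / q) 1 \<mu>"
  proof (rule log_carleson_of_bloch_bound[OF assms(1,3,7)])
    fix f z assume f: "f \<in> besov p" and z: "z \<in> \<D>"
    have "cesaro_op \<mu> f \<in> weighted_bloch ?w"
      using f TX assms(6) unfolding bloch_eq_weighted_bloch by blast
    then have "?w z * cmod (deriv (cesaro_op \<mu> f) z) \<le>
        weighted_bloch_norm ?w (cesaro_op \<mu> f) - cmod (cesaro_op \<mu> f 0)"
      using z by (rule weighted_bloch_bound)
    also have "\<dots> \<le> weighted_bloch_norm ?w (cesaro_op \<mu> f)" by simp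
    also have "\<dots> \<le> A * N (cesaro_op \<mu> f)" using A f TX by blast
    also have "\<dots> \<le> A * (C * besov_norm p f)" using A C f by (intro mult_left_mono) auto
    finally show "?w z * cmod (deriv (cesaro_op \<mu> f) z) \<le> (A * C) * besov_norm p f"
      by (simp add: mult.assoc)
  qed
next
  assume carl: "log_carleson (1 / q) 1 \<mu>"
  \<comment> \<open>Any \<open>b\<close> strictly between \<open>1 / s\<close> and \<open>1\<close> would do.\<close>
  define b where "b = (1 + 1 / s) / 2"
  have s1: "0 < 1 / s" "1 / s < 1" using assms(2) by auto
  have b: "0 \<le> b" "b < 1" using s1 by (auto simp: b_def)
  have bs: "1 < b * s" using assms(2) by (simp add: b_def field_simps)
  have YX: "weighted_bloch (cone_weight b) \<subseteq> X"
    using weighted_bloch_subset_mean_lipschitz[OF assms(2) b bs] assms(5) by blast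
  obtain A where A: "0 \<le> A"
      "\<forall>f\<in>weighted_bloch (cone_weight b). N f \<le> A * weighted_bloch_norm (cone_weight b) f"
    using continuous_inclusion[OF banach_space_weighted_bloch[OF cone_weight_ge[OF b(1)]] assms(4) YX]
    by blast
  obtain C where C: "\<forall>f\<in>besov p. cesaro_op \<mu> f \<in> weighted_bloch (cone_weight b) \<and>
     weighted_bloch_norm (cone_weight b) (cesaro_op \<mu> f) \<le> C * besov_norm p f"
    using cesaro_bounded_into_weighted_bloch[OF assms(1,3,7) carl b] by blast
  have hol: "f \<in> hol_disc" if "f \<in> besov p" for f using that by (simp add: besov_def)
  have "N (cesaro_op \<mu> f) \<le> (A * C) * besov_norm p f" if f: "f \<in> besov p" for f
  proof -
    have "N (cesaro_op \<mu> f) \<le> A * weighted_bloch_norm (cone_weight b) (cesaro_op \<mu> f)"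
      using A C f by blast
    also have "\<dots> \<le> A * (C * besov_norm p f)" using A C f by (intro mult_left_mono) auto
    finally show ?thesis by (simp add: mult.assoc)
  qed
  moreover have "cesaro_op \<mu> f \<in> X" if "f \<in> besov p" for f using C YX that by blast
  ultimately show "bounded_operator (besov p) (besov_norm p) X N (cesaro_op \<mu>)"
    unfolding bounded_operator_def
  proof (intro conjI ballI allI)
    show "cesaro_op \<mu> (\<lambda>z. f z + g z) = (\<lambda>z. cesaro_op \<mu> f z + cesaro_op \<mu> g z)"
      if "f \<in> besov p" "g \<in> besov p" for f g
      by (rule cesaro_op_add[OF assms(7) hol hol]) fact+
    show "cesaro_op \<mu> (\<lambda>z. c * f z) = (\<lambda>z. c * cesaro_op \<mu> f z)" if "f \<in> besov p" for c f
      by (rule cesaro_op_cmult[OF assms(7) hol[OF that]])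
  qed blast+
qed

end
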